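(* Let $H$ be a real Hilbert space and let $A$ be a self-adjoint nonnegative operator on $H$ with dense domain (with $\{e_k\}$, $\lambda_k$, and the spaces $\mathcal{G}_{\varphi,r,\alpha}(A)$, $\mathcal{G}_{\varphi,\infty,\alpha}(A)$ as described in the context). Let $\omega$ be a continuity modulus, let $m:[0,+\infty)\to[0,+\infty)$ be a function for which there exists a constant $L\in\mathbb{R}$ such that $|m(a)-m(b)|\leq L\,\omega(|a-b|)$ for all $a\geq 0$, $b\geq 0$, and let $\varphi:[0,+\infty)\to(0,+\infty)$ be any function. Assume that there exists a constant $\Lambda$ such that at least one of the following holds: (i) (strictly hyperbolic case) there exists $\nu>0$ with $m(\sigma)\geq\nu$ for every $\sigma\geq 0$, and $\sigma\,\omega(1/\sigma)\leq\Lambda\,\varphi(\sigma)$ for every $\sigma>0$; (ii) (weakly hyperbolic case) $m(\sigma)\geq 0$ for every $\sigma\geq 0$, and $\sigma\leq\Lambda\,\varphi\big(\sigma/\sqrt{\omega(1/\sigma)}\big)$ for every $\sigma>0$. Then for every pair of initial data $$(u_0,u_1)\in\mathcal{G}_{\varphi,\infty,3/4}(A)\times\mathcal{G}_{\varphi,\infty,1/4}(A)$$ there exist two pairs of initial data $(\overline{u}_0,\overline{u}_1)$ and $(\widehat{u}_0,\widehat{u}_1)$ in $\mathcal{G}_{\varphi,\infty,3/4}(A)\times\mathcal{G}_{\varphi,\infty,1/4}(A)$ such that $u_0=\overline{u}_0+\widehat{u}_0$, $u_1=\overline{u}_1+\widehat{u}_1$, and such that for each of the two choices $(v_0,v_1)=(\overline{u}_0,\overline{u}_1)$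 and $(v_0,v_1)=(\widehat{u}_0,\widehat{u}_1)$ the Cauchy problem $$u''(t)+m\big(|A^{1/2}u(t)|^2\big)Au(t)=0\quad(t\geq 0),\qquad u(0)=v_0,\quad u'(0)=v_1,$$ admits a global solution.
   Context: Hilbert space setting. $H$ is a real Hilbert space with norm $|x|$ and scalar product $\langle x,y\rangle$. $A$ is an unbounded linear operator on $H$ with dense domain $D(A)$, self-adjoint and nonnegative, so that $A^\alpha$ is defined on $D(A^\alpha)$ for every $\alpha\geq 0$. It is assumed that $H$ admits a countable complete orthonormal system $\{e_k\}_{k\geq 1}$ made of eigenvectors of $A$, with $Ae_k=\lambda_k^2e_k$ and $\lambda_k\geq 0$. For $u\in H$ write $u_k=\langle u,e_k\rangle$, so $u=\sum_{k\ge1} u_ke_k$, and $D(A^\alpha)=\{u\in H:\sum_{k}\lambda_k^{4\alpha}u_k^2<+\infty\}$. Spaces. For $\varphi:[0,+\infty)\to(0,+\infty)$, $\alpha\geq 0$, $r>0$, set $$\|u\|_{\varphi,r,\alpha}^2:=\sum_{k=1}^\infty\lambda_k^{4\alpha}u_k^2\exp\big(r\varphi(\lambda_k)\big),\qquad \mathcal{G}_{\varphi,r,\alpha}(A):=\{u\in H:\|u\|_{\varphi,r,\alpha}^2<+\infty\},$$ a Hilbert space with norm $(|u|^2+\|u\|_{\varphi,r,\alpha}^2)^{1/2}$, and $\mathcal{G}_{\varphi,\infty,\alpha}(A):=\bigcap_{r>0}\mathcal{G}_{\varphi,r,\alpha}(A)$. Continuity modulus. A continuity modulus is a continuous increasing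 function $\omega:[0,+\infty)\to[0,+\infty)$ such that $\omega(0)=0$ (with $\omega(x)>0$ for $x>0$) and $\omega(a+b)\leq\omega(a)+\omega(b)$ for all $a,b\geq 0$. Solutions. A global solution is a function $u\in C^1([0,+\infty);\mathcal{G}_{\varphi,r,1/4}(A))\cap C^0([0,+\infty);\mathcal{G}_{\varphi,r,3/4}(A))$ for every $r>0$ which attains the initial data and satisfies the equation componentwise: each Fourier component $u_k(t)=\langle u(t),e_k\rangle$ is of class $C^2$ and satisfies $u_k''(t)+m(|A^{1/2}u(t)|^2)\lambda_k^2u_k(t)=0$ for all $t\geq 0$. *)

theory Defs
  imports "HOL-Analysis.Analysis"
begin

section \<open>Self-adjoint operators with a complete system of eigenvectors\<close>

text \<open>An unbounded operator is given by its domain \<open>D\<close> together with a function \<open>A\<close>, whose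
  values outside \<open>D\<close> are irrelevant.\<close>

definition linear_operator :: "'a::real_vector set \<Rightarrow> ('a \<Rightarrow> 'a) \<Rightarrow> bool" where
  "linear_operator D A \<longleftrightarrow>
     subspace D \<and> (\<forall>x\<in>D. \<forall>y\<in>D. A (x + y) = A x + A y) \<and> (\<forall>c. \<forall>x\<in>D. A (c *\<^sub>R x) = c *\<^sub>R A x)"

definition adjoint_graph :: "'a::real_inner set \<Rightarrow> ('a \<Rightarrow> 'a) \<Rightarrow> ('a \<times> 'a) set" where
  "adjoint_graph D A = {(v, w). \<forall>u\<in>D. inner (A u) v = inner u w}"

definition self_adjoint :: "'a::real_inner set \<Rightarrow> ('a \<Rightarrow> 'a) \<Rightarrow> bool" where
  "self_adjoint D A \<longleftrightarrow>
     linear_operator D A \<and> closure D = UNIV \<and> adjoint_graph D A = {(v, A v) | v. v \<in> D}"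

definition nonnegative_operator :: "'a::real_inner set \<Rightarrow> ('a \<Rightarrow> 'a) \<Rightarrow> bool" where
  "nonnegative_operator D A \<longleftrightarrow> (\<forall>u\<in>D. inner (A u) u \<ge> 0)"

definition complete_orthonormal_system :: "(nat \<Rightarrow> 'a::real_inner) \<Rightarrow> bool" where
  "complete_orthonormal_system e \<longleftrightarrow>
     (\<forall>j k. inner (e j) (e k) = (if j = k then 1 else 0)) \<and> closure (span (range e)) = UNIV"

text \<open>Indices start at 0 rather than at 1. The eigenvalues of \<open>A\<close> are the squares
  \<open>(lam k)\<^sup>2\<close>.\<close>

definition eigen_system ::
  "'a::real_inner set \<Rightarrow> ('a \<Rightarrow> 'a) \<Rightarrow> (nat \<Rightarrow> 'a) \<Rightarrow> (nat \<Rightarrow> real) \<Rightarrow> bool" where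
  "eigen_system D A e lam \<longleftrightarrow> complete_orthonormal_system e \<and>
     (\<forall>k. lam k \<ge> 0 \<and> e k \<in> D \<and> A (e k) = (lam k)\<^sup>2 *\<^sub>R e k)"

text \<open>Real powers of nonnegative numbers with \<open>x\<^sup>0 = 1\<close> also for \<open>x = 0\<close>
  (whereas \<open>0 powr 0 = 0\<close>).\<close>

definition rpow :: "real \<Rightarrow> real \<Rightarrow> real" where
  "rpow x a = (if a = 0 then 1 else x powr a)"

text \<open>\<open>A\<^sup>\<alpha> u = \<Sum>\<^sub>k \<lambda>\<^sub>k\<^sup>2\<^sup>\<alpha> u\<^sub>k e\<^sub>k\<close>; meaningful when \<open>\<Sum>\<^sub>k \<lambda>\<^sub>k\<^sup>4\<^sup>\<alpha> u\<^sub>k\<^sup>2\<close> converges, that is,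
  for \<open>u\<close> in the domain of \<open>A\<^sup>\<alpha>\<close>.\<close>

definition frac_power ::
  "(nat \<Rightarrow> 'a::real_inner) \<Rightarrow> (nat \<Rightarrow> real) \<Rightarrow> real \<Rightarrow> 'a \<Rightarrow> 'a" where
  "frac_power e lam \<alpha> u = (\<Sum>k. (rpow (lam k) (2 * \<alpha>) * inner u (e k)) *\<^sub>R e k)"

section \<open>Generalized Gevrey spaces\<close>

definition gevrey_term ::
  "(nat \<Rightarrow> 'a::real_inner) \<Rightarrow> (nat \<Rightarrow> real) \<Rightarrow> (real \<Rightarrow> real) \<Rightarrow> real \<Rightarrow> real \<Rightarrow> 'a \<Rightarrow> nat \<Rightarrow> real" where
  "gevrey_term e lam \<phi> r \<alpha> u k =
     rpow (lam k) (4 * \<alpha>) * (inner u (e k))\<^sup>2 * exp (r * \<phi> (lam k))"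

text \<open>The terms are nonnegative, so finiteness of the sum is summability.\<close>

definition gevrey ::
  "(nat \<Rightarrow> 'a::real_inner) \<Rightarrow> (nat \<Rightarrow> real) \<Rightarrow> (real \<Rightarrow> real) \<Rightarrow> real \<Rightarrow> real \<Rightarrow> 'a set" where
  "gevrey e lam \<phi> r \<alpha> = {u. summable (gevrey_term e lam \<phi> r \<alpha> u)}"

definition gevrey_norm ::
  "(nat \<Rightarrow> 'a::real_inner) \<Rightarrow> (nat \<Rightarrow> real) \<Rightarrow> (real \<Rightarrow> real) \<Rightarrow> real \<Rightarrow> real \<Rightarrow> 'a \<Rightarrow> real" where
  "gevrey_norm e lam \<phi> r \<alpha> u = sqrt ((norm u)\<^sup>2 + (\<Sum>k. gevrey_term e lam \<phi> r \<alpha> u k))"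

definition gevrey_inf ::
  "(nat \<Rightarrow> 'a::real_inner) \<Rightarrow> (nat \<Rightarrow> real) \<Rightarrow> (real \<Rightarrow> real) \<Rightarrow> real \<Rightarrow> 'a set" where
  "gevrey_inf e lam \<phi> \<alpha> = (\<Inter>r\<in>{0<..}. gevrey e lam \<phi> r \<alpha>)"

section \<open>Global solutions\<close>

text \<open>\<open>C\<^sup>0([0,\<infinity>); X)\<close> and \<open>C\<^sup>1([0,\<infinity>); X)\<close> for a subspace \<open>X\<close> carrying its own norm \<open>N\<close>.\<close>

definition C0_in :: "'a::real_vector set \<Rightarrow> ('a \<Rightarrow> real) \<Rightarrow> (real \<Rightarrow> 'a) \<Rightarrow> bool" where
  "C0_in X N u \<longleftrightarrow>
     (\<forall>t\<ge>0. u t \<in> X) \<and> (\<forall>t\<ge>0. ((\<lambda>s. N (u s - u t)) \<longlongrightarrow> 0) (at t within {0..}))"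

definition C1_in :: "'a::real_vector set \<Rightarrow> ('a \<Rightarrow> real) \<Rightarrow> (real \<Rightarrow> 'a) \<Rightarrow> bool" where
  "C1_in X N u \<longleftrightarrow>
     (\<forall>t\<ge>0. u t \<in> X) \<and>
     (\<exists>u'. C0_in X N u' \<and>
        (\<forall>t\<ge>0. ((\<lambda>s. N ((u s - u t) /\<^sub>R (s - t) - u' t)) \<longlongrightarrow> 0) (at t within {0..})))"

text \<open>\<open>f\<close> is of class \<open>C\<^sup>2\<close> on \<open>[0,\<infinity>)\<close> with second derivative \<open>f2\<close>.\<close>

definition C2_with :: "(real \<Rightarrow> real) \<Rightarrow> (real \<Rightarrow> real) \<Rightarrow> bool" where
  "C2_with f f2 \<longleftrightarrow> continuous_on {0..} f2 \<and>
     (\<exists>f1. \<forall>t\<ge>0. (f has_real_derivative f1 t) (at t within {0..}) \<and>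
                 (f1 has_real_derivative f2 t) (at t within {0..}))"

definition global_solution ::
  "(nat \<Rightarrow> 'a::real_inner) \<Rightarrow> (nat \<Rightarrow> real) \<Rightarrow> (real \<Rightarrow> real) \<Rightarrow> (real \<Rightarrow> real) \<Rightarrow>
   'a \<Rightarrow> 'a \<Rightarrow> (real \<Rightarrow> 'a) \<Rightarrow> bool" where
  "global_solution e lam \<phi> m v0 v1 u \<longleftrightarrow>
     (\<forall>r>0. C1_in (gevrey e lam \<phi> r (1/4)) (gevrey_norm e lam \<phi> r (1/4)) u \<and>
            C0_in (gevrey e lam \<phi> r (3/4)) (gevrey_norm e lam \<phi> r (3/4)) u) \<and>
     u 0 = v0 \<and> (u has_vector_derivative v1) (at 0 within {0..}) \<and>
     (\<forall>k. \<exists>f2. C2_with (\<lambda>t. inner (u t) (e k)) f2 \<and>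
        (\<forall>t\<ge>0. f2 t + m ((norm (frac_power e lam (1/2) (u t)))\<^sup>2) * (lam k)\<^sup>2 * inner (u t) (e k) = 0))"

section \<open>Continuity moduli\<close>

definition continuity_modulus :: "(real \<Rightarrow> real) \<Rightarrow> bool" where
  "continuity_modulus \<omega> \<longleftrightarrow>
     continuous_on {0..} \<omega> \<and> mono_on {0..} \<omega> \<and> \<omega> 0 = 0 \<and> (\<forall>x>0. \<omega> x > 0) \<and>
     (\<forall>a\<ge>0. \<forall>b\<ge>0. \<omega> (a + b) \<le> \<omega> a + \<omega> b)"

end

theory Submission
  imports Defs "HOL-Complex_Analysis.Great_Picard"
begin

text \<open>Cut the frequencies at a very rapidly increasing sequence and give the blocks alternately to the two
  summands. Each summand then has gaps at arbitrarily high cutoffs \<open>\<rho>\<close>: the components above \<open>\<rho>\<close> lie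
  above the far end of the gap and are as small as we please in terms of \<open>\<rho>\<close> and of any prescribed time
  horizon \<open>T\<close>. Conservation of \<open>|u'|\<^sup>2 + M(|A\<^sup>1\<^sup>/\<^sup>2 u|\<^sup>2)\<close>, \<open>M' = m\<close>, bounds \<open>|u'|\<close>, hence \<open>|u|\<close> on \<open>[0, T]\<close>, hence
  the low frequency part of \<open>g = |A\<^sup>1\<^sup>/\<^sup>2 u|\<^sup>2\<close> and of \<open>g'\<close>. So \<open>g\<close> is Lipschitz as long as the high
  frequency part is of size 1, the coefficient \<open>m(g)\<close> has the modulus of continuity \<open>\<omega>\<close>, and the
  Colombini--De Giorgi--Spagnolo energy estimate shows that the high frequencies grow at most by a
  factor \<open>C exp (R \<phi>(\<lambda>))\<close>, which their initial smallness beats. On each horizon a solution is a fixed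
  point of the causal map \<open>g \<mapsto> |A\<^sup>1\<^sup>/\<^sup>2 u|\<^sup>2\<close>, where \<open>u\<close> solves the linear equation with coefficient
  \<open>m(g)\<close>; it exists by delaying \<open>g\<close> and compactness of Lipschitz functions. Solutions are not unique,
  so each horizon extends the solution already found on the previous one.\<close>

section \<open>Series and differential inequalities\<close>

text \<open>The obstacle is a circular dependence of constants. The Lipschitz constant available for
  \<open>g\<close> grows with the cutoff \<open>\<rho>\<close>, and the amplification
  \<open>C exp (R \<phi>)\<close> depends on that Lipschitz constant, so for general data a larger
  cutoff need not make the amplified tail above it small. For fixed \<open>C\<close> and
  \<open>R\<close>, however, the tail above some later cutoff is small, because the data lie in the
  spaces of every radius. Discarding the frequencies between the two cutoffs breaks the circle. A
  second circle: the bound on \<open>g\<close> comes from a conservation law, which holds only for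
  the nonlinear equation, whereas the linear estimates need a bound on \<open>g\<close> beforehand.
  It is broken by truncating the argument of \<open>m\<close> at a level \<open>bd\<close>. The
  truncated problem has its own conserved energy, the resulting bound on \<open>g\<close> does not
  involve \<open>bd\<close>, and so \<open>bd\<close> can be taken above it. Since \<open>m\<close>
  may vanish, the conserved energy is used to control \<open>|u'|\<close> only; the bound on
  \<open>|u|\<close> follows by Gronwall and grows with the horizon, so every horizon gets constants
  and a cutoff of its own.\<close>

lemma dominated_series_has_derivative:
  fixes f f' :: "nat \<Rightarrow> real \<Rightarrow> real"
  assumes "convex S"
    and "\<And>k t. t \<in> S \<Longrightarrow> (f k has_real_derivative f' k t) (at t within S)"
    and "\<And>k t. t \<in> S \<Longrightarrow> \<bar>f' k t\<bar> \<le> M k"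
    and "summable M" and "t0 \<in> S" and "summable (\<lambda>k. f k t0)" and t: "t \<in> S"
  shows "((\<lambda>t. \<Sum>k. f k t) has_real_derivative (\<Sum>k. f' k t)) (at t within S)"
    and "summable (\<lambda>k. f k t)"
proof -
  have "uniform_limit S (\<lambda>n t. \<Sum>i<n. f' i t) (\<lambda>t. \<Sum>i. f' i t) sequentially"
    by (rule Weierstrass_m_test[OF _ \<open>summable M\<close>]) (use assms(3) in auto)
  from has_field_derivative_series[OF assms(1,2) this assms(5,6)]
  obtain g where g: "\<And>x. x \<in> S \<Longrightarrow> (\<lambda>n. f n x) sums g x"
    "\<And>x. x \<in> S \<Longrightarrow> (g has_real_derivative (\<Sum>i. f' i x)) (at x within S)" by blast
  have eq: "g x = (\<Sum>k. f k x)" if "x \<in> S" for x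
    using g(1)[OF that] by (simp add: sums_iff)
  show "((\<lambda>t. \<Sum>k. f k t) has_real_derivative (\<Sum>k. f' k t)) (at t within S)"
    by (rule has_field_derivative_transform_within[OF g(2)[OF t] zero_less_one t]) (simp add: eq)
  show "summable (\<lambda>k. f k t)" using g(1)[OF t] by (simp add: sums_iff)
qed

lemma summable_suminf_le:
  fixes f M :: "nat \<Rightarrow> real"
  assumes "\<And>k. \<bar>f k\<bar> \<le> M k" "summable M"
  shows "summable f" "\<bar>suminf f\<bar> \<le> suminf M"
proof -
  have s: "summable (\<lambda>k. \<bar>f k\<bar>)"
    by (rule summable_comparison_test'[OF assms(2), of 0]) (use assms in auto)
  show "summable f" by (rule summable_rabs_cancel[OF s])
  have "\<bar>suminf f\<bar> \<le> (\<Sum>k. \<bar>f k\<bar>)" by (rule summable_rabs[OF s])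
  also have "\<dots> \<le> suminf M" by (rule suminf_le[OF assms(1) s assms(2)])
  finally show "\<bar>suminf f\<bar> \<le> suminf M" .
qed

text \<open>Dominated convergence along an arbitrary filter: needed for sequences of coefficients as
  well as for limits in time of Gevrey norms.\<close>

lemma dominated_series_tendsto:
  fixes f :: "nat \<Rightarrow> 'b \<Rightarrow> real"
  assumes "\<And>k. ((\<lambda>x. f k x) \<longlongrightarrow> g k) F"
    and "\<forall>\<^sub>F x in F. \<forall>k. \<bar>f k x\<bar> \<le> M k" and "summable M"
  shows "((\<lambda>x. \<Sum>k. f k x) \<longlongrightarrow> (\<Sum>k. g k)) F"
proof (cases "F = bot")
  case False
  have "eventually (\<lambda>(k,n). norm (f k n) \<le> M k) (at_top \<times>\<^sub>F F)"
    unfolding eventually_prod_filter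
    by (rule exI[of _ "\<lambda>_. True"], rule exI[of _ "\<lambda>x. \<forall>k. \<bar>f k x\<bar> \<le> M k"])
       (use assms(2) in auto)
  from tannerys_theorem[OF assms(1) this assms(3) False] show ?thesis by simp
qed simp

lemma deriv_nonpos_imp_le:
  fixes f :: "real \<Rightarrow> real"
  assumes "\<And>t. t \<in> {0..T} \<Longrightarrow> (f has_real_derivative f' t) (at t within {0..T})"
    and "\<And>t. t \<in> {0..T} \<Longrightarrow> f' t \<le> 0" and "t \<in> {0..T}"
  shows "f t \<le> f 0"
proof -
  have "(f has_derivative (*) (f' x)) (at x within {0..t})" if "0 \<le> x" "x \<le> t" for x
    using has_field_derivative_subset[OF assms(1)[of x], of "{0..t}"] that assms(3)
    by (auto simp: has_field_derivative_def)
  from mvt_very_simple[of 0 t f "\<lambda>x. (*) (f' x)", OF _ this] assms(3)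
  obtain x where x: "x \<in> {0..t}" "f t - f 0 = f' x * (t - 0)" by auto
  then have "f t - f 0 \<le> 0" using assms(2)[of x] assms(3)
    by (simp add: mult_nonpos_nonneg)
  then show ?thesis by simp
qed

lemma gronwall:
  fixes F :: "real \<Rightarrow> real"
  assumes F: "\<And>t. t \<in> {0..T} \<Longrightarrow> (F has_real_derivative F' t) (at t within {0..T})"
    and le: "\<And>t. t \<in> {0..T} \<Longrightarrow> F' t \<le> a * F t + \<eta>"
    and "a \<ge> 0" "\<eta> \<ge> 0" and t: "t \<in> {0..T}"
  shows "F t \<le> (F 0 + \<eta> * t) * exp (a * t)"
proof -
  \<comment> \<open>Subtracting \<open>\<eta> * t\<close> rather than the exact integral
    \<open>\<eta> / a * (1 - exp (- a * t))\<close> keeps the case \<open>a = 0\<close>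
    uniform.\<close>
  define G where "G = (\<lambda>t. F t * exp (- (a * t)) - \<eta> * t)"
  have "G t \<le> G 0"
  proof (rule deriv_nonpos_imp_le[where f' = "\<lambda>t. (F' t - a * F t) * exp (- (a * t)) - \<eta>", OF _ _ t])
    fix s assume s: "s \<in> {0..T}"
    show "(G has_real_derivative (F' s - a * F s) * exp (- (a * s)) - \<eta>) (at s within {0..T})"
      unfolding G_def by (rule derivative_eq_intros F[OF s] refl)+ (simp add: algebra_simps)
    have "(F' s - a * F s) * exp (- (a * s)) \<le> \<eta> * exp (- (a * s))"
      using le[OF s] by (intro mult_right_mono) auto
    also have "\<dots> \<le> \<eta> * 1" using s \<open>a \<ge> 0\<close> \<open>\<eta> \<ge> 0\<close> by (intro mult_left_mono) auto
    finally show "(F' s - a * F s) * exp (- (a * s)) - \<eta> \<le> 0" by simp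
  qed
  then have "F t * exp (- (a * t)) \<le> F 0 + \<eta> * t" by (simp add: G_def)
  then have "F t * exp (- (a * t)) * exp (a * t) \<le> (F 0 + \<eta> * t) * exp (a * t)"
    by (intro mult_right_mono) auto
  then show ?thesis by (simp add: mult.assoc flip: exp_add)
qed

section \<open>The scalar linear equation\<close>

definition solves_on :: "real \<Rightarrow> (real \<Rightarrow> real) \<Rightarrow> (real \<Rightarrow> real) \<Rightarrow> (real \<Rightarrow> real) \<Rightarrow> bool" where
  "solves_on T q u v \<longleftrightarrow> (\<forall>t\<in>{0..T}. (u has_real_derivative v t) (at t within {0..T}) \<and>
     (v has_real_derivative - (q t * u t)) (at t within {0..T}))"

text \<open>Picard iteration for \<open>u'' = - q u\<close>. Summing the increments gives a solution operator that is
  defined for every \<open>q\<close> and obviously causal.\<close>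

fun picard_term :: "(real \<Rightarrow> real) \<Rightarrow> real \<Rightarrow> real \<Rightarrow> nat \<Rightarrow> real \<Rightarrow> real"
  and picard_vel :: "(real \<Rightarrow> real) \<Rightarrow> real \<Rightarrow> real \<Rightarrow> nat \<Rightarrow> real \<Rightarrow> real" where
  "picard_term q a b 0 t = a + b * t"
| "picard_term q a b (Suc i) t = integral {0..t} (picard_vel q a b (Suc i))"
| "picard_vel q a b 0 t = b"
| "picard_vel q a b (Suc i) t = - integral {0..t} (\<lambda>s. q s * picard_term q a b i s)"

definition lin_sol :: "(real \<Rightarrow> real) \<Rightarrow> real \<Rightarrow> real \<Rightarrow> real \<Rightarrow> real" where
  "lin_sol q a b t = (\<Sum>i. picard_term q a b i t)"

definition lin_vel :: "(real \<Rightarrow> real) \<Rightarrow> real \<Rightarrow> real \<Rightarrow> real \<Rightarrow> real" where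
  "lin_vel q a b t = (\<Sum>i. picard_vel q a b i t)"

text \<open>An iterate at time \<open>s\<close> only integrates over \<open>{0..s}\<close>. No
  regularity of \<open>q\<close> is needed, because equal integrands have equal
  \<open>integral\<close> whether or not they are integrable.\<close>

lemma picard_causal:
  assumes "\<And>s. s \<in> {0..t} \<Longrightarrow> q s = q' s" "s \<in> {0..t}"
  shows "picard_term q a b i s = picard_term q' a b i s \<and> picard_vel q a b i s = picard_vel q' a b i s"
  using assms(2)
proof (induction i arbitrary: s)
  case (Suc i)
  have v: "picard_vel q a b (Suc i) s = picard_vel q' a b (Suc i) s" if "s \<in> {0..t}" for s
    unfolding picard_vel.simps using that assms(1) Suc.IH
    by (intro arg_cong[where f = uminus] integral_cong) auto
  have "picard_term q a b (Suc i) s = picard_term q' a b (Suc i) s"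
    unfolding picard_term.simps using v Suc.prems by (intro integral_cong) auto
  with v[OF Suc.prems] show ?case by simp
qed simp

lemma lin_sol_causal:
  assumes "\<And>s. s \<in> {0..t} \<Longrightarrow> q s = q' s" "t \<ge> 0"
  shows "lin_sol q a b t = lin_sol q' a b t" "lin_vel q a b t = lin_vel q' a b t"
  using picard_causal[of t q q' t] assms by (simp_all add: lin_sol_def lin_vel_def)

lemma picard_derivative:
  assumes q: "continuous_on {0..T} q"
  shows "\<forall>t\<in>{0..T}. (picard_term q a b i has_real_derivative picard_vel q a b i t) (at t within {0..T})"
    and "\<forall>t\<in>{0..T}. (picard_vel q a b i has_real_derivative
      - (case i of 0 \<Rightarrow> 0 | Suc j \<Rightarrow> q t * picard_term q a b j t)) (at t within {0..T})"
proof -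
  have "(\<forall>t\<in>{0..T}. (picard_term q a b i has_real_derivative picard_vel q a b i t) (at t within {0..T}))
    \<and> (\<forall>t\<in>{0..T}. (picard_vel q a b i has_real_derivative
      - (case i of 0 \<Rightarrow> 0 | Suc j \<Rightarrow> q t * picard_term q a b j t)) (at t within {0..T}))"
  proof (induction i)
    case 0
    have "picard_term q a b 0 = (\<lambda>t. a + b * t)" "picard_vel q a b 0 = (\<lambda>t. b)" by auto
    then show ?case by (auto intro!: derivative_eq_intros)
  next
    case (Suc i)
    have "continuous_on {0..T} (picard_term q a b i)"
      using Suc by (intro DERIV_continuous_on) auto
    then have c: "continuous_on {0..T} (\<lambda>s. q s * picard_term q a b i s)"
      using q by (intro continuous_intros)
    have veq: "picard_vel q a b (Suc i) = (\<lambda>t. - integral {0..t} (\<lambda>s. q s * picard_term q a b i s))"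
      by auto
    have v: "\<forall>t\<in>{0..T}. (picard_vel q a b (Suc i) has_real_derivative
        - (q t * picard_term q a b i t)) (at t within {0..T})"
      unfolding veq using integral_has_real_derivative[OF c] by (auto intro!: DERIV_minus)
    then have cv: "continuous_on {0..T} (picard_vel q a b (Suc i))"
      by (intro DERIV_continuous_on) auto
    have ueq: "picard_term q a b (Suc i) = (\<lambda>t. integral {0..t} (picard_vel q a b (Suc i)))"
      by (rule ext, simp only: picard_term.simps)
    have "\<forall>t\<in>{0..T}. (picard_term q a b (Suc i) has_real_derivative picard_vel q a b (Suc i) t)
        (at t within {0..T})"
      using integral_has_real_derivative[OF cv] unfolding ueq by blast
    with v show ?case by (intro conjI) (simp_all only: nat.case)
  qed
  then show "\<forall>t\<in>{0..T}. (picard_term q a b i has_real_derivative picard_vel q a b i t) (at t within {0..T})"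
    and "\<forall>t\<in>{0..T}. (picard_vel q a b i has_real_derivative
      - (case i of 0 \<Rightarrow> 0 | Suc j \<Rightarrow> q t * picard_term q a b j t)) (at t within {0..T})"
    by auto
qed

text \<open>In the sup norm weighted by \<open>exp (- \<mu> * t)\<close> integration has norm at
  most \<open>1 / \<mu>\<close>; this turns the Picard increments into a geometric series on an
  interval of any length.\<close>

lemma deriv_exp_bound:
  fixes f :: "real \<Rightarrow> real"
  assumes f: "\<And>t. t \<in> {0..T} \<Longrightarrow> (f has_real_derivative f' t) (at t within {0..T})"
    and le: "\<And>t. t \<in> {0..T} \<Longrightarrow> \<bar>f' t\<bar> \<le> C * exp (\<mu> * t)"
    and "f 0 = 0" "\<mu> > 0" "C \<ge> 0" and t: "t \<in> {0..T}"
  shows "\<bar>f t\<bar> \<le> C / \<mu> * exp (\<mu> * t)"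
proof -
  have "\<sigma> * f t - C / \<mu> * exp (\<mu> * t) \<le> \<sigma> * f 0 - C / \<mu> * exp (\<mu> * 0)" if "\<sigma> = 1 \<or> \<sigma> = -1" for \<sigma>
  proof (rule deriv_nonpos_imp_le[where f' = "\<lambda>t. \<sigma> * f' t - C * exp (\<mu> * t)", OF _ _ t])
    fix s assume s: "s \<in> {0..T}"
    show "((\<lambda>t. \<sigma> * f t - C / \<mu> * exp (\<mu> * t)) has_real_derivative \<sigma> * f' s - C * exp (\<mu> * s)) (at s within {0..T})"
      by (rule derivative_eq_intros f[OF s] refl)+ (use \<open>\<mu> > 0\<close> in auto)
    show "\<sigma> * f' s - C * exp (\<mu> * s) \<le> 0" using le[OF s] that by auto
  qed
  from this[of 1] this[of "-1"] have "\<bar>f t\<bar> \<le> C / \<mu> * exp (\<mu> * t) - C / \<mu>"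
    using \<open>f 0 = 0\<close> by (auto simp: abs_if)
  also have "\<dots> \<le> C / \<mu> * exp (\<mu> * t)" using assms by simp
  finally show ?thesis .
qed

text \<open>One step multiplies by \<open>q\<close> and integrates twice, hence costs
  \<open>Q / \<mu>\<^sup>2 \<le> 1/2\<close>. The summand 1 in \<open>\<mu>\<close> provides
  \<open>t \<le> exp (\<mu> * t)\<close> for the initial term.\<close>

lemma picard_bound:
  assumes q: "continuous_on {0..T} q" and Q: "\<And>t. t \<in> {0..T} \<Longrightarrow> \<bar>q t\<bar> \<le> Q" "Q \<ge> 0"
    and \<mu>: "\<mu> = 1 + 2 * Q"
  shows "\<forall>t\<in>{0..T}. \<bar>picard_term q a b i t\<bar> \<le> (\<bar>a\<bar> + \<bar>b\<bar>) * (1/2)^i * exp (\<mu> * t)"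
proof (induction i)
  case 0
  show ?case
  proof
    fix t :: real assume t: "t \<in> {0..T}"
    have "t \<le> exp (1 * t)" using exp_ge_add_one_self[of t] unfolding mult_1 by linarith
    also have "\<dots> \<le> exp (\<mu> * t)" using t Q \<mu> by (simp add: algebra_simps)
    finally have 1: "t \<le> exp (\<mu> * t)" .
    have 2: "1 \<le> exp (\<mu> * t)" using t Q \<mu> by simp
    have "\<bar>a + b * t\<bar> \<le> \<bar>a\<bar> * 1 + \<bar>b\<bar> * t" using t by (auto simp: abs_mult intro: order_trans[OF abs_triangle_ineq])
    also have "\<dots> \<le> \<bar>a\<bar> * exp (\<mu> * t) + \<bar>b\<bar> * exp (\<mu> * t)"
      using 1 2 by (intro add_mono mult_left_mono) auto
    finally show "\<bar>picard_term q a b 0 t\<bar> \<le> (\<bar>a\<bar> + \<bar>b\<bar>) * (1/2)^0 * exp (\<mu> * t)"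
      by (simp add: algebra_simps)
  qed
next
  case (Suc i)
  let ?C = "(\<bar>a\<bar> + \<bar>b\<bar>) * (1/2)^i"
  have \<mu>0: "\<mu> > 0" "\<mu> \<noteq> 0" using \<mu> Q by auto
  have v: "\<bar>picard_vel q a b (Suc i) t\<bar> \<le> Q * ?C / \<mu> * exp (\<mu> * t)" if "t \<in> {0..T}" for t
  proof (rule deriv_exp_bound[OF _ _ _ \<mu>0(1) _ that])
    fix s assume s: "s \<in> {0..T}"
    show "(picard_vel q a b (Suc i) has_real_derivative - (q s * picard_term q a b i s)) (at s within {0..T})"
      using picard_derivative(2)[OF q, of a b "Suc i"] s by auto
    show "\<bar>- (q s * picard_term q a b i s)\<bar> \<le> Q * ?C * exp (\<mu> * s)"
      using mult_mono[OF Q(1)[OF s] Suc[rule_format, OF s]] Q(2)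
      by (simp add: abs_mult mult.assoc)
  qed (use Q in auto)
  show ?case
  proof
    fix t assume t: "t \<in> {0..T}"
    have "\<bar>picard_term q a b (Suc i) t\<bar> \<le> Q * ?C / \<mu> / \<mu> * exp (\<mu> * t)"
    proof (rule deriv_exp_bound[OF _ v _ \<mu>0(1) _ t])
      fix s assume s: "s \<in> {0..T}"
      show "(picard_term q a b (Suc i) has_real_derivative picard_vel q a b (Suc i) s) (at s within {0..T})"
        using picard_derivative(1)[OF q, of a b "Suc i"] s by blast
    qed (use Q \<mu>0 in auto)
    also have "Q * ?C / \<mu> / \<mu> \<le> ?C * (1/2)"
    proof -
      have "2 * Q \<le> \<mu> * \<mu>" using \<mu> Q by (simp add: algebra_simps)
      then have "?C * (2 * Q) \<le> ?C * (\<mu> * \<mu>)" by (intro mult_left_mono) auto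
      then show ?thesis using \<mu>0 by (simp add: field_simps)
    qed
    finally show "\<bar>picard_term q a b (Suc i) t\<bar> \<le> (\<bar>a\<bar> + \<bar>b\<bar>) * (1/2)^(Suc i) * exp (\<mu> * t)"
      by (simp add: mult_right_mono)
  qed
qed

lemma lin_sol_solves:
  assumes q: "continuous_on {0..T} q"
  shows "solves_on T q (lin_sol q a b) (lin_vel q a b)"
proof (cases "T \<ge> 0")
  case T: True
  obtain Q where Q: "\<And>t. t \<in> {0..T} \<Longrightarrow> \<bar>q t\<bar> \<le> Q" "Q \<ge> 0"
  proof -
    have "bounded (q ` {0..T})" by (intro compact_imp_bounded compact_continuous_image q) auto
    then obtain Q where "\<forall>x\<in>q ` {0..T}. norm x \<le> Q" by (auto simp: bounded_iff)
    then show ?thesis using T by (intro that[of Q]) (auto intro: order_trans[of 0 "\<bar>q 0\<bar>"])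
  qed
  define \<mu> where "\<mu> = 1 + 2 * Q"
  define M where "M = (\<lambda>i. (\<bar>a\<bar> + \<bar>b\<bar>) * exp (\<mu> * T) * (1/2::real)^i)"
  have sM: "summable M" unfolding M_def by (intro summable_mult summable_geometric) auto
  have bt: "\<bar>picard_term q a b i t\<bar> \<le> M i" if t: "t \<in> {0..T}" for i t
  proof -
    have "\<bar>picard_term q a b i t\<bar> \<le> (\<bar>a\<bar> + \<bar>b\<bar>) * (1/2)^i * exp (\<mu> * t)"
      using picard_bound[OF q Q \<mu>_def] t by blast
    also have "\<dots> \<le> (\<bar>a\<bar> + \<bar>b\<bar>) * (1/2)^i * exp (\<mu> * T)"
      using t Q by (intro mult_left_mono) (auto simp: \<mu>_def)
    finally show ?thesis by (simp add: M_def mult_ac)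
  qed
  \<comment> \<open>The acceleration of increment \<open>Suc j\<close> is \<open>- q\<close> times
    increment \<open>j\<close>; this shift of the index makes the summed accelerations equal to
    \<open>- q\<close> times the summed solution.\<close>
  define acc where "acc = (\<lambda>i t. - (case i of 0 \<Rightarrow> 0 | Suc j \<Rightarrow> q t * picard_term q a b j t))"
  define MA where "MA = (\<lambda>i. case i of 0 \<Rightarrow> 0 | Suc j \<Rightarrow> Q * M j)"
  have sMA: "summable MA"
  proof -
    have "summable (\<lambda>i. MA (Suc i))" unfolding MA_def using sM by (simp add: summable_mult)
    then show ?thesis by (simp only: summable_Suc_iff)
  qed
  have ba: "\<bar>acc i t\<bar> \<le> MA i" if "t \<in> {0..T}" for i t
    unfolding acc_def MA_def using bt[OF that] Q that
    by (auto split: nat.split simp: abs_mult intro!: mult_mono)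
  have z: "(0::real) \<in> {0..T}" using T by simp
  \<comment> \<open>At time 0 all increments but the first vanish, which gives convergence at the
    base point required for termwise differentiation.\<close>
  have pv0: "summable (\<lambda>i. picard_vel q a b i 0)"
    by (rule summable_finite[of "{0}"]) (auto simp: gr0_conv_Suc)
  have pt0: "summable (\<lambda>i. picard_term q a b i 0)"
    by (rule summable_finite[of "{0}"]) (auto simp: gr0_conv_Suc)
  have dv: "(picard_vel q a b k has_real_derivative acc k t) (at t within {0..T})" if "t \<in> {0..T}" for k t
    using picard_derivative(2)[OF q, of a b k] that unfolding acc_def by blast
  have V: "(lin_vel q a b has_real_derivative (\<Sum>k. acc k t)) (at t within {0..T})" if "t \<in> {0..T}" for t
    unfolding lin_vel_def[abs_def]
    by (rule dominated_series_has_derivative(1)[where S = "{0..T}" and f = "picard_vel q a b" and ?t0.0 = 0, OF convex_real_interval(5) _ _ sMA z pv0 that])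
       (fact dv ba)+
  have bv: "\<bar>picard_vel q a b i t\<bar> \<le> (case i of 0 \<Rightarrow> \<bar>b\<bar> | Suc j \<Rightarrow> T * (Q * M j))" if t: "t \<in> {0..T}" for i t
  proof (cases i)
    case (Suc j)
    have "norm (picard_vel q a b i t - picard_vel q a b i 0) \<le> MA i * norm (t - 0)"
      by (rule field_differentiable_bound[OF convex_real_interval(5) dv _ t z]) (use ba in auto)
    then have "\<bar>picard_vel q a b i t\<bar> \<le> MA i * t" using Suc t by simp
    also have "\<dots> \<le> MA i * T" using t ba[OF t, of i] by (intro mult_left_mono) auto
    finally show ?thesis using Suc by (simp add: MA_def mult_ac)
  qed simp
  have sMV: "summable (\<lambda>i. case i of 0 \<Rightarrow> \<bar>b\<bar> | Suc j \<Rightarrow> T * (Q * M j))"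
    by (subst summable_Suc_iff[symmetric]) (simp add: summable_mult sM)
  have du: "(picard_term q a b k has_real_derivative picard_vel q a b k t) (at t within {0..T})" if "t \<in> {0..T}" for k t
    using picard_derivative(1)[OF q, of a b k] that by blast
  have U: "(lin_sol q a b has_real_derivative lin_vel q a b t) (at t within {0..T})"
    "summable (\<lambda>i. picard_term q a b i t)" if "t \<in> {0..T}" for t
    unfolding lin_sol_def[abs_def] lin_vel_def
    by (rule dominated_series_has_derivative[where S = "{0..T}" and f = "picard_term q a b" and ?t0.0 = 0, OF convex_real_interval(5) _ _ sMV z pt0 that];
        fact du bv)+
  have "(\<Sum>k. acc k t) = - (q t * lin_sol q a b t)" if t: "t \<in> {0..T}" for t
  proof -
    have s: "summable (\<lambda>k. acc k t)" using summable_suminf_le(1)[OF ba[OF t] sMA] .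
    have "(\<Sum>k. acc k t) = acc 0 t + (\<Sum>k. acc (Suc k) t)" using suminf_split_head[OF s] by simp
    also have "\<dots> = - (\<Sum>k. q t * picard_term q a b k t)"
      using U(2)[OF t] by (simp add: acc_def suminf_minus summable_mult)
    also have "\<dots> = - (q t * lin_sol q a b t)"
      using suminf_mult[OF U(2)[OF t], of "q t"] by (simp add: lin_sol_def)
    finally show ?thesis .
  qed
  with U(1) V show ?thesis unfolding solves_on_def by auto
qed (simp add: solves_on_def)

lemma lin_sol_0 [simp]: "lin_sol q a b 0 = a" "lin_vel q a b 0 = b"
proof -
  have "(\<Sum>i. picard_term q a b i 0) = (\<Sum>i\<in>{0}. picard_term q a b i 0)"
    by (rule suminf_finite) (auto simp: gr0_conv_Suc)
  then show "lin_sol q a b 0 = a" by (simp add: lin_sol_def)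
  have "(\<Sum>i. picard_vel q a b i 0) = (\<Sum>i\<in>{0}. picard_vel q a b i 0)"
    by (rule suminf_finite) (auto simp: gr0_conv_Suc)
  then show "lin_vel q a b 0 = b" by (simp add: lin_vel_def)
qed

section \<open>Energy estimates\<close>

text \<open>The energy carries the constant weight 1 instead of \<open>c\<close>, so only the size
  of \<open>c\<close> matters: neither continuity moduli nor positivity bounded away from 0 enter.
  The price is a rate proportional to \<open>l\<close>, harmless below a cutoff.\<close>

lemma low_energy:
  assumes sol: "solves_on T (\<lambda>t. l\<^sup>2 * c t) u v" and l: "l \<ge> 0"
    and c: "\<And>t. t \<in> {0..T} \<Longrightarrow> 0 \<le> c t \<and> c t \<le> K" and t: "t \<in> {0..T}"
  shows "(v t)\<^sup>2 + l\<^sup>2 * (u t)\<^sup>2 \<le> ((v 0)\<^sup>2 + l\<^sup>2 * (u 0)\<^sup>2) * exp ((1 + K) * l * T)"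
proof -
  let ?F = "\<lambda>t. (v t)\<^sup>2 + l\<^sup>2 * (u t)\<^sup>2"
  have K: "K \<ge> 0" using c[OF t] by linarith
  have "?F t \<le> (?F 0 + 0 * t) * exp (((1 + K) * l) * t)"
  proof (rule gronwall[where F' = "\<lambda>s. 2 * (l * u s) * v s * l * (1 - c s)", OF _ _ _ _ t])
    fix s assume s: "s \<in> {0..T}"
    have u: "(u has_real_derivative v s) (at s within {0..T})"
      and v: "(v has_real_derivative - (l\<^sup>2 * c s * u s)) (at s within {0..T})"
      using sol s unfolding solves_on_def by blast+
    show "(?F has_real_derivative 2 * (l * u s) * v s * l * (1 - c s)) (at s within {0..T})"
      by (rule derivative_eq_intros u v refl)+ (simp add: algebra_simps power2_eq_square)
    have "\<bar>2 * (l * u s) * v s\<bar> \<le> ?F s"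
      using sum_squares_bound[of "\<bar>l * u s\<bar>" "\<bar>v s\<bar>"] by (simp add: power_mult_distrib abs_mult)
    moreover have "\<bar>l * (1 - c s)\<bar> \<le> l * (1 + K)"
      unfolding abs_mult using c[OF s] l by (intro mult_mono) auto
    ultimately have "\<bar>2 * (l * u s) * v s * (l * (1 - c s))\<bar> \<le> ?F s * (l * (1 + K))"
      unfolding abs_mult[of "2 * (l * u s) * v s"] by (intro mult_mono) auto
    then show "2 * (l * u s) * v s * l * (1 - c s) \<le> (1 + K) * l * ?F s + 0"
      by (simp add: mult_ac abs_le_iff)
  qed (use l K in auto)
  also have "\<dots> \<le> ?F 0 * exp ((1 + K) * l * T)"
    using t l K by (auto intro!: mult_left_mono)
  finally show ?thesis .
qed

text \<open>The energy is weighted by a differentiable substitute \<open>d\<close> for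
  \<open>c\<close>. The derivative of \<open>d\<close> costs the rate
  \<open>\<eta>2 / \<mu>\<close>, its distance from \<open>c\<close> the rate
  \<open>\<eta>1 * l / sqrt \<mu>\<close>; the choice of \<open>d\<close> has to balance the
  two.\<close>

lemma energy_growth:
  assumes sol: "solves_on T (\<lambda>t. l\<^sup>2 * c t) u v" and l: "l \<ge> 0"
    and d: "\<And>t. t \<in> {0..T} \<Longrightarrow> (d has_real_derivative d' t) (at t within {0..T})"
    and dc: "\<And>t. t \<in> {0..T} \<Longrightarrow> \<bar>d t - c t\<bar> \<le> \<eta>1"
    and d': "\<And>t. t \<in> {0..T} \<Longrightarrow> \<bar>d' t\<bar> \<le> \<eta>2"
    and \<mu>: "\<mu> > 0" "\<And>t. t \<in> {0..T} \<Longrightarrow> d t \<ge> \<mu>" and t: "t \<in> {0..T}"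
  shows "(v t)\<^sup>2 + d t * l\<^sup>2 * (u t)\<^sup>2 \<le>
    ((v 0)\<^sup>2 + d 0 * l\<^sup>2 * (u 0)\<^sup>2) * exp ((\<eta>2 / \<mu> + \<eta>1 * l / sqrt \<mu>) * T)"
proof -
  let ?F = "\<lambda>t. (v t)\<^sup>2 + d t * l\<^sup>2 * (u t)\<^sup>2"
  define a where "a = \<eta>2 / \<mu> + \<eta>1 * l / sqrt \<mu>"
  have \<eta>: "\<eta>1 \<ge> 0" "\<eta>2 \<ge> 0" using dc[OF t] d'[OF t] by linarith+
  then have a: "a \<ge> 0" using l \<mu> unfolding a_def by simp
  have "?F t \<le> (?F 0 + 0 * t) * exp (a * t)"
  proof (rule gronwall[where F' = "\<lambda>s. d' s * (l\<^sup>2 * (u s)\<^sup>2) + (d s - c s) * (2 * l\<^sup>2 * u s * v s)", OF _ _ a _ t])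
    fix s assume s: "s \<in> {0..T}"
    have u: "(u has_real_derivative v s) (at s within {0..T})"
      and v: "(v has_real_derivative - (l\<^sup>2 * c s * u s)) (at s within {0..T})"
      using sol s unfolding solves_on_def by blast+
    show "(?F has_real_derivative d' s * (l\<^sup>2 * (u s)\<^sup>2) + (d s - c s) * (2 * l\<^sup>2 * u s * v s)) (at s within {0..T})"
      by (rule derivative_eq_intros u v d[OF s] refl)+ (simp add: algebra_simps power2_eq_square)
    have "\<mu> * (l\<^sup>2 * (u s)\<^sup>2) \<le> d s * (l\<^sup>2 * (u s)\<^sup>2)"
      using \<mu>(2)[OF s] by (intro mult_right_mono) auto
    then have low: "(v s)\<^sup>2 + \<mu> * (l\<^sup>2 * (u s)\<^sup>2) \<le> ?F s" by (simp add: mult.assoc)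
    have "\<mu> * (l\<^sup>2 * (u s)\<^sup>2) \<le> ?F s" using low zero_le_power2[of "v s"] by linarith
    then have 1: "l\<^sup>2 * (u s)\<^sup>2 \<le> ?F s / \<mu>" using \<mu>(1) by (simp add: field_simps)
    have "d' s * (l\<^sup>2 * (u s)\<^sup>2) \<le> \<eta>2 * (l\<^sup>2 * (u s)\<^sup>2)"
      using d'[OF s] by (intro mult_right_mono) auto
    also have "\<dots> \<le> \<eta>2 * (?F s / \<mu>)" using 1 \<eta> by (intro mult_left_mono)
    finally have A: "d' s * (l\<^sup>2 * (u s)\<^sup>2) \<le> \<eta>2 / \<mu> * ?F s" by simp
    have "2 * \<bar>v s\<bar> * (sqrt \<mu> * (l * \<bar>u s\<bar>)) \<le> (v s)\<^sup>2 + \<mu> * (l\<^sup>2 * (u s)\<^sup>2)"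
      using sum_squares_bound[of "\<bar>v s\<bar>" "sqrt \<mu> * (l * \<bar>u s\<bar>)"] \<mu>(1)
      by (simp add: power_mult_distrib)
    then have "sqrt \<mu> * (2 * l * \<bar>u s\<bar> * \<bar>v s\<bar>) \<le> ?F s" using low by (simp add: mult_ac)
    then have 2: "2 * l * \<bar>u s\<bar> * \<bar>v s\<bar> \<le> ?F s / sqrt \<mu>" using \<mu>(1) by (simp add: field_simps)
    have "(d s - c s) * (2 * l\<^sup>2 * u s * v s) \<le> \<bar>d s - c s\<bar> * \<bar>2 * l\<^sup>2 * u s * v s\<bar>"
      by (metis abs_ge_self abs_mult)
    also have "\<dots> \<le> \<eta>1 * \<bar>2 * l\<^sup>2 * u s * v s\<bar>" using dc[OF s] by (intro mult_right_mono) auto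
    also have "\<dots> = \<eta>1 * l * (2 * l * \<bar>u s\<bar> * \<bar>v s\<bar>)"
      using l by (simp add: abs_mult power2_eq_square)
    also have "\<dots> \<le> \<eta>1 * l * (?F s / sqrt \<mu>)" using 2 \<eta> l by (intro mult_left_mono) auto
    finally have B: "(d s - c s) * (2 * l\<^sup>2 * u s * v s) \<le> \<eta>1 * l / sqrt \<mu> * ?F s" by simp
    show "d' s * (l\<^sup>2 * (u s)\<^sup>2) + (d s - c s) * (2 * l\<^sup>2 * u s * v s) \<le> a * ?F s + 0"
      using A B unfolding a_def by (simp add: distrib_right)
  qed simp
  also have "\<dots> \<le> ?F 0 * exp (a * T)"
  proof -
    have "d 0 \<ge> 0" using \<mu>(1) \<mu>(2)[of 0] t by fastforce
    then show ?thesis using t a by (auto intro!: mult_left_mono)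
  qed
  finally show ?thesis by (simp add: a_def)
qed

text \<open>Colombini--De Giorgi--Spagnolo smoothing: the mean of \<open>c\<close> over \<open>[t, t + \<epsilon>]\<close> is a value of \<open>c\<close>.\<close>

lemma moving_average:
  fixes c :: "real \<Rightarrow> real"
  assumes c: "continuous_on {0..} c" and \<epsilon>: "\<epsilon> > 0"
  obtains d where "\<And>t. t \<in> {0..T} \<Longrightarrow> (d has_real_derivative (c (t + \<epsilon>) - c t) / \<epsilon>) (at t within {0..T})"
    and "\<And>t. t \<in> {0..T} \<Longrightarrow> \<exists>x\<in>{t..t + \<epsilon>}. d t = c x"
proof -
  define C where "C = (\<lambda>t. integral {0..t} c)"
  have cc: "continuous_on {0..T + \<epsilon>} c" by (rule continuous_on_subset[OF c]) auto
  have C: "(C has_real_derivative c t) (at t within {0..T + \<epsilon>})" if "t \<in> {0..T + \<epsilon>}" for t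
    unfolding C_def by (rule integral_has_real_derivative[OF cc that])
  show thesis
  proof (rule that[of "\<lambda>t. (C (t + \<epsilon>) - C t) / \<epsilon>"])
    fix t assume t: "t \<in> {0..T}"
    have 1: "(C has_real_derivative c t) (at t within {0..T})"
      by (rule has_field_derivative_subset[OF C]) (use t \<epsilon> in auto)
    have "(C has_real_derivative c (t + \<epsilon>)) (at (t + \<epsilon>) within (\<lambda>t. t + \<epsilon>) ` {0..T})"
      by (rule has_field_derivative_subset[OF C]) (use t \<epsilon> in auto)
    moreover have "((\<lambda>t. t + \<epsilon>) has_real_derivative 1) (at t within {0..T})"
      by (auto intro!: derivative_eq_intros)
    ultimately have 2: "((\<lambda>t. C (t + \<epsilon>)) has_real_derivative c (t + \<epsilon>)) (at t within {0..T})"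
      using DERIV_image_chain[of C "c (t + \<epsilon>)" "\<lambda>t. t + \<epsilon>" t "{0..T}" 1] by (simp add: o_def)
    show "((\<lambda>t. (C (t + \<epsilon>) - C t) / \<epsilon>) has_real_derivative (c (t + \<epsilon>) - c t) / \<epsilon>) (at t within {0..T})"
      by (intro DERIV_cdivide DERIV_diff 1 2)
    have "(C has_derivative (*) (c x)) (at x within {t..t + \<epsilon>})" if "t \<le> x" "x \<le> t + \<epsilon>" for x
      using has_field_derivative_subset[OF C[of x], of "{t..t + \<epsilon>}"] t that
      by (auto simp: has_field_derivative_def)
    from mvt_very_simple[of t "t + \<epsilon>" C "\<lambda>x. (*) (c x)", OF _ this] \<epsilon>
    show "\<exists>x\<in>{t..t + \<epsilon>}. (C (t + \<epsilon>) - C t) / \<epsilon> = c x" by auto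
  qed
qed

text \<open>Subadditivity handles integer multiples, and \<open>x\<close> is at most the integer
  \<open>nat \<lceil>x\<rceil>\<close>, which is at most \<open>x + 1\<close>.\<close>

lemma continuity_modulus_mult:
  assumes "continuity_modulus \<omega>" "x \<ge> 0" "y \<ge> 0"
  shows "\<omega> (x * y) \<le> (x + 1) * \<omega> y"
proof -
  have mono: "\<omega> a \<le> \<omega> b" if "0 \<le> a" "a \<le> b" for a b
    using assms(1) that unfolding continuity_modulus_def mono_on_def by auto
  have nonneg: "\<omega> a \<ge> 0" if "0 \<le> a" for a
    using mono[OF _ that] assms(1) unfolding continuity_modulus_def by auto
  have n: "\<omega> (real n * y) \<le> real n * \<omega> y" for n
  proof (induction n)
    case 0 then show ?case using assms(1) by (simp add: continuity_modulus_def)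
  next
    case (Suc n)
    have "\<omega> (real (Suc n) * y) = \<omega> (real n * y + y)" by (simp add: algebra_simps)
    also have "\<dots> \<le> \<omega> (real n * y) + \<omega> y"
      using assms unfolding continuity_modulus_def by simp
    finally show ?case using Suc by (simp add: algebra_simps)
  qed
  have "\<omega> (x * y) \<le> \<omega> (real (nat \<lceil>x\<rceil>) * y)"
    using assms by (intro mono mult_right_mono) (auto simp: real_nat_ceiling_ge)
  also have "\<dots> \<le> real (nat \<lceil>x\<rceil>) * \<omega> y" by (rule n)
  also have "\<dots> \<le> (x + 1) * \<omega> y"
    using assms nonneg[of y] by (intro mult_right_mono) (auto simp: of_nat_nat, linarith?)
  finally show ?thesis .
qed

lemma absorb_linear_factor:
  fixes F :: real
  assumes "F \<le> Q * (1 + \<sigma>) * E" "E \<le> X * I * exp (Y * \<sigma>)" "\<sigma> \<le> S"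
    and "Q \<ge> 0" "X \<ge> 0" "I \<ge> 0" "Y \<ge> 0" "\<sigma> \<ge> 0"
  shows "F \<le> Q * X * exp ((1 + Y) * S) * I"
proof -
  have "F \<le> Q * (1 + \<sigma>) * (X * I * exp (Y * \<sigma>))"
    using assms(1) mult_left_mono[OF assms(2), of "Q * (1 + \<sigma>)"] assms(4,8) by simp
  also have "\<dots> \<le> Q * exp \<sigma> * (X * I * exp (Y * \<sigma>))"
    by (intro mult_right_mono mult_left_mono exp_ge_add_one_self) (use assms in auto)
  also have "\<dots> = Q * X * exp ((1 + Y) * \<sigma>) * I" by (simp add: distrib_right exp_add)
  also have "\<dots> \<le> Q * X * exp ((1 + Y) * S) * I"
    using assms by (intro mult_right_mono mult_left_mono) (auto intro!: mult_left_mono)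
  finally show ?thesis .
qed

section \<open>Energy estimates in the strictly and in the weakly hyperbolic case\<close>

locale hyperbolic =
  fixes \<omega> m \<phi> :: "real \<Rightarrow> real" and L \<Lambda> :: real
  assumes modulus: "continuity_modulus \<omega>"
    and m_nonneg: "\<And>x. x \<ge> 0 \<Longrightarrow> m x \<ge> 0"
    and L: "L \<ge> 0" and m_modulus: "\<And>a b. a \<ge> 0 \<Longrightarrow> b \<ge> 0 \<Longrightarrow> \<bar>m a - m b\<bar> \<le> L * \<omega> \<bar>a - b\<bar>"
    and \<phi>_pos: "\<And>x. x \<ge> 0 \<Longrightarrow> \<phi> x > 0"
    and hyperbolicity: "((\<exists>\<nu>>0. \<forall>\<sigma>\<ge>0. m \<sigma> \<ge> \<nu>) \<and> (\<forall>\<sigma>>0. \<sigma> * \<omega> (1 / \<sigma>) \<le> \<Lambda> * \<phi> \<sigma>)) \<or>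
       ((\<forall>\<sigma>\<ge>0. m \<sigma> \<ge> 0) \<and> (\<forall>\<sigma>>0. \<sigma> \<le> \<Lambda> * \<phi> (\<sigma> / sqrt (\<omega> (1 / \<sigma>)))))"
begin

lemma \<omega>_mono: "0 \<le> a \<Longrightarrow> a \<le> b \<Longrightarrow> \<omega> a \<le> \<omega> b"
  using modulus unfolding continuity_modulus_def mono_on_def by auto

lemma \<omega>_0 [simp]: "\<omega> 0 = 0" and \<omega>_pos: "a > 0 \<Longrightarrow> \<omega> a > 0"
  using modulus unfolding continuity_modulus_def by auto

lemma \<omega>_nonneg: "0 \<le> a \<Longrightarrow> \<omega> a \<ge> 0"
  using \<omega>_mono[of 0 a] by simp

text \<open>Both growth conditions, evaluated at \<open>\<sigma> = 1\<close>, have a positive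
  left-hand side, and \<open>\<phi>\<close> is positive. The sign makes the exponential rates below
  nonnegative.\<close>

lemma \<Lambda>_pos: "\<Lambda> > 0"
proof -
  have "\<exists>a x. 0 < a \<and> 0 < x \<and> a \<le> \<Lambda> * \<phi> x"
    using hyperbolicity
  proof (elim disjE conjE)
    assume "\<forall>\<sigma>>0. \<sigma> * \<omega> (1 / \<sigma>) \<le> \<Lambda> * \<phi> \<sigma>"
    from this[rule_format, of 1] \<omega>_pos[of 1] show ?thesis by (intro exI[of _ "\<omega> 1"] exI[of _ 1]) auto
  next
    assume "\<forall>\<sigma>>0. \<sigma> \<le> \<Lambda> * \<phi> (\<sigma> / sqrt (\<omega> (1 / \<sigma>)))"
    from this[rule_format, of 1] \<omega>_pos[of 1] show ?thesis
      by (intro exI[of _ 1] exI[of _ "1 / sqrt (\<omega> 1)"]) auto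
  qed
  then obtain a x where ax: "0 < a" "0 < x" "a \<le> \<Lambda> * \<phi> x" by blast
  then have "0 < \<Lambda> * \<phi> x" by linarith
  then show ?thesis using \<phi>_pos[of x] ax by (auto simp: zero_less_mult_iff)
qed

lemma continuous_on_m: "continuous_on {0..} m"
  unfolding continuous_on_iff dist_real_def
proof (intro ballI allI impI)
  fix x e :: real assume "x \<in> {0..}" and e: "e > 0"
  then have x: "x \<ge> 0" by simp
  have "continuous_on {0..} \<omega>" using modulus by (simp add: continuity_modulus_def)
  then obtain d where d: "d > 0" "\<And>y. y \<ge> 0 \<Longrightarrow> \<bar>y\<bar> < d \<Longrightarrow> \<bar>\<omega> y\<bar> < e / (L + 1)"
    unfolding continuous_on_iff dist_real_def
    using L e by (elim ballE[of _ _ 0] allE[of _ "e / (L + 1)"]) (auto simp: divide_pos_pos add_nonneg_pos)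
  show "\<exists>d>0. \<forall>x'\<in>{0..}. \<bar>x' - x\<bar> < d \<longrightarrow> \<bar>m x' - m x\<bar> < e"
  proof (intro exI[of _ d] conjI ballI impI d(1))
    fix y :: real assume "y \<in> {0..}" "\<bar>y - x\<bar> < d"
    then have y: "y \<ge> 0" "\<bar>y - x\<bar> < d" by auto
    have "\<bar>m y - m x\<bar> \<le> L * \<omega> \<bar>y - x\<bar>" by (rule m_modulus[OF y(1) x])
    also have "\<dots> \<le> L * (e / (L + 1))"
      using d(2)[of "\<bar>y - x\<bar>"] y L by (intro mult_left_mono) auto
    also have "\<dots> < e" using L e by (simp add: field_simps)
    finally show "\<bar>m y - m x\<bar> < e" .
  qed
qed

text \<open>Averaging over the length \<open>\<epsilon> = 1 / l\<close> makes both error rates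
  multiples of \<open>l * \<omega> (1 / l)\<close>, the very quantity that the strict condition
  bounds by \<open>\<Lambda> * \<phi> l\<close>.\<close>

lemma energy_estimate_strict:
  assumes \<nu>: "\<nu> > 0" "\<And>t. t \<ge> 0 \<Longrightarrow> \<nu> \<le> c t" and c: "continuous_on {0..} c" "\<And>t. t \<ge> 0 \<Longrightarrow> c t \<le> K"
    and mod: "\<And>s t. s \<ge> 0 \<Longrightarrow> t \<ge> 0 \<Longrightarrow> \<bar>c s - c t\<bar> \<le> A * \<omega> \<bar>s - t\<bar>" and A: "A \<ge> 0"
    and \<phi>: "l * \<omega> (1 / l) \<le> \<Lambda> * \<phi> l"
    and sol: "solves_on T (\<lambda>t. l\<^sup>2 * c t) u v" and l: "l \<ge> 1" and t: "t \<in> {0..T}"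
  shows "(v t)\<^sup>2 + l\<^sup>2 * (u t)\<^sup>2 \<le> (1 + K) / min 1 \<nu> * exp (A * (1 / \<nu> + 1 / sqrt \<nu>) * \<Lambda> * T * \<phi> l)
    * ((v 0)\<^sup>2 + l\<^sup>2 * (u 0)\<^sup>2)"
proof -
  define \<epsilon> where "\<epsilon> = 1 / l"
  have \<epsilon>: "\<epsilon> > 0" using l by (simp add: \<epsilon>_def)
  obtain d where d: "\<And>t. t \<in> {0..T} \<Longrightarrow> (d has_real_derivative (c (t + \<epsilon>) - c t) / \<epsilon>) (at t within {0..T})"
    "\<And>t. t \<in> {0..T} \<Longrightarrow> \<exists>x\<in>{t..t + \<epsilon>}. d t = c x" using moving_average[OF c(1) \<epsilon>] by blast
  have mod\<epsilon>: "\<bar>c x - c t\<bar> \<le> A * \<omega> \<epsilon>" if "x \<in> {t..t + \<epsilon>}" "t \<ge> 0" for x t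
    using mod[of x t] mult_left_mono[OF \<omega>_mono[of "\<bar>x - t\<bar>" \<epsilon>] A] that by fastforce
  have K: "K \<ge> 0" using \<nu>(1) \<nu>(2)[of 0] c(2)[of 0] by linarith
  let ?E = "\<lambda>t. (v t)\<^sup>2 + d t * l\<^sup>2 * (u t)\<^sup>2"
  have "?E t \<le> ?E 0 * exp ((A * \<omega> \<epsilon> / \<epsilon> / \<nu> + A * \<omega> \<epsilon> * l / sqrt \<nu>) * T)"
  proof (rule energy_growth[OF sol _ d(1) _ _ \<nu>(1) _ t])
    fix s assume s: "s \<in> {0..T}"
    obtain x where x: "x \<in> {s..s + \<epsilon>}" "d s = c x" using d(2)[OF s] by blast
    show "\<bar>d s - c s\<bar> \<le> A * \<omega> \<epsilon>" using mod\<epsilon>[OF x(1)] x s by auto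
    show "\<nu> \<le> d s" using x s \<nu> by auto
    show "\<bar>(c (s + \<epsilon>) - c s) / \<epsilon>\<bar> \<le> A * \<omega> \<epsilon> / \<epsilon>"
      unfolding abs_divide using mod\<epsilon>[of "s + \<epsilon>" s] s \<epsilon> by (auto intro!: divide_right_mono)
  qed (use l in auto)
  also have "\<dots> \<le> ((1 + K) * ((v 0)\<^sup>2 + l\<^sup>2 * (u 0)\<^sup>2)) * exp (A * (1 / \<nu> + 1 / sqrt \<nu>) * \<Lambda> * T * \<phi> l)"
  proof (intro mult_mono)
    obtain x where "x \<in> {0..0 + \<epsilon>}" "d 0 = c x" using d(2)[of 0] t by auto
    then have "d 0 \<le> 1 + K" using c(2)[of x] by auto
    then have "d 0 * (l\<^sup>2 * (u 0)\<^sup>2) \<le> (1 + K) * (l\<^sup>2 * (u 0)\<^sup>2)" by (intro mult_right_mono) auto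
    moreover have "(v 0)\<^sup>2 \<le> (1 + K) * (v 0)\<^sup>2" using K by (simp add: algebra_simps)
    ultimately show "?E 0 \<le> (1 + K) * ((v 0)\<^sup>2 + l\<^sup>2 * (u 0)\<^sup>2)" by (simp add: algebra_simps)
    have "(A * \<omega> \<epsilon> / \<epsilon> / \<nu> + A * \<omega> \<epsilon> * l / sqrt \<nu>) * T = A * (1 / \<nu> + 1 / sqrt \<nu>) * T * (l * \<omega> (1 / l))"
      using l by (simp add: \<epsilon>_def field_simps)
    also have "\<dots> \<le> A * (1 / \<nu> + 1 / sqrt \<nu>) * T * (\<Lambda> * \<phi> l)"
      using A \<nu> t \<phi> by (intro mult_left_mono) auto
    finally show "exp ((A * \<omega> \<epsilon> / \<epsilon> / \<nu> + A * \<omega> \<epsilon> * l / sqrt \<nu>) * T) \<le> exp (A * (1 / \<nu> + 1 / sqrt \<nu>) * \<Lambda> * T * \<phi> l)"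
      by (simp add: mult_ac)
  qed (use K in auto)
  finally have 1: "?E t \<le> \<dots>" .
  have "\<nu> \<le> d t" using d(2)[OF t] \<nu> t by auto
  then have "min 1 \<nu> * (l\<^sup>2 * (u t)\<^sup>2) \<le> d t * (l\<^sup>2 * (u t)\<^sup>2)" by (intro mult_right_mono) auto
  moreover have "min 1 \<nu> * (v t)\<^sup>2 \<le> 1 * (v t)\<^sup>2" by (intro mult_right_mono) auto
  ultimately have "min 1 \<nu> * ((v t)\<^sup>2 + l\<^sup>2 * (u t)\<^sup>2) \<le> ?E t" by (simp add: algebra_simps)
  with 1 have "min 1 \<nu> * ((v t)\<^sup>2 + l\<^sup>2 * (u t)\<^sup>2) \<le>
    ((1 + K) * ((v 0)\<^sup>2 + l\<^sup>2 * (u 0)\<^sup>2)) * exp (A * (1 / \<nu> + 1 / sqrt \<nu>) * \<Lambda> * T * \<phi> l)" by linarith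
  moreover have "min 1 \<nu> > 0" using \<nu>(1) by simp
  ultimately show ?thesis by (simp add: pos_le_divide_eq mult_ac del: min_less_iff_conj)
qed

text \<open>The weak condition is parametrised by \<open>\<sigma>\<close>, whereas the frequency
  \<open>l\<close> is given. The intermediate value theorem recovers a \<open>\<sigma>\<close>
  belonging to \<open>l\<close>.\<close>

lemma exists_weak_scale:
  assumes l: "l > 0"
  obtains \<sigma> where "\<sigma> > 0" "l = \<sigma> / sqrt (\<omega> (1 / \<sigma>))"
proof -
  define f where "f = (\<lambda>s. s - l * sqrt (\<omega> (1 / s)))"
  \<comment> \<open>The endpoints are 1 and \<open>l * sqrt (\<omega> 1)\<close> in increasing
    order. Since \<open>\<omega> (1 / s)\<close> does not increase in \<open>s\<close>,
    \<open>f\<close> changes sign between them.\<close>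
  define a where "a = min 1 (l * sqrt (\<omega> 1))"
  define b where "b = max 1 (l * sqrt (\<omega> 1))"
  have a: "a > 0" using l \<omega>_pos[of 1] by (simp add: a_def)
  have ab: "a \<le> 1" "1 \<le> b" by (auto simp: a_def b_def)
  have "continuous_on {0..} \<omega>" using modulus by (simp add: continuity_modulus_def)
  then have "continuous_on {a..b} (\<lambda>s. \<omega> (1 / s))"
    by (rule continuous_on_compose2) (use a in \<open>auto intro!: continuous_intros\<close>)
  then have "continuous_on {a..b} f" unfolding f_def by (intro continuous_intros)
  moreover have "f a \<le> 0"
  proof -
    have "l * sqrt (\<omega> 1) \<le> l * sqrt (\<omega> (1 / a))"
      using l a ab by (intro mult_left_mono real_sqrt_le_mono \<omega>_mono) (auto simp: field_simps)
    then show ?thesis by (simp add: f_def a_def min_def split: if_splits)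
  qed
  moreover have "0 \<le> f b"
  proof -
    have "l * sqrt (\<omega> (1 / b)) \<le> l * sqrt (\<omega> 1)"
      using l ab by (intro mult_left_mono real_sqrt_le_mono \<omega>_mono) (auto simp: field_simps)
    then show ?thesis by (simp add: f_def b_def max_def split: if_splits)
  qed
  ultimately obtain s where s: "a \<le> s" "s \<le> b" "f s = 0"
    using IVT'[of f a 0 b] ab by auto
  have "sqrt (\<omega> (1 / s)) > 0" using \<omega>_pos[of "1 / s"] a s by simp
  then show thesis using s a by (intro that[of s]) (auto simp: f_def field_simps)
qed

text \<open>With \<open>\<epsilon> = 1 / \<sigma>\<close> the two error terms are both of order \<open>\<sigma>\<close>. The regularisation by \<open>\<omega>(\<epsilon>)\<close> only
  controls \<open>\<omega>(\<epsilon>) l\<^sup>2 u\<^sup>2\<close>; the lost factor \<open>1 / \<omega>(\<epsilon>) \<le> (1 + \<sigma>) / \<omega>(1)\<close> is absorbed by the exponential.\<close>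

lemma energy_estimate_weak:
  assumes c: "continuous_on {0..} c" "\<And>t. t \<ge> 0 \<Longrightarrow> 0 \<le> c t \<and> c t \<le> K"
    and mod: "\<And>s t. s \<ge> 0 \<Longrightarrow> t \<ge> 0 \<Longrightarrow> \<bar>c s - c t\<bar> \<le> A * \<omega> \<bar>s - t\<bar>" and A: "A \<ge> 0"
    and \<phi>: "\<And>\<sigma>. \<sigma> > 0 \<Longrightarrow> \<sigma> \<le> \<Lambda> * \<phi> (\<sigma> / sqrt (\<omega> (1 / \<sigma>)))"
    and sol: "solves_on T (\<lambda>t. l\<^sup>2 * c t) u v" and l: "l \<ge> 1" and t: "t \<in> {0..T}"
  shows "(v t)\<^sup>2 + l\<^sup>2 * (u t)\<^sup>2 \<le> (1 + 1 / \<omega> 1) * (1 + K + \<omega> 1 + sqrt (\<omega> 1)) *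
    exp ((1 + (2 * A + 1) * T) * \<Lambda> * \<phi> l) * ((v 0)\<^sup>2 + l\<^sup>2 * (u 0)\<^sup>2)"
proof -
  have l0: "l > 0" using l by simp
  obtain \<sigma> where \<sigma>: "\<sigma> > 0" "l = \<sigma> / sqrt (\<omega> (1 / \<sigma>))" using exists_weak_scale[OF l0] by blast
  define \<epsilon> where "\<epsilon> = 1 / \<sigma>"
  have \<epsilon>: "\<epsilon> > 0" using \<sigma> by (simp add: \<epsilon>_def)
  have w: "\<omega> \<epsilon> > 0" using \<omega>_pos[OF \<epsilon>] .
  have w1: "\<omega> 1 > 0" using \<omega>_pos[of 1] by simp
  have \<sigma>l: "\<sigma> = l * sqrt (\<omega> \<epsilon>)" using \<sigma> w by (simp add: \<epsilon>_def field_simps)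
  have \<sigma>\<phi>: "\<sigma> \<le> \<Lambda> * \<phi> l" using \<phi>[OF \<sigma>(1)] \<sigma>(2) by simp
  obtain d where d: "\<And>t. t \<in> {0..T} \<Longrightarrow> (d has_real_derivative (c (t + \<epsilon>) - c t) / \<epsilon>) (at t within {0..T})"
    "\<And>t. t \<in> {0..T} \<Longrightarrow> \<exists>x\<in>{t..t + \<epsilon>}. d t = c x" using moving_average[OF c(1) \<epsilon>] by blast
  have mod\<epsilon>: "\<bar>c x - c t\<bar> \<le> A * \<omega> \<epsilon>" if "x \<in> {t..t + \<epsilon>}" "t \<ge> 0" for x t
    using mod[of x t] mult_left_mono[OF \<omega>_mono[of "\<bar>x - t\<bar>" \<epsilon>] A] that by fastforce
  have K: "K \<ge> 0" using c(2)[of 0] by linarith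
  let ?d = "\<lambda>t. d t + \<omega> \<epsilon>"
  let ?E = "\<lambda>t. (v t)\<^sup>2 + ?d t * l\<^sup>2 * (u t)\<^sup>2"
  let ?I = "(v 0)\<^sup>2 + l\<^sup>2 * (u 0)\<^sup>2"
  \<comment> \<open>By \<open>\<sigma> = l * sqrt (\<omega> \<epsilon>)\<close> the moving weight
    costs \<open>A * \<sigma>\<close> and the approximation error \<open>(A + 1) * \<sigma>\<close>;
    the extra 1 stems from the added \<open>\<omega> \<epsilon>\<close>, which keeps the weight away
    from 0.\<close>
  have rate: "(A * \<omega> \<epsilon> / \<epsilon> / \<omega> \<epsilon> + ((A + 1) * \<omega> \<epsilon>) * l / sqrt (\<omega> \<epsilon>)) * T = (2 * A + 1) * T * \<sigma>"
  proof -
    have "\<omega> \<epsilon> / sqrt (\<omega> \<epsilon>) = sqrt (\<omega> \<epsilon>)" using w by (simp add: real_div_sqrt)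
    moreover have "((A + 1) * \<omega> \<epsilon>) * l / sqrt (\<omega> \<epsilon>) = (A + 1) * (l * (\<omega> \<epsilon> / sqrt (\<omega> \<epsilon>)))" by simp
    ultimately have "((A + 1) * \<omega> \<epsilon>) * l / sqrt (\<omega> \<epsilon>) = (A + 1) * \<sigma>"
      by (simp only: \<sigma>l)
    moreover have "A * \<omega> \<epsilon> / \<epsilon> / \<omega> \<epsilon> = A * \<sigma>" using w by (simp add: \<epsilon>_def)
    ultimately have "(A * \<omega> \<epsilon> / \<epsilon> / \<omega> \<epsilon> + ((A + 1) * \<omega> \<epsilon>) * l / sqrt (\<omega> \<epsilon>)) * T = (A * \<sigma> + (A + 1) * \<sigma>) * T"
      by (simp only:)
    then show ?thesis by (simp add: algebra_simps)
  qed
  have "?E t \<le> ?E 0 * exp ((A * \<omega> \<epsilon> / \<epsilon> / \<omega> \<epsilon> + ((A + 1) * \<omega> \<epsilon>) * l / sqrt (\<omega> \<epsilon>)) * T)"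
  proof (rule energy_growth[OF sol _ _ _ _ w _ t])
    fix s assume s: "s \<in> {0..T}"
    obtain x where x: "x \<in> {s..s + \<epsilon>}" "d s = c x" using d(2)[OF s] by blast
    show "\<bar>?d s - c s\<bar> \<le> (A + 1) * \<omega> \<epsilon>" using mod\<epsilon>[OF x(1)] x s w by (auto simp: algebra_simps abs_le_iff)
    show "\<omega> \<epsilon> \<le> ?d s" using x s c(2) by auto
    show "\<bar>(c (s + \<epsilon>) - c s) / \<epsilon>\<bar> \<le> A * \<omega> \<epsilon> / \<epsilon>"
      unfolding abs_divide using mod\<epsilon>[of "s + \<epsilon>" s] s \<epsilon> by (auto intro!: divide_right_mono)
    show "(?d has_real_derivative (c (s + \<epsilon>) - c s) / \<epsilon>) (at s within {0..T})"
      using DERIV_add[OF d(1)[OF s] DERIV_const[of "\<omega> \<epsilon>"]] by simp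
  qed (use l in auto)
  then have "?E t \<le> ?E 0 * exp ((2 * A + 1) * T * \<sigma>)" by (simp only: rate)
  also have "\<dots> \<le>
     ((1 + K + \<omega> 1 + sqrt (\<omega> 1)) * ?I) * exp ((2 * A + 1) * T * \<sigma>)"
  proof (intro mult_right_mono)
    \<comment> \<open>\<open>\<omega> \<epsilon>\<close> must be bounded independently of
      \<open>l\<close>. It could be large only for small \<open>\<sigma>\<close>, but if
      \<open>\<sigma> < 1\<close> then \<open>l \<ge> 1\<close> forces
      \<open>\<sigma> \<ge> sqrt (\<omega> 1)\<close>.\<close>
    have w2: "\<omega> \<epsilon> \<le> \<omega> 1 + sqrt (\<omega> 1)"
    proof (cases "\<sigma> \<ge> 1")
      case True
      then have "\<omega> \<epsilon> \<le> \<omega> 1" by (intro \<omega>_mono) (auto simp: \<epsilon>_def)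
      then show ?thesis using w1 by (simp add: add_increasing2)
    next
      case False
      then have "\<omega> 1 \<le> \<omega> \<epsilon>" using \<sigma> by (intro \<omega>_mono) (auto simp: \<epsilon>_def)
      then have "1 * sqrt (\<omega> 1) \<le> l * sqrt (\<omega> \<epsilon>)" using l w1 by (intro mult_mono) auto
      then have s: "sqrt (\<omega> 1) \<le> \<sigma>" using \<sigma>l by simp
      have "\<omega> (\<epsilon> * 1) \<le> (\<epsilon> + 1) * \<omega> 1"
        by (rule continuity_modulus_mult[OF modulus]) (use \<epsilon> in auto)
      also have "\<epsilon> * \<omega> 1 \<le> sqrt (\<omega> 1)"
      proof -
        have "\<omega> 1 = sqrt (\<omega> 1) * sqrt (\<omega> 1)" using w1 by simp
        also have "\<dots> \<le> sqrt (\<omega> 1) * \<sigma>" using s w1 by (intro mult_left_mono) auto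
        finally show ?thesis using \<sigma> by (simp add: \<epsilon>_def field_simps)
      qed
      then have "(\<epsilon> + 1) * \<omega> 1 \<le> \<omega> 1 + sqrt (\<omega> 1)" by (simp add: algebra_simps)
      finally show ?thesis by simp
    qed
    obtain x where "x \<in> {0..0 + \<epsilon>}" "d 0 = c x" using d(2)[of 0] t by auto
    then have "d 0 \<le> K" using c(2)[of x] by auto
    with w2 have "?d 0 \<le> 1 + K + \<omega> 1 + sqrt (\<omega> 1)" by simp
    then have "?d 0 * (l\<^sup>2 * (u 0)\<^sup>2) \<le> (1 + K + \<omega> 1 + sqrt (\<omega> 1)) * (l\<^sup>2 * (u 0)\<^sup>2)"
      by (intro mult_right_mono) auto
    moreover have "1 * (v 0)\<^sup>2 \<le> (1 + K + \<omega> 1 + sqrt (\<omega> 1)) * (v 0)\<^sup>2"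
      using K w1 by (intro mult_right_mono) auto
    ultimately show "?E 0 \<le> (1 + K + \<omega> 1 + sqrt (\<omega> 1)) * ?I"
      unfolding distrib_left by (simp add: mult.assoc)
  qed simp
  finally have 1: "?E t \<le> \<dots>" .
  have "(v t)\<^sup>2 + l\<^sup>2 * (u t)\<^sup>2 \<le> (1 + 1 / \<omega> 1) * (1 + \<sigma>) * ?E t"
  proof -
    let ?P = "(1 + 1 / \<omega> 1) * (1 + \<sigma>)"
    have \<sigma>0: "\<sigma> \<ge> 0" and w1': "1 / \<omega> 1 \<ge> 0" using \<sigma>(1) w1 by simp_all
    have P1: "1 \<le> ?P" by (rule mult_ge1_I) (use \<sigma>0 w1' in simp_all)
    have "\<omega> (\<sigma> * \<epsilon>) \<le> (\<sigma> + 1) * \<omega> \<epsilon>"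
      by (rule continuity_modulus_mult[OF modulus]) (use \<epsilon> \<sigma>0 in simp_all)
    then have "\<omega> 1 \<le> (\<sigma> + 1) * \<omega> \<epsilon>" using \<sigma>(1) by (simp add: \<epsilon>_def)
    then have "1 \<le> 1 / \<omega> 1 * ((\<sigma> + 1) * \<omega> \<epsilon>)" using w1 by (simp add: pos_le_divide_eq)
    also have "\<dots> \<le> (1 + 1 / \<omega> 1) * ((1 + \<sigma>) * ?d t)"
    proof (rule mult_mono)
      obtain x where "x \<in> {t..t + \<epsilon>}" "d t = c x" using d(2)[OF t] by blast
      then have "0 \<le> d t" using c(2)[of x] t by simp
      then show "(\<sigma> + 1) * \<omega> \<epsilon> \<le> (1 + \<sigma>) * ?d t" using \<sigma>0 by (simp add: mult_left_mono add.commute)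
    qed (use \<sigma>0 w1' w in simp_all)
    finally have P2: "1 \<le> ?P * ?d t" by (simp add: mult.assoc)
    have *: "V + W \<le> P * (V + D * W)" if "1 \<le> P" "1 \<le> P * D" "V \<ge> 0" "W \<ge> 0" for P D V W :: real
      using mult_right_mono[OF that(1,3)] mult_right_mono[OF that(2,4)] by (simp add: distrib_left mult.assoc)
    have "(v t)\<^sup>2 + l\<^sup>2 * (u t)\<^sup>2 \<le> ?P * ((v t)\<^sup>2 + ?d t * (l\<^sup>2 * (u t)\<^sup>2))"
      by (rule *[OF P1 P2]) simp_all
    then show ?thesis by (simp only: mult.assoc)
  qed
  from absorb_linear_factor[OF this 1 \<sigma>\<phi>] show ?thesis
    using w1 K A t \<sigma>(1) by (simp add: mult.assoc)
qed

text \<open>The moving average at times near \<open>T\<close> looks beyond \<open>T\<close>.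
  Freezing the coefficient at \<open>T\<close> extends it to the half line and preserves its range
  and its modulus.\<close>

definition stopped_coef :: "real \<Rightarrow> (real \<Rightarrow> real) \<Rightarrow> real \<Rightarrow> real" where
  "stopped_coef T h = (\<lambda>t. m (h (min t T)))"

lemma stopped_coef_bounds:
  assumes Lh: "Lh \<ge> 0" and T: "T \<ge> 0"
    and h: "\<And>t. t \<in> {0..T} \<Longrightarrow> 0 \<le> h t \<and> h t \<le> b"
    and lip: "\<And>s t. s \<in> {0..T} \<Longrightarrow> t \<in> {0..T} \<Longrightarrow> \<bar>h s - h t\<bar> \<le> Lh * \<bar>s - t\<bar>"
  shows "\<And>s t. s \<ge> 0 \<Longrightarrow> t \<ge> 0 \<Longrightarrow> \<bar>stopped_coef T h s - stopped_coef T h t\<bar> \<le> (L * (Lh + 1)) * \<omega> \<bar>s - t\<bar>"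
    and "continuous_on {0..} (stopped_coef T h)" and "\<And>t. t \<ge> 0 \<Longrightarrow> 0 \<le> stopped_coef T h t \<and> stopped_coef T h t \<le> m 0 + L * \<omega> b"
    and "\<And>t. t \<ge> 0 \<Longrightarrow> \<exists>x\<ge>0. stopped_coef T h t = m x"
proof -
  let ?c = "stopped_coef T h"
  have range: "min t T \<in> {0..T}" if "t \<ge> 0" for t using that T by auto
  have 1: "\<bar>?c s - ?c t\<bar> \<le> (L * (Lh + 1)) * \<omega> \<bar>s - t\<bar>" if "s \<ge> 0" "t \<ge> 0" for s t
  proof -
    have "\<bar>?c s - ?c t\<bar> \<le> L * \<omega> \<bar>h (min s T) - h (min t T)\<bar>"
      unfolding stopped_coef_def using h[OF range[OF that(1)]] h[OF range[OF that(2)]] by (intro m_modulus) simp_all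
    also have "\<dots> \<le> L * \<omega> (Lh * \<bar>min s T - min t T\<bar>)"
      using lip[OF range[OF that(1)] range[OF that(2)]] L by (intro mult_left_mono \<omega>_mono) simp_all
    also have "\<dots> \<le> L * \<omega> (Lh * \<bar>s - t\<bar>)"
      using Lh T L by (intro mult_left_mono \<omega>_mono) (auto simp: min_def)
    \<comment> \<open>Multiplying the argument of a modulus by \<open>Lh\<close> costs the factor
      \<open>Lh + 1\<close>, the origin of the constant in the claim.\<close>
    also have "\<dots> \<le> L * ((Lh + 1) * \<omega> \<bar>s - t\<bar>)"
      using Lh T L by (intro mult_left_mono continuity_modulus_mult[OF modulus]) auto
    finally show ?thesis by (simp add: mult.assoc)
  qed
  have "continuous_on {0..} (\<lambda>t. h (min t T))"
    unfolding continuous_on_iff dist_real_def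
  proof (intro ballI allI impI)
    fix x e :: real assume "x \<in> {0..}" "e > 0"
    then have x: "x \<ge> 0" "e > 0" by auto
    show "\<exists>d>0. \<forall>x'\<in>{0..}. \<bar>x' - x\<bar> < d \<longrightarrow> \<bar>h (min x' T) - h (min x T)\<bar> < e"
    proof (intro exI[of _ "e / (Lh + 1)"] conjI ballI impI)
      fix y :: real assume "y \<in> {0..}" "\<bar>y - x\<bar> < e / (Lh + 1)"
      then have y: "y \<ge> 0" "\<bar>y - x\<bar> < e / (Lh + 1)" by auto
      have "\<bar>h (min y T) - h (min x T)\<bar> \<le> Lh * \<bar>min y T - min x T\<bar>"
        by (rule lip[OF range[OF y(1)] range[OF x(1)]])
      also have "\<dots> \<le> Lh * \<bar>y - x\<bar>" using Lh T by (intro mult_left_mono) (auto simp: min_def)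
      also have "\<dots> \<le> Lh * (e / (Lh + 1))" using Lh T y by (intro mult_left_mono) auto
      also have "\<dots> < e" using Lh T x by (simp add: field_simps)
      finally show "\<bar>h (min y T) - h (min x T)\<bar> < e" .
    qed (use Lh T x in auto)
  qed
  then have 2: "continuous_on {0..} ?c" unfolding stopped_coef_def
  proof (rule continuous_on_compose2[OF continuous_on_m], intro image_subsetI)
    fix t :: real assume "t \<in> {0..}"
    then have "t \<ge> 0" by simp
    from h[OF range[OF this]] show "h (min t T) \<in> {0..}" by simp
  qed
  have 3: "0 \<le> ?c t \<and> ?c t \<le> m 0 + L * \<omega> b" if "t \<ge> 0" for t
  proof -
    have "\<bar>m (h (min t T)) - m 0\<bar> \<le> L * \<omega> \<bar>h (min t T) - 0\<bar>"
      using h[OF range[OF that]] by (intro m_modulus) simp_all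
    also have "\<dots> \<le> L * \<omega> b" using h[OF range[OF that]] L by (intro mult_left_mono \<omega>_mono) simp_all
    finally show ?thesis using h[OF range[OF that]] m_nonneg[of "h (min t T)"] by (simp add: stopped_coef_def)
  qed
  show "\<exists>x\<ge>0. ?c t = m x" if "t \<ge> 0" for t
    using h[OF range[OF that]] by (auto simp: stopped_coef_def)
  show "\<bar>?c s - ?c t\<bar> \<le> (L * (Lh + 1)) * \<omega> \<bar>s - t\<bar>" if "s \<ge> 0" "t \<ge> 0" for s t
    by (rule 1[OF that])
  show "continuous_on {0..} ?c" by (rule 2)
  show "0 \<le> ?c t \<and> ?c t \<le> m 0 + L * \<omega> b" if "t \<ge> 0" for t by (rule 3[OF that])
qed

text \<open>What matters is the order of quantifiers: \<open>C\<close> and \<open>R\<close> are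
  fixed before the frequency, the function \<open>h\<close> and the solution, so they are available
  before any data are selected.\<close>

lemma energy_estimate:
  assumes "Lh \<ge> 0" "T \<ge> 0"
  obtains C R where "C \<ge> 0" "R \<ge> 0"
    "\<And>l h u v t. l \<ge> 1 \<Longrightarrow> (\<And>t. t \<in> {0..T} \<Longrightarrow> 0 \<le> h t \<and> h t \<le> b) \<Longrightarrow>
      (\<And>s t. s \<in> {0..T} \<Longrightarrow> t \<in> {0..T} \<Longrightarrow> \<bar>h s - h t\<bar> \<le> Lh * \<bar>s - t\<bar>) \<Longrightarrow>
      solves_on T (\<lambda>t. l\<^sup>2 * m (h t)) u v \<Longrightarrow> t \<in> {0..T} \<Longrightarrow>
      (v t)\<^sup>2 + l\<^sup>2 * (u t)\<^sup>2 \<le> C * exp (R * \<phi> l) * ((v 0)\<^sup>2 + l\<^sup>2 * (u 0)\<^sup>2)"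
proof -
  note that' = that
  define A where "A = L * (Lh + 1)"
  define K where "K = m 0 + L * \<omega> b"
  have A: "A \<ge> 0" using L assms by (simp add: A_def)
  have w1: "\<omega> 1 > 0" using \<omega>_pos[of 1] by simp
  have K: "K \<ge> 0" if "b \<ge> 0" using that m_nonneg[of 0] L \<omega>_nonneg[OF that] by (simp add: K_def)
  \<comment> \<open>For negative \<open>b\<close> no \<open>h\<close> satisfies the range hypothesis
    at the given time, so any constants will do.\<close>
  have trivial: thesis if "\<not> b \<ge> 0"
    proof (rule that'[of 0 0], goal_cases)
    case (3 l h u v t)
    then show ?case using 3(2)[OF 3(5)] that by linarith
  qed auto
  from hyperbolicity show thesis
  proof (elim disjE conjE exE)
    fix \<nu> assume \<nu>: "\<nu> > 0" "\<forall>\<sigma>\<ge>0. \<nu> \<le> m \<sigma>" and \<phi>: "\<forall>\<sigma>>0. \<sigma> * \<omega> (1 / \<sigma>) \<le> \<Lambda> * \<phi> \<sigma>"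
    show thesis
    proof (cases "b \<ge> 0")
      case True
      show thesis
      proof (rule that[of "(1 + K) / min 1 \<nu>" "A * (1 / \<nu> + 1 / sqrt \<nu>) * \<Lambda> * T"], goal_cases)
        case (3 l h u v t)
        let ?c = "stopped_coef T h"
        have c: "\<And>s t. s \<ge> 0 \<Longrightarrow> t \<ge> 0 \<Longrightarrow> \<bar>?c s - ?c t\<bar> \<le> A * \<omega> \<bar>s - t\<bar>"
          "continuous_on {0..} ?c" "\<And>t. t \<ge> 0 \<Longrightarrow> 0 \<le> ?c t \<and> ?c t \<le> K"
          "\<And>t. t \<ge> 0 \<Longrightarrow> \<exists>x\<ge>0. ?c t = m x"
          using stopped_coef_bounds[OF assms, of h b, folded A_def K_def] 3(2,3) by simp_all
        have sol: "solves_on T (\<lambda>t. l\<^sup>2 * stopped_coef T h t) u v" using 3(4) by (simp add: solves_on_def stopped_coef_def min_absorb1)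
          show ?case
        proof (rule energy_estimate_strict[OF \<nu>(1) _ c(2) _ c(1) A _ sol 3(1,5)])
          show "l * \<omega> (1 / l) \<le> \<Lambda> * \<phi> l" using \<phi> 3(1) by auto
          show "stopped_coef T h t \<le> K" if "t \<ge> 0" for t using c(3)[OF that] by simp
          show "\<nu> \<le> stopped_coef T h t" if "t \<ge> 0" for t using c(4)[OF that] \<nu>(2) by auto
        qed
      qed (use K[OF True] \<nu> A \<Lambda>_pos assms in auto)
    qed (fact trivial)
  next
    assume \<phi>: "\<forall>\<sigma>>0. \<sigma> \<le> \<Lambda> * \<phi> (\<sigma> / sqrt (\<omega> (1 / \<sigma>)))"
    show thesis
    proof (cases "b \<ge> 0")
      case True
      show thesis
      proof (rule that[of "(1 + 1 / \<omega> 1) * (1 + K + \<omega> 1 + sqrt (\<omega> 1))" "(1 + (2 * A + 1) * T) * \<Lambda>"], goal_cases)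
        case (3 l h u v t)
        let ?c = "stopped_coef T h"
        have c: "\<And>s t. s \<ge> 0 \<Longrightarrow> t \<ge> 0 \<Longrightarrow> \<bar>?c s - ?c t\<bar> \<le> A * \<omega> \<bar>s - t\<bar>"
          "continuous_on {0..} ?c" "\<And>t. t \<ge> 0 \<Longrightarrow> 0 \<le> ?c t \<and> ?c t \<le> K"
          "\<And>t. t \<ge> 0 \<Longrightarrow> \<exists>x\<ge>0. ?c t = m x"
          using stopped_coef_bounds[OF assms, of h b, folded A_def K_def] 3(2,3) by simp_all
        have sol: "solves_on T (\<lambda>t. l\<^sup>2 * stopped_coef T h t) u v" using 3(4) by (simp add: solves_on_def stopped_coef_def min_absorb1)
          show ?case by (rule energy_estimate_weak[OF c(2,3,1) A \<phi>[rule_format] sol 3(1,5)])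
      qed (use K[OF True] A \<Lambda>_pos assms w1 in auto)
    qed (fact trivial)
  qed
qed

end

section \<open>Fixed points of causal operators\<close>

text \<open>Functions are compared on \<open>{0..T}\<close> only and are arbitrary elsewhere. No
  upper bound is imposed: \<open>g0 + Lh * T\<close> is implied, and Arzela-Ascoli applies.\<close>

definition lip_class :: "real \<Rightarrow> real \<Rightarrow> real \<Rightarrow> (real \<Rightarrow> real) set" where
  "lip_class T Lh g0 = {h. (\<forall>s\<in>{0..T}. \<forall>t\<in>{0..T}. \<bar>h s - h t\<bar> \<le> Lh * \<bar>s - t\<bar>) \<and>
     (\<forall>t\<in>{0..T}. h t \<ge> 0) \<and> h 0 = g0}"

lemma lip_classD:
  assumes "h \<in> lip_class T Lh g0"
  shows "s \<in> {0..T} \<Longrightarrow> t \<in> {0..T} \<Longrightarrow> \<bar>h s - h t\<bar> \<le> Lh * \<bar>s - t\<bar>"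
    and "t \<in> {0..T} \<Longrightarrow> h t \<ge> 0" and "h 0 = g0"
  using assms unfolding lip_class_def by auto

lemma lip_class_comp:
  assumes h: "h \<in> lip_class T Lh g0" and "Lh \<ge> 0"
    and \<theta>: "\<And>t. t \<in> {0..T} \<Longrightarrow> \<theta> t \<in> {0..T}" "\<And>s t. \<bar>\<theta> s - \<theta> t\<bar> \<le> \<bar>s - t\<bar>" "\<theta> 0 = 0"
  shows "h \<circ> \<theta> \<in> lip_class T Lh g0"
proof -
  have "\<bar>h (\<theta> s) - h (\<theta> t)\<bar> \<le> Lh * \<bar>s - t\<bar>" if "s \<in> {0..T}" "t \<in> {0..T}" for s t
    using lip_classD(1)[OF h \<theta>(1)[OF that(1)] \<theta>(1)[OF that(2)]] mult_left_mono[OF \<theta>(2)[of s t] \<open>Lh \<ge> 0\<close>]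
    by linarith
  then show ?thesis using lip_classD(2,3)[OF h] \<theta> by (auto simp: lip_class_def)
qed

text \<open>Tonelli's retarded equation: with the input delayed by \<open>\<delta>\<close>, causality makes the iterates
  stationary on \<open>[0, n + i \<delta>]\<close> after \<open>i\<close> steps, so an exact fixed point is reached.\<close>

lemma causal_delayed_fixpoint:
  assumes n: "0 \<le> n" "n \<le> T" and Lh: "Lh \<ge> 0" and \<delta>: "\<delta> > 0"
    and maps: "\<And>h. h \<in> lip_class T Lh g0 \<Longrightarrow> F h \<in> lip_class T Lh g0"
    and causal: "\<And>h h' s. h \<in> lip_class T Lh g0 \<Longrightarrow> h' \<in> lip_class T Lh g0 \<Longrightarrow> s \<in> {0..T} \<Longrightarrow>
      (\<And>r. r \<in> {0..s} \<Longrightarrow> h r = h' r) \<Longrightarrow> F h s = F h' s"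
    and p: "p \<in> lip_class T Lh g0" "\<And>s. s \<in> {0..n} \<Longrightarrow> F p s = p s"
  obtains h where "h \<in> lip_class T Lh g0" "\<And>t. t \<in> {0..n} \<Longrightarrow> h t = p t"
    "\<And>t. t \<in> {0..T} \<Longrightarrow> \<bar>h t - F h t\<bar> \<le> Lh * \<delta>"
proof -
  \<comment> \<open>The identity on \<open>{0..n}\<close>, constant \<open>n\<close> on
    \<open>{n..n + \<delta>}\<close>, and \<open>t - \<delta>\<close> afterwards. The history is
    read without delay, so it is preserved exactly.\<close>
  define \<theta> where "\<theta> = (\<lambda>t. min t (max n (t - \<delta>)))"
  have \<theta>: "\<theta> t \<in> {0..T}" if "t \<in> {0..T}" for t
    using that n by (auto simp: \<theta>_def min_def max_def)
  have \<theta>_lip: "\<bar>\<theta> s - \<theta> t\<bar> \<le> \<bar>s - t\<bar>" for s t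
    unfolding \<theta>_def by (auto simp: min_def max_def)
  have \<theta>0: "\<theta> 0 = 0" using n by (simp add: \<theta>_def)
  define X where "X = lip_class T Lh g0"
  define hs where "hs = rec_nat (\<lambda>t. p (min t n)) (\<lambda>_ h t. F h (\<theta> t))"
  have hs: "hs 0 = (\<lambda>t. p (min t n))" "hs (Suc i) = (\<lambda>t. F (hs i) (\<theta> t))" for i
    by (simp_all add: hs_def)
  have hsX: "hs i \<in> X" for i
  proof (induction i)
    case 0
    have "p \<circ> (\<lambda>t. min t n) \<in> X" unfolding X_def
      by (rule lip_class_comp[OF p(1) Lh]) (use n in \<open>auto simp: min_def\<close>)
    then show ?case by (simp add: hs o_def)
  next
    case (Suc i)
    have "F (hs i) \<circ> \<theta> \<in> X" unfolding X_def
      by (rule lip_class_comp[OF maps Lh \<theta> \<theta>_lip \<theta>0]) (use Suc in \<open>auto simp: X_def\<close>)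
    then show ?case by (simp add: hs o_def)
  qed
  have agree: "hs (Suc i) t = hs i t" if "t \<in> {0..T}" "t \<le> n + real i * \<delta>" for i t
    using that
  proof (induction i arbitrary: t)
    case 0
    then have t: "t \<in> {0..n}" by auto
    have "\<theta> t = t" using t by (auto simp: \<theta>_def)
    then have "hs (Suc 0) t = F (hs 0) t" by (simp add: hs)
    also have "\<dots> = F p t"
      by (rule causal) (use hsX[of 0] p t n in \<open>auto simp: X_def hs\<close>)
    finally show ?case using p(2)[OF t] t by (simp add: hs)
  next
    case (Suc i)
    have *: "\<theta> t \<le> n + real i * \<delta>"
    proof -
      have "t - \<delta> \<le> n + real i * \<delta>" using Suc.prems by (simp add: algebra_simps)
      moreover have "0 \<le> real i * \<delta>" using \<delta> by simp
      ultimately show ?thesis by (auto simp: \<theta>_def min_def max_def)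
    qed
    show ?case unfolding hs(2)[of "Suc i"] hs(2)[of i]
    proof (rule causal)
      fix r assume r: "r \<in> {0..\<theta> t}"
      have "hs (Suc i) r = hs i r" using \<theta>[OF Suc.prems(1)] r * by (intro Suc.IH) auto
      then show "F (hs i) (\<theta> r) = hs i r" by (simp add: hs)
    next
      show "(\<lambda>t. F (hs i) (\<theta> t)) \<in> lip_class T Lh g0" using hsX[of "Suc i"] by (simp add: X_def hs)
    qed (use hsX \<theta>[OF Suc.prems(1)] in \<open>auto simp: X_def\<close>)
  qed
  have hist: "hs i t = p t" if "t \<in> {0..n}" for i t
  proof (induction i)
    case (Suc i)
    have "hs (Suc i) t = hs i t" by (rule agree) (use that n \<delta> in \<open>auto intro: add_increasing2\<close>)
    then show ?case using Suc by simp
  qed (use that in \<open>simp add: hs\<close>)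
  obtain i where i: "T < real i * \<delta>" using reals_Archimedean3[OF \<delta>] by blast
  have fixp: "hs i t = F (hs i) (\<theta> t)" if "t \<in> {0..T}" for t
    using agree[of t i] that i n by (simp add: hs)
  show thesis
  proof (rule that[of "hs i"])
    fix t assume t: "t \<in> {0..T}"
    \<comment> \<open>The delay never exceeds \<open>\<delta>\<close>, so undoing it costs at most
      \<open>Lh * \<delta>\<close>.\<close>
    have "\<bar>F (hs i) (\<theta> t) - F (hs i) t\<bar> \<le> Lh * \<bar>\<theta> t - t\<bar>"
      by (rule lip_classD(1)[OF maps]) (use hsX \<theta> t in \<open>auto simp: X_def\<close>)
    also have "\<dots> \<le> Lh * \<delta>"
      using Lh \<delta> by (intro mult_left_mono) (auto simp: \<theta>_def min_def max_def)
    finally show "\<bar>hs i t - F (hs i) t\<bar> \<le> Lh * \<delta>" using fixp[OF t] by simp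
  qed (use hsX hist in \<open>auto simp: X_def\<close>)
qed

text \<open>Delays \<open>1 / (j + 1)\<close> give approximate fixed points in an equicontinuous
  class, and a uniform limit is an exact one. Each approximation carries the prescribed history
  exactly, hence so does the limit. Only continuity of \<open>F\<close> is asked for; a contraction
  property is out of reach when \<open>m\<close> merely has the modulus
  \<open>\<omega>\<close>.\<close>

lemma causal_fixpoint:
  assumes n: "0 \<le> n" "n \<le> T" and Lh: "Lh \<ge> 0"
    and maps: "\<And>h. h \<in> lip_class T Lh g0 \<Longrightarrow> F h \<in> lip_class T Lh g0"
    and causal: "\<And>h h' s. h \<in> lip_class T Lh g0 \<Longrightarrow> h' \<in> lip_class T Lh g0 \<Longrightarrow> s \<in> {0..T} \<Longrightarrow>
      (\<And>r. r \<in> {0..s} \<Longrightarrow> h r = h' r) \<Longrightarrow> F h s = F h' s"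
    and cont: "\<And>hs h t. (\<And>j::nat. hs j \<in> lip_class T Lh g0) \<Longrightarrow> h \<in> lip_class T Lh g0 \<Longrightarrow>
      uniform_limit {0..T} hs h sequentially \<Longrightarrow> t \<in> {0..T} \<Longrightarrow> (\<lambda>j. F (hs j) t) \<longlonglongrightarrow> F h t"
    and p: "p \<in> lip_class T Lh g0" "\<And>s. s \<in> {0..n} \<Longrightarrow> F p s = p s"
  obtains h where "h \<in> lip_class T Lh g0" "\<And>t. t \<in> {0..n} \<Longrightarrow> h t = p t"
    "\<And>t. t \<in> {0..T} \<Longrightarrow> F h t = h t"
proof -
  define X where "X = lip_class T Lh g0"
  have "\<exists>h. h \<in> X \<and> (\<forall>t\<in>{0..n}. h t = p t) \<and> (\<forall>t\<in>{0..T}. \<bar>h t - F h t\<bar> \<le> Lh * inverse (real (Suc j)))" for j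
    by (rule causal_delayed_fixpoint[where F = F and p = p and \<delta> = "inverse (real (Suc j))", OF n Lh _ maps causal p])
       (auto simp: X_def)
  then obtain h where h: "\<And>j. h j \<in> X" "\<And>j t. t \<in> {0..n} \<Longrightarrow> h j t = p t"
    "\<And>j t. t \<in> {0..T} \<Longrightarrow> \<bar>h j t - F (h j) t\<bar> \<le> Lh * inverse (real (Suc j))"
    by metis
  note hD = lip_classD[OF h(1)[unfolded X_def]]
  obtain g k where k: "strict_mono (k :: nat \<Rightarrow> nat)"
    and lim: "\<And>e. 0 < e \<Longrightarrow> \<exists>N. \<forall>n x. n \<ge> N \<and> x \<in> {0..T} \<longrightarrow> norm (h (k n) x - g x) < e"
  proof (rule Arzela_Ascoli[of "{0..T}" h "\<bar>g0\<bar> + Lh * T"])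
    fix j x assume x: "x \<in> {0..T}"
    have "\<bar>h j x - h j 0\<bar> \<le> Lh * \<bar>x - 0\<bar>" by (rule hD(1)) (use x in auto)
    moreover have "Lh * x \<le> Lh * T" using x Lh by (intro mult_left_mono) auto
    ultimately show "norm (h j x) \<le> \<bar>g0\<bar> + Lh * T" using hD(3)[of j] x by auto
  next
    fix x e :: real assume x: "x \<in> {0..T}" "0 < e"
    show "\<exists>d>0. \<forall>n y. y \<in> {0..T} \<and> norm (x - y) < d \<longrightarrow> norm (h n x - h n y) < e"
    proof (intro exI[of _ "e / (Lh + 1)"] conjI allI impI)
      fix j y assume y: "y \<in> {0..T} \<and> norm (x - y) < e / (Lh + 1)"
      have "\<bar>h j x - h j y\<bar> \<le> Lh * \<bar>x - y\<bar>" by (rule hD(1)) (use x y in auto)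
      also have "\<dots> \<le> Lh * (e / (Lh + 1))" using Lh y by (intro mult_left_mono) auto
      also have "\<dots> < e" using Lh x by (simp add: field_simps)
      finally show "norm (h j x - h j y) < e" by simp
    qed (use Lh x in auto)
  qed auto
  have ul: "uniform_limit {0..T} (\<lambda>j. h (k j)) g sequentially"
    unfolding uniform_limit_iff eventually_sequentially dist_norm using lim by blast
  have pt: "(\<lambda>j. h (k j) t) \<longlonglongrightarrow> g t" if "t \<in> {0..T}" for t
    by (rule tendsto_uniform_limitI[OF ul that])
  have gX: "g \<in> lip_class T Lh g0"
    unfolding lip_class_def
  proof (intro CollectI conjI ballI)
    fix s t assume st: "s \<in> {0..T}" "t \<in> {0..T}"
    show "\<bar>g s - g t\<bar> \<le> Lh * \<bar>s - t\<bar>"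
      by (rule tendsto_upperbound[OF tendsto_rabs[OF tendsto_diff[OF pt[OF st(1)] pt[OF st(2)]]]])
         (use hD(1)[OF st] in auto)
  next
    fix t assume t: "t \<in> {0..T}"
    show "0 \<le> g t" by (rule tendsto_lowerbound[OF pt[OF t]]) (use hD(2)[OF t] in auto)
  next
    have "(\<lambda>j. h (k j) 0) \<longlonglongrightarrow> g 0" using pt[of 0] n by auto
    then show "g 0 = g0" using hD(3) by (simp add: LIMSEQ_const_iff)
  qed
  show thesis
  proof (rule that[OF gX])
    fix t assume t: "t \<in> {0..n}"
    then show "g t = p t" using pt[of t] n h(2)[OF t] by (simp add: LIMSEQ_const_iff)
  next
    fix t assume t: "t \<in> {0..T}"
    have 1: "(\<lambda>j. F (h (k j)) t) \<longlonglongrightarrow> F g t"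
      by (rule cont[OF _ gX ul t]) (use h(1) in \<open>simp add: X_def\<close>)
    have z: "(\<lambda>j. Lh * inverse (real (Suc (k j)))) \<longlonglongrightarrow> Lh * 0"
      by (intro tendsto_mult_left LIMSEQ_subseq_LIMSEQ[OF LIMSEQ_inverse_real_of_nat k, unfolded o_def])
    have "(\<lambda>j. h (k j) t - F (h (k j)) t) \<longlonglongrightarrow> 0"
      by (rule Lim_null_comparison[OF _ z[unfolded mult_zero_right]]) (use h(3)[OF t] in auto)
    moreover have "(\<lambda>j. h (k j) t - F (h (k j)) t) \<longlonglongrightarrow> g t - F g t"
      by (intro tendsto_diff pt t 1)
    ultimately show "F g t = g t" using LIMSEQ_unique by fastforce
  qed
qed

section \<open>The Kirchhoff operator on a finite horizon\<close>

text \<open>The difference starts from 0 and is driven by the force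
  \<open>l\<^sup>2 (c' - c) u'\<close>. The constant deteriorates with \<open>l\<close>, which is
  harmless because it is applied to one component at a time.\<close>

lemma lin_sol_stable:
  assumes u: "solves_on T (\<lambda>t. l\<^sup>2 * c t) u v" and u': "solves_on T (\<lambda>t. l\<^sup>2 * c' t) u' v'"
    and init: "u 0 = u' 0" "v 0 = v' 0" and l: "l \<ge> 0"
    and c: "\<And>t. t \<in> {0..T} \<Longrightarrow> 0 \<le> c t \<and> c t \<le> K"
    and close: "\<And>t. t \<in> {0..T} \<Longrightarrow> \<bar>c' t - c t\<bar> \<le> \<eta>"
    and M: "\<And>t. t \<in> {0..T} \<Longrightarrow> l\<^sup>2 * (u' t)\<^sup>2 \<le> M" and t: "t \<in> {0..T}"
  shows "l\<^sup>2 * (u' t - u t)\<^sup>2 \<le> (l\<^sup>2 * M * T * exp (((1 + K) * l + 1) * T)) * \<eta>\<^sup>2"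
proof -
  let ?F = "\<lambda>t. (v' t - v t)\<^sup>2 + l\<^sup>2 * (u' t - u t)\<^sup>2"
  have K: "K \<ge> 0" using c[OF t] by linarith
  have \<eta>: "\<eta> \<ge> 0" using close[OF t] by linarith
  have M0: "M \<ge> 0" using M[OF t] zero_le_power2[of l] zero_le_power2[of "u' t"]
    by (meson mult_nonneg_nonneg order_trans)
  have "?F t \<le> (?F 0 + (l\<^sup>2 * M * \<eta>\<^sup>2) * t) * exp (((1 + K) * l + 1) * t)"
  proof (rule gronwall[where F' = "\<lambda>s. 2 * (l * (u' s - u s)) * (v' s - v s) * l * (1 - c s)
      - 2 * (v' s - v s) * (l\<^sup>2 * (c' s - c s) * u' s)", OF _ _ _ _ t])
    fix s assume s: "s \<in> {0..T}"
    have d: "(u has_real_derivative v s) (at s within {0..T})"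
      "(v has_real_derivative - (l\<^sup>2 * c s * u s)) (at s within {0..T})"
      "(u' has_real_derivative v' s) (at s within {0..T})"
      "(v' has_real_derivative - (l\<^sup>2 * c' s * u' s)) (at s within {0..T})"
      using u u' s unfolding solves_on_def by blast+
    show "(?F has_real_derivative 2 * (l * (u' s - u s)) * (v' s - v s) * l * (1 - c s)
      - 2 * (v' s - v s) * (l\<^sup>2 * (c' s - c s) * u' s)) (at s within {0..T})"
      by (rule derivative_eq_intros d refl)+ (simp add: algebra_simps power2_eq_square)
    let ?D = "u' s - u s" and ?W = "v' s - v s"
    have "\<bar>2 * (l * ?D) * ?W\<bar> \<le> ?F s"
      using sum_squares_bound[of "\<bar>l * ?D\<bar>" "\<bar>?W\<bar>"] by (simp add: power_mult_distrib abs_mult)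
    moreover have "\<bar>l * (1 - c s)\<bar> \<le> l * (1 + K)"
      unfolding abs_mult using c[OF s] l by (intro mult_mono) auto
    ultimately have "\<bar>2 * (l * ?D) * ?W * (l * (1 - c s))\<bar> \<le> ?F s * (l * (1 + K))"
      unfolding abs_mult[of "2 * (l * ?D) * ?W"] by (intro mult_mono) auto
    then have 1: "2 * (l * ?D) * ?W * l * (1 - c s) \<le> (1 + K) * l * ?F s"
      by (simp add: mult_ac abs_le_iff)
    have "- (2 * ?W * (l\<^sup>2 * (c' s - c s) * u' s)) \<le> ?W\<^sup>2 + (l\<^sup>2 * (c' s - c s) * u' s)\<^sup>2"
      using sum_squares_bound[of "- ?W" "l\<^sup>2 * (c' s - c s) * u' s"]
      by (simp only: power2_minus mult_minus_left mult_minus_right)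
    moreover have "(l\<^sup>2 * (c' s - c s) * u' s)\<^sup>2 = l\<^sup>2 * (l\<^sup>2 * (u' s)\<^sup>2) * (c' s - c s)\<^sup>2"
      by (simp add: power2_eq_square)
    moreover have "\<dots> \<le> l\<^sup>2 * M * \<eta>\<^sup>2"
      using M[OF s] M0 close[OF s] by (intro mult_mono mult_left_mono abs_le_square_iff[THEN iffD1]) auto
    moreover have "?W\<^sup>2 \<le> ?F s" by simp
    ultimately have 2: "- (2 * ?W * (l\<^sup>2 * (c' s - c s) * u' s)) \<le> ?F s + l\<^sup>2 * M * \<eta>\<^sup>2" by linarith
    show "2 * (l * ?D) * ?W * l * (1 - c s) - 2 * ?W * (l\<^sup>2 * (c' s - c s) * u' s)
      \<le> ((1 + K) * l + 1) * ?F s + l\<^sup>2 * M * \<eta>\<^sup>2"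
      using 1 2 by (simp only: distrib_right[of "(1 + K) * l" 1 "?F s"] mult_1)
  qed (use l K M0 in auto)
  also have "\<dots> = l\<^sup>2 * M * t * exp (((1 + K) * l + 1) * t) * \<eta>\<^sup>2" using init by simp
  also have "\<dots> \<le> l\<^sup>2 * M * T * exp (((1 + K) * l + 1) * T) * \<eta>\<^sup>2"
    using t l K M0 by (intro mult_right_mono mult_mono) (auto intro: mult_left_mono)
  finally show ?thesis using zero_le_power2[of "v' t - v t"] by linarith
qed

section \<open>Componentwise solutions of the linear equation\<close>

locale spectral_data = hyperbolic +
  fixes lam a b :: "nat \<Rightarrow> real"
  assumes lam: "lam k \<ge> 0" and sa: "summable (\<lambda>k. (a k)\<^sup>2)" and sb: "summable (\<lambda>k. (b k)\<^sup>2)"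
    and sa3: "r > 0 \<Longrightarrow> summable (\<lambda>k. lam k ^ 3 * (a k)\<^sup>2 * exp (r * \<phi> (lam k)))"
    and sb1: "r > 0 \<Longrightarrow> summable (\<lambda>k. lam k * (b k)\<^sup>2 * exp (r * \<phi> (lam k)))"
begin

definition U :: "(real \<Rightarrow> real) \<Rightarrow> nat \<Rightarrow> real \<Rightarrow> real" where
  "U c k t = lin_sol (\<lambda>s. (lam k)\<^sup>2 * c s) (a k) (b k) t"

definition V :: "(real \<Rightarrow> real) \<Rightarrow> nat \<Rightarrow> real \<Rightarrow> real" where
  "V c k t = lin_vel (\<lambda>s. (lam k)\<^sup>2 * c s) (a k) (b k) t"

text \<open>The squared norm of \<open>A^(1/2) u(t)\<close> for the linear solution with coefficient
  \<open>c\<close>; the Kirchhoff equation is \<open>G (\<lambda>s. m (h s)) = h\<close>.\<close>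

definition G :: "(real \<Rightarrow> real) \<Rightarrow> real \<Rightarrow> real" where
  "G c t = (\<Sum>k. (lam k)\<^sup>2 * (U c k t)\<^sup>2)"

definition E0 :: "nat \<Rightarrow> real" where
  "E0 k = (b k)\<^sup>2 + (lam k)\<^sup>2 * (a k)\<^sup>2"

definition g0 :: real where
  "g0 = (\<Sum>k. (lam k)\<^sup>2 * (a k)\<^sup>2)"

lemma U_0 [simp]: "U c k 0 = a k" "V c k 0 = b k"
  by (simp_all add: U_def V_def)

lemma UV_causal:
  assumes "\<And>s. s \<in> {0..t} \<Longrightarrow> c s = c' s" "t \<ge> 0"
  shows "U c k t = U c' k t" "V c k t = V c' k t" "G c t = G c' t"
proof -
  show "U c k t = U c' k t" "V c k t = V c' k t" for k
    unfolding U_def V_def by (rule lin_sol_causal; use assms in auto)+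
  then show "G c t = G c' t" by (simp add: G_def)
qed

lemma UV_solves:
  assumes "continuous_on {0..T} c"
  shows "solves_on T (\<lambda>t. (lam k)\<^sup>2 * c t) (U c k) (V c k)"
  unfolding U_def[abs_def] V_def[abs_def] by (intro lin_sol_solves continuous_intros assms)

lemma UV_deriv:
  assumes "continuous_on {0..T} c" "t \<in> {0..T}"
  shows "(U c k has_real_derivative V c k t) (at t within {0..T})"
    and "(V c k has_real_derivative - ((lam k)\<^sup>2 * c t * U c k t)) (at t within {0..T})"
  using UV_solves[OF assms(1)] assms(2) unfolding solves_on_def by auto

text \<open>Interpolation between the norm of the Hilbert space and the weighted norm of order 3/4,
  by \<open>x\<^sup>2 \<le> 1 + x\<^sup>3\<close>; the exponential weight is at least 1.\<close>

lemma summable_lam2_a2: "summable (\<lambda>k. (lam k)\<^sup>2 * (a k)\<^sup>2)"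
proof (rule summable_comparison_test'[of "\<lambda>k. (a k)\<^sup>2 + lam k ^ 3 * (a k)\<^sup>2 * exp (1 * \<phi> (lam k))" 0])
  show "summable (\<lambda>k. (a k)\<^sup>2 + lam k ^ 3 * (a k)\<^sup>2 * exp (1 * \<phi> (lam k)))"
    by (intro summable_add sa sa3) simp
  fix k
  have e: "1 \<le> exp (1 * \<phi> (lam k))" using \<phi>_pos[OF lam, of k] by simp
  have "(lam k)\<^sup>2 \<le> 1 + lam k ^ 3"
  proof (cases "lam k \<le> 1")
    case True then show ?thesis using lam[of k] by (simp add: power_le_one add_increasing2)
  next
    case False
    then have "(lam k)\<^sup>2 \<le> lam k ^ 3" by (intro power_increasing) auto
    then show ?thesis by simp
  qed
  then have "(lam k)\<^sup>2 * (a k)\<^sup>2 \<le> (1 + lam k ^ 3) * (a k)\<^sup>2" by (intro mult_right_mono) auto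
  moreover have "lam k ^ 3 * (a k)\<^sup>2 * 1 \<le> lam k ^ 3 * (a k)\<^sup>2 * exp (1 * \<phi> (lam k))"
    using e lam by (intro mult_left_mono) auto
  ultimately show "norm ((lam k)\<^sup>2 * (a k)\<^sup>2) \<le> (a k)\<^sup>2 + lam k ^ 3 * (a k)\<^sup>2 * exp (1 * \<phi> (lam k))"
    by (simp add: distrib_right)
qed

lemma summable_E0: "summable E0"
  unfolding E0_def[abs_def] by (intro summable_add sb summable_lam2_a2)

lemma summable_lam_E0: "r > 0 \<Longrightarrow> summable (\<lambda>k. lam k * E0 k * exp (r * \<phi> (lam k)))"
  using summable_add[OF sb1 sa3, of r r] by (simp add: E0_def algebra_simps power2_eq_square power3_eq_cube)

lemma E0_nonneg: "E0 k \<ge> 0"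
  by (simp add: E0_def)

text \<open>The energy controls \<open>lam k * U\<close>, which says nothing about \<open>U\<close>
  at frequency 0 and little near it. The velocity bound is integrated instead.\<close>

lemma U_bound:
  assumes c: "continuous_on {0..T} c" and M: "\<And>t. t \<in> {0..T} \<Longrightarrow> (V c k t)\<^sup>2 \<le> M" and t: "t \<in> {0..T}"
  shows "(U c k t)\<^sup>2 \<le> 2 * (a k)\<^sup>2 + 2 * T\<^sup>2 * M"
proof -
  have M0: "M \<ge> 0" using M[OF t] zero_le_power2[of "V c k t"] by linarith
  have "norm (U c k t - U c k 0) \<le> sqrt M * norm (t - 0)"
    by (rule field_differentiable_bound[OF convex_real_interval(5) UV_deriv(1)[OF c]])
       (use t real_sqrt_le_mono[OF M] in auto)
  also have "\<dots> \<le> sqrt M * T" using t M0 by (intro mult_left_mono) auto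
  finally have "\<bar>U c k t - a k\<bar> \<le> sqrt M * T" by simp
  then have "\<bar>U c k t - a k\<bar>\<^sup>2 \<le> (sqrt M * T)\<^sup>2" by (intro power_mono) auto
  then have "(U c k t - a k)\<^sup>2 \<le> M * T\<^sup>2" using M0 by (simp add: power_mult_distrib)
  \<comment> \<open>With \<open>x = U c k t\<close>, the difference of the two sides is the square
    of \<open>x - 2 * a k\<close>.\<close>
  moreover have "(U c k t)\<^sup>2 \<le> 2 * (a k)\<^sup>2 + 2 * (U c k t - a k)\<^sup>2"
    using zero_le_power2[of "U c k t - 2 * a k"] by (simp add: power2_eq_square algebra_simps)
  ultimately show ?thesis by (simp add: mult_ac)
qed

end

text \<open>\<open>dominated\<close> refers to every admissible \<open>h\<close> and not only to
  solutions, so the single sequence \<open>M\<close> is a majorant for the whole Lipschitz class.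
  This makes the class invariant and justifies all exchanges of sums with limits and
  derivatives.\<close>

locale horizon = spectral_data +
  fixes T \<rho> bd Lh B H :: real and M :: "nat \<Rightarrow> real"
  assumes T: "T \<ge> 0" and \<rho>: "\<rho> \<ge> 0" and bd: "bd \<ge> g0" and Lh: "Lh \<ge> 0"
    and sM: "summable M" and slM: "summable (\<lambda>k. lam k * M k)"
    and Lh_bound: "(\<Sum>k. lam k * M k) \<le> Lh"
    and high: "(\<Sum>k. if lam k > \<rho> then M k else 0) \<le> 1"
    and H: "(\<Sum>k. (b k)\<^sup>2) + g0 * (m 0 + L * \<omega> g0) \<le> H" and B: "(\<Sum>k. (a k)\<^sup>2) \<le> B"
    and bd_bound: "\<rho>\<^sup>2 * ((B + H * T) * exp T) + 1 \<le> bd"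
    and dominated: "\<And>h k t. (\<And>t. t \<in> {0..T} \<Longrightarrow> 0 \<le> h t \<and> h t \<le> bd) \<Longrightarrow>
      (\<And>s t. s \<in> {0..T} \<Longrightarrow> t \<in> {0..T} \<Longrightarrow> \<bar>h s - h t\<bar> \<le> Lh * \<bar>s - t\<bar>) \<Longrightarrow> t \<in> {0..T} \<Longrightarrow>
      (V (\<lambda>s. m (h s)) k t)\<^sup>2 + (lam k)\<^sup>2 * (U (\<lambda>s. m (h s)) k t)\<^sup>2 \<le> M k"
begin

abbreviation X :: "(real \<Rightarrow> real) set" where "X \<equiv> lip_class T Lh g0"

text \<open>Members of \<open>X\<close> may exceed \<open>bd\<close>; the bound by \<open>bd\<close>
  is available only a posteriori, for fixed points. Truncation makes \<open>dominated\<close>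
  applicable to every member.\<close>

definition coef :: "(real \<Rightarrow> real) \<Rightarrow> real \<Rightarrow> real" where
  "coef h = (\<lambda>s. m (min bd (h s)))"

lemma g0_nonneg: "g0 \<ge> 0"
  unfolding g0_def by (intro suminf_nonneg summable_lam2_a2) auto

lemma energy_M:
  assumes "h \<in> X" "t \<in> {0..T}"
  shows "(V (coef h) k t)\<^sup>2 + (lam k)\<^sup>2 * (U (coef h) k t)\<^sup>2 \<le> M k"
  unfolding coef_def
proof (rule dominated[OF _ _ assms(2)])
  fix s t assume st: "s \<in> {0..T}" "t \<in> {0..T}"
  have "\<bar>min bd (h s) - min bd (h t)\<bar> \<le> \<bar>h s - h t\<bar>" by (auto simp: min_def)
  then show "\<bar>min bd (h s) - min bd (h t)\<bar> \<le> Lh * \<bar>s - t\<bar>" using lip_classD(1)[OF assms(1) st] by linarith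
next
  fix t assume "t \<in> {0..T}"
  then show "0 \<le> min bd (h t) \<and> min bd (h t) \<le> bd" using lip_classD(2)[OF assms(1)] g0_nonneg bd by auto
qed

lemma M_nonneg: "M k \<ge> 0"
proof -
  have "(\<lambda>_. g0) \<in> X" using g0_nonneg Lh by (auto simp: lip_class_def)
  from energy_M[OF this, of 0 k] T show ?thesis
    using zero_le_power2[of "lam k"] by (simp add: order_trans[rotated])
qed

lemma energy_M':
  assumes "h \<in> X" "t \<in> {0..T}"
  shows "(V (coef h) k t)\<^sup>2 \<le> M k" "(lam k)\<^sup>2 * (U (coef h) k t)\<^sup>2 \<le> M k"
  using energy_M[OF assms, of k] zero_le_power2[of "V (coef h) k t"]
    mult_nonneg_nonneg[OF zero_le_power2[of "lam k"] zero_le_power2[of "U (coef h) k t"]] by linarith+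

lemma continuous_h: "h \<in> X \<Longrightarrow> continuous_on {0..T} h"
  by (rule lipschitz_on_continuous_on[of Lh])
     (use Lh in \<open>auto simp: lipschitz_on_def dist_real_def dest: lip_classD(1)\<close>)

lemma continuous_coef:
  assumes "h \<in> X" shows "continuous_on {0..T} (coef h)"
  unfolding coef_def
  by (rule continuous_on_compose2[OF continuous_on_m continuous_on_min[OF continuous_on_const continuous_h[OF assms]]])
     (use lip_classD(2)[OF assms] g0_nonneg bd in auto)

lemma coef_range:
  assumes "h \<in> X" "t \<in> {0..T}" shows "0 \<le> coef h t \<and> coef h t \<le> m 0 + L * \<omega> bd"
proof -
  have r: "0 \<le> min bd (h t)" using lip_classD(2)[OF assms] g0_nonneg bd by auto
  have "\<bar>m (min bd (h t)) - m 0\<bar> \<le> L * \<omega> \<bar>min bd (h t) - 0\<bar>" using r by (intro m_modulus) auto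
  also have "\<dots> \<le> L * \<omega> bd" using r L by (intro mult_left_mono \<omega>_mono) auto
  finally show ?thesis using m_nonneg[OF r] by (auto simp: coef_def)
qed

lemma twice_prod_le: "\<bar>2 * x * y\<bar> \<le> x\<^sup>2 + y\<^sup>2" for x y :: real
  using sum_squares_bound[of "\<bar>x\<bar>" "\<bar>y\<bar>"] by (simp add: abs_mult)

text \<open>Differentiating \<open>G\<close> costs one factor \<open>lam k\<close>. This is where
  the orders 3/4 and 1/4 come from: \<open>lam k * E0 k\<close> contains
  \<open>lam k ^ 3 * (a k)\<^sup>2\<close> and \<open>lam k * (b k)\<^sup>2\<close>.\<close>

lemma cross_bound:
  assumes "h \<in> X" "t \<in> {0..T}"
  shows "\<bar>2 * (lam k)\<^sup>2 * U (coef h) k t * V (coef h) k t\<bar> \<le> lam k * M k"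
proof -
  have "\<bar>2 * (lam k * U (coef h) k t) * V (coef h) k t\<bar> \<le> M k"
    using twice_prod_le[of "lam k * U (coef h) k t" "V (coef h) k t"] energy_M[OF assms, of k]
    by (simp add: power_mult_distrib)
  then have "lam k * \<bar>2 * (lam k * U (coef h) k t) * V (coef h) k t\<bar> \<le> lam k * M k"
    using lam by (intro mult_left_mono)
  then show ?thesis using lam[of k] by (simp add: abs_mult power2_eq_square mult_ac)
qed

lemma G_deriv:
  assumes h: "h \<in> X" and t: "t \<in> {0..T}"
  shows "(G (coef h) has_real_derivative (\<Sum>k. 2 * (lam k)\<^sup>2 * U (coef h) k t * V (coef h) k t)) (at t within {0..T})"
  unfolding G_def[abs_def]
proof (rule dominated_series_has_derivative(1)[where M = "\<lambda>k. lam k * M k" and f = "\<lambda>k t. (lam k)\<^sup>2 * (U (coef h) k t)\<^sup>2"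
    and S = "{0..T}" and ?t0.0 = 0, OF _ _ _ slM])
  fix k s assume s: "s \<in> {0..T}"
  show "((\<lambda>t. (lam k)\<^sup>2 * (U (coef h) k t)\<^sup>2) has_real_derivative 2 * (lam k)\<^sup>2 * U (coef h) k s * V (coef h) k s) (at s within {0..T})"
    by (rule derivative_eq_intros UV_deriv[OF continuous_coef[OF h] s] refl)+ simp
  show "\<bar>2 * (lam k)\<^sup>2 * U (coef h) k s * V (coef h) k s\<bar> \<le> lam k * M k" by (rule cross_bound[OF h s])
qed (use T t summable_lam2_a2 in auto)

lemma cross_sum_bound:
  assumes h: "h \<in> X" and t: "t \<in> {0..T}"
  shows "\<bar>\<Sum>k. 2 * (lam k)\<^sup>2 * U (coef h) k t * V (coef h) k t\<bar> \<le> Lh"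
  using summable_suminf_le(2)[OF cross_bound[OF h t] slM] Lh_bound by linarith

lemma G_maps:
  assumes h: "h \<in> X" shows "G (coef h) \<in> X"
  unfolding lip_class_def
proof (intro CollectI conjI ballI)
  fix s t assume st: "s \<in> {0..T}" "t \<in> {0..T}"
  have "norm (G (coef h) s - G (coef h) t) \<le> Lh * norm (s - t)"
    by (rule field_differentiable_bound[OF convex_real_interval(5) G_deriv[OF h]])
       (use st cross_sum_bound[OF h] in auto)
  then show "\<bar>G (coef h) s - G (coef h) t\<bar> \<le> Lh * \<bar>s - t\<bar>" by simp
next
  fix t assume t: "t \<in> {0..T}"
  have "summable (\<lambda>k. (lam k)\<^sup>2 * (U (coef h) k t)\<^sup>2)"
    by (rule summable_comparison_test'[OF sM, of 0]) (use energy_M'(2)[OF h t] in auto)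
  then show "0 \<le> G (coef h) t" unfolding G_def by (intro suminf_nonneg) auto
qed (simp add: G_def g0_def)

text \<open>\<open>m\<close> is uniformly continuous on \<open>{0..bd}\<close>, so the truncated
  coefficients converge uniformly; each component then converges by \<open>lin_sol_stable\<close>,
  and \<open>M\<close> dominates the series.\<close>

lemma G_continuous:
  assumes hs: "\<And>j::nat. hs j \<in> X" and h: "h \<in> X" and ul: "uniform_limit {0..T} hs h sequentially"
    and t: "t \<in> {0..T}"
  shows "(\<lambda>j. G (coef (hs j)) t) \<longlonglongrightarrow> G (coef h) t"
  unfolding G_def
proof (rule dominated_series_tendsto[OF _ _ sM])
  show "\<forall>\<^sub>F j in sequentially. \<forall>k. \<bar>(lam k)\<^sup>2 * (U (coef (hs j)) k t)\<^sup>2\<bar> \<le> M k"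
    using energy_M'(2)[OF hs t] by auto
  fix k
  show "(\<lambda>j. (lam k)\<^sup>2 * (U (coef (hs j)) k t)\<^sup>2) \<longlonglongrightarrow> (lam k)\<^sup>2 * (U (coef h) k t)\<^sup>2"
  \<comment> \<open>The stability estimate carries the weight \<open>(lam k)\<^sup>2\<close>, which
    has to be divided out; at frequency 0 the summand is identically 0.\<close>
  proof (cases "lam k = 0")
    case False
    have "continuous_on {0..bd} m" by (rule continuous_on_subset[OF continuous_on_m]) auto
    then have um: "uniformly_continuous_on {0..bd} m" by (intro compact_uniformly_continuous) auto
    have ulc: "uniform_limit {0..T} (\<lambda>j. coef (hs j)) (coef h) sequentially"
      unfolding uniform_limit_iff
    proof (intro allI impI)
      fix e :: real assume "e > 0"
      with um obtain d where d: "d > 0" "\<And>x y. x \<in> {0..bd} \<Longrightarrow> y \<in> {0..bd} \<Longrightarrow> dist y x < d \<Longrightarrow> dist (m y) (m x) < e"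
        unfolding uniformly_continuous_on_def by meson
      from ul d(1) have "\<forall>\<^sub>F j in sequentially. \<forall>x\<in>{0..T}. dist (hs j x) (h x) < d"
        unfolding uniform_limit_iff by blast
      then show "\<forall>\<^sub>F j in sequentially. \<forall>x\<in>{0..T}. dist (coef (hs j) x) (coef h x) < e"
      proof eventually_elim
        case (elim j)
        show ?case
        proof
          fix x assume x: "x \<in> {0..T}"
          have "dist (min bd (hs j x)) (min bd (h x)) \<le> dist (hs j x) (h x)" by (auto simp: dist_real_def min_def)
          then show "dist (coef (hs j) x) (coef h x) < e"
            unfolding coef_def using elim x lip_classD(2)[OF hs x] lip_classD(2)[OF h x] g0_nonneg bd
            by (intro d(2)) (auto intro: le_less_trans)
        qed
      qed
    qed
    define C where "C = (lam k)\<^sup>2 * M k * T * exp (((1 + (m 0 + L * \<omega> bd)) * lam k + 1) * T)"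
    have "(\<lambda>j. (lam k)\<^sup>2 * (U (coef (hs j)) k t - U (coef h) k t)\<^sup>2) \<longlonglongrightarrow> 0"
    proof (rule LIMSEQ_I)
      fix e :: real assume e: "e > 0"
      have C0: "C \<ge> 0" unfolding C_def using M_nonneg T by simp
      \<comment> \<open>Chosen so that \<open>C * \<eta>\<^sup>2\<close> is
        \<open>e * C / (C + 1)\<close>, strictly below \<open>e\<close> even for
        \<open>C = 0\<close>.\<close>
      define \<eta> where "\<eta> = sqrt (e / (C + 1))"
      have \<eta>: "\<eta> > 0" "\<eta>\<^sup>2 = e / (C + 1)" using e C0 by (simp_all add: \<eta>_def)
      from ulc \<eta>(1) obtain N where N: "\<And>j. j \<ge> N \<Longrightarrow> \<forall>x\<in>{0..T}. dist (coef (hs j) x) (coef h x) < \<eta>"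
        unfolding uniform_limit_iff eventually_sequentially by meson
      show "\<exists>N. \<forall>j\<ge>N. norm ((lam k)\<^sup>2 * (U (coef (hs j)) k t - U (coef h) k t)\<^sup>2 - 0) < e"
      proof (intro exI[of _ N] allI impI)
        fix j assume j: "j \<ge> N"
        have "(lam k)\<^sup>2 * (U (coef (hs j)) k t - U (coef h) k t)\<^sup>2 \<le> C * \<eta>\<^sup>2"
          unfolding C_def
          by (rule lin_sol_stable[OF UV_solves[OF continuous_coef[OF h]] UV_solves[OF continuous_coef[OF hs]]
              _ _ lam coef_range[OF h] _ energy_M'(2)[OF hs] t])
             (use N[OF j] in \<open>auto simp: dist_real_def intro: less_imp_le\<close>)
        also have "\<dots> < e" using C0 e by (simp add: \<eta>(2) field_simps)
        finally show "norm ((lam k)\<^sup>2 * (U (coef (hs j)) k t - U (coef h) k t)\<^sup>2 - 0) < e" by simp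
      qed
    qed
    then have "(\<lambda>j. (lam k)\<^sup>2 * (U (coef (hs j)) k t - U (coef h) k t)\<^sup>2 / (lam k)\<^sup>2) \<longlonglongrightarrow> 0 / (lam k)\<^sup>2"
      by (intro tendsto_divide tendsto_const) (use False in auto)
    then have "(\<lambda>j. sqrt ((U (coef (hs j)) k t - U (coef h) k t)\<^sup>2)) \<longlonglongrightarrow> sqrt 0"
      using False by (intro tendsto_real_sqrt) simp
    then have "(\<lambda>j. U (coef (hs j)) k t) \<longlonglongrightarrow> U (coef h) k t"
      using Lim_null[of "\<lambda>j. U (coef (hs j)) k t"] by (simp add: tendsto_rabs_zero_iff)
    then show ?thesis by (intro tendsto_intros)
  qed simp
qed

text \<open>For a fixed point, \<open>h\<close> is the argument of its own coefficient, so
  \<open>coef h * S\<close> is the derivative of \<open>J (h t)\<close> and the sum of the kinetic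
  term and \<open>J (h t)\<close> is conserved. Since \<open>J\<close> is the primitive of the
  truncated \<open>m\<close>, no circularity arises: \<open>h \<le> bd\<close> is not yet
  known.\<close>

lemma kinetic_bound:
  assumes h: "h \<in> X" and fx: "\<And>t. t \<in> {0..T} \<Longrightarrow> G (coef h) t = h t" and t: "t \<in> {0..T}"
  shows "(\<Sum>k. (V (coef h) k t)\<^sup>2) \<le> H"
proof -
  define P where "P = (\<lambda>t. \<Sum>k. (V (coef h) k t)\<^sup>2)"
  define mh where "mh = (\<lambda>x. m (min bd x))"
  define J where "J = (\<lambda>x. integral {0..x} mh)"
  define S where "S = (\<lambda>t. \<Sum>k. 2 * (lam k)\<^sup>2 * U (coef h) k t * V (coef h) k t)"
  define K where "K = m 0 + L * \<omega> bd"
  have cross: "\<bar>2 * V (coef h) k s * - ((lam k)\<^sup>2 * coef h s * U (coef h) k s)\<bar> \<le> K * (lam k * M k)"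
    if s: "s \<in> {0..T}" for k s
  proof -
    have "\<bar>coef h s\<bar> * \<bar>2 * (lam k)\<^sup>2 * U (coef h) k s * V (coef h) k s\<bar> \<le> K * (lam k * M k)"
      using coef_range[OF h s] cross_bound[OF h s] by (intro mult_mono) (auto simp: K_def)
    then show ?thesis by (simp add: abs_mult mult_ac)
  qed
  have dP: "(P has_real_derivative - (coef h s * S s)) (at s within {0..T})" if s: "s \<in> {0..T}" for s
  proof -
    have "(P has_real_derivative (\<Sum>k. 2 * V (coef h) k s * - ((lam k)\<^sup>2 * coef h s * U (coef h) k s))) (at s within {0..T})"
      unfolding P_def
    proof (rule dominated_series_has_derivative(1)[where M = "\<lambda>k. K * (lam k * M k)" and f = "\<lambda>k t. (V (coef h) k t)\<^sup>2"
      and S = "{0..T}" and ?t0.0 = 0, OF _ _ cross])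
      fix k s assume s: "s \<in> {0..T}"
      show "((\<lambda>t. (V (coef h) k t)\<^sup>2) has_real_derivative 2 * V (coef h) k s * - ((lam k)\<^sup>2 * coef h s * U (coef h) k s)) (at s within {0..T})"
        by (rule derivative_eq_intros UV_deriv[OF continuous_coef[OF h] s] refl)+ simp
    qed (use T s sb slM in \<open>auto intro: summable_mult\<close>)
    also have "(\<Sum>k. 2 * V (coef h) k s * - ((lam k)\<^sup>2 * coef h s * U (coef h) k s)) =
      (\<Sum>k. - coef h s * (2 * (lam k)\<^sup>2 * U (coef h) k s * V (coef h) k s))"
      by (simp add: mult_ac)
    also have "\<dots> = - coef h s * S s" unfolding S_def
      by (rule suminf_mult summable_suminf_le(1)[OF cross_bound[OF h s] slM])+
    finally show ?thesis by simp
  qed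
  \<comment> \<open>\<open>J\<close> has to be differentiable on the whole range of
    \<open>h\<close>, which at this stage may exceed \<open>bd\<close>; the Lipschitz class supplies
    an interval containing it.\<close>
  define b2 where "b2 = Lh * T + g0"
  have hr: "h s \<in> {0..b2}" if s: "s \<in> {0..T}" for s
  proof -
    have "\<bar>h s - h 0\<bar> \<le> Lh * \<bar>s - 0\<bar>" by (rule lip_classD(1)[OF h]) (use s in auto)
    moreover have "Lh * \<bar>s - 0\<bar> \<le> Lh * T" using s Lh by (intro mult_left_mono) auto
    ultimately show ?thesis using lip_classD(2)[OF h s] lip_classD(3)[OF h] by (auto simp: b2_def)
  qed
  have cmh: "continuous_on {0..b2} mh" unfolding mh_def
    by (rule continuous_on_compose2[OF continuous_on_m]) (use g0_nonneg bd in \<open>auto intro!: continuous_intros\<close>)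
  have dh: "(h has_real_derivative S s) (at s within {0..T})" if s: "s \<in> {0..T}" for s
  proof (rule has_field_derivative_transform_within[OF _ zero_less_one s])
    show "(G (coef h) has_real_derivative S s) (at s within {0..T})" using G_deriv[OF h s] by (simp add: S_def)
  qed (use fx in auto)
  have dJ: "((\<lambda>s. J (h s)) has_real_derivative coef h s * S s) (at s within {0..T})" if s: "s \<in> {0..T}" for s
  proof -
    have "(J has_real_derivative mh (h s)) (at (h s) within {0..b2})"
      unfolding J_def by (rule integral_has_real_derivative[OF cmh hr[OF s]])
    then have "(J has_real_derivative mh (h s)) (at (h s) within h ` {0..T})"
      by (rule has_field_derivative_subset) (use hr in auto)
    from DERIV_image_chain[OF this dh[OF s]] show ?thesis by (simp add: o_def mh_def coef_def)
  qed
  have "P t + J (h t) \<le> P 0 + J (h 0)"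
    by (rule deriv_nonpos_imp_le[where f' = "\<lambda>_. 0", OF _ _ t]) (use DERIV_add[OF dP dJ] in auto)
  moreover have "0 \<le> J (h t)"
    unfolding J_def
    by (rule integral_nonneg[OF integrable_continuous_real[OF continuous_on_subset[OF cmh]]])
       (use hr[OF t] g0_nonneg bd in \<open>auto simp: mh_def intro!: m_nonneg\<close>)
  \<comment> \<open>Up to \<open>g0 \<le> bd\<close> the truncation is inactive, so the initial
    potential energy, and hence \<open>H\<close>, does not depend on \<open>bd\<close>.\<close>
  moreover have "J (h 0) \<le> g0 * (m 0 + L * \<omega> g0)"
  proof -
    have "norm (integral {0..g0} mh) \<le> integral {0..g0} (\<lambda>x. m 0 + L * \<omega> g0)"
    proof (rule integral_norm_bound_integral)
      show "mh integrable_on {0..g0}"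
        by (rule integrable_continuous_real[OF continuous_on_subset[OF cmh]]) (use Lh T in \<open>auto simp: b2_def\<close>)
      fix x assume x: "x \<in> {0..g0}"
      then have "mh x = m x" using bd by (simp add: mh_def min_absorb2)
      moreover have "\<bar>m x - m 0\<bar> \<le> L * \<omega> \<bar>x - 0\<bar>" using x by (intro m_modulus) auto
      moreover have "L * \<omega> \<bar>x - 0\<bar> \<le> L * \<omega> g0" using x L by (intro mult_left_mono \<omega>_mono) auto
      ultimately show "norm (mh x) \<le> m 0 + L * \<omega> g0" using m_nonneg[of x] x by auto
    qed (rule integrable_const_ivl)
    then show ?thesis using g0_nonneg lip_classD(3)[OF h] by (simp add: J_def)
  qed
  ultimately show ?thesis using H by (simp add: P_def)
qed

text \<open>The truncation is inactive along fixed points. The estimate closes because the left-hand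
  side of \<open>bd_bound\<close> involves \<open>\<rho>\<close>, \<open>T\<close> and the size of
  the data, but not \<open>bd\<close>.\<close>

lemma fixpoint_le_bd:
  assumes h: "h \<in> X" and fx: "\<And>t. t \<in> {0..T} \<Longrightarrow> G (coef h) t = h t" and t: "t \<in> {0..T}"
  shows "h t \<le> bd"
proof -
  define Y where "Y = (\<lambda>t. \<Sum>k. (U (coef h) k t)\<^sup>2)"
  define D where "D = (\<lambda>k. 2 * (a k)\<^sup>2 + 2 * T\<^sup>2 * M k)"
  have sD: "summable D" unfolding D_def by (intro summable_add summable_mult sa sM)
  have UD: "(U (coef h) k s)\<^sup>2 \<le> D k" if "s \<in> {0..T}" for k s
    unfolding D_def by (rule U_bound[OF continuous_coef[OF h] energy_M'(1)[OF h] that])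
  have sU: "summable (\<lambda>k. (U (coef h) k s)\<^sup>2)" if "s \<in> {0..T}" for s
    by (rule summable_comparison_test'[OF sD, of 0]) (use UD[OF that] in auto)
  have sV: "summable (\<lambda>k. (V (coef h) k s)\<^sup>2)" if "s \<in> {0..T}" for s
    by (rule summable_comparison_test'[OF sM, of 0]) (use energy_M'(1)[OF h that] in auto)
  have UV: "\<bar>2 * U (coef h) k s * V (coef h) k s\<bar> \<le> D k + M k" if s: "s \<in> {0..T}" for k s
    using twice_prod_le[of "U (coef h) k s" "V (coef h) k s"] UD[OF s, of k] energy_M'(1)[OF h s, of k] by linarith
  have H0: "H \<ge> 0"
    using order_trans[OF suminf_nonneg[OF sV[OF t]] kinetic_bound[OF h fx t]] by simp
  have "Y t \<le> (Y 0 + H * t) * exp (1 * t)"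
  proof (rule gronwall[where F' = "\<lambda>s. \<Sum>k. 2 * U (coef h) k s * V (coef h) k s", OF _ _ _ H0 t])
    fix s assume s: "s \<in> {0..T}"
    show "(Y has_real_derivative (\<Sum>k. 2 * U (coef h) k s * V (coef h) k s)) (at s within {0..T})"
      unfolding Y_def
    proof (rule dominated_series_has_derivative(1)[where M = "\<lambda>k. D k + M k" and f = "\<lambda>k t. (U (coef h) k t)\<^sup>2"
      and S = "{0..T}" and ?t0.0 = 0, OF _ _ UV])
      fix k s assume s: "s \<in> {0..T}"
      show "((\<lambda>t. (U (coef h) k t)\<^sup>2) has_real_derivative 2 * U (coef h) k s * V (coef h) k s) (at s within {0..T})"
        by (rule derivative_eq_intros UV_deriv[OF continuous_coef[OF h] s] refl)+ simp
    qed (use T s sa sD sM in \<open>auto intro: summable_add\<close>)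
    have "(\<Sum>k. 2 * U (coef h) k s * V (coef h) k s) \<le> (\<Sum>k. (U (coef h) k s)\<^sup>2 + (V (coef h) k s)\<^sup>2)"
      by (intro suminf_le summable_suminf_le(1)[OF UV[OF s] summable_add[OF sD sM]] summable_add sU sV s)
         (simp add: sum_squares_bound)
    also have "\<dots> = Y s + (\<Sum>k. (V (coef h) k s)\<^sup>2)" unfolding Y_def by (rule suminf_add[OF sU[OF s] sV[OF s], symmetric])
    finally show "(\<Sum>k. 2 * U (coef h) k s * V (coef h) k s) \<le> 1 * Y s + H"
      using kinetic_bound[OF h fx s] by simp
  qed simp
  also have "\<dots> \<le> (B + H * T) * exp T"
  proof (intro mult_mono add_mono mult_left_mono)
    show "Y 0 \<le> B" using B by (simp add: Y_def)
    have "0 \<le> (\<Sum>k. (a k)\<^sup>2)" by (intro suminf_nonneg sa) auto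
    then show "0 \<le> B + H * T" using B H0 T by simp
  qed (use t H0 in auto)
  finally have Y: "Y t \<le> (B + H * T) * exp T" .
  have sh: "summable (\<lambda>k. if lam k > \<rho> then M k else 0)"
    by (rule summable_comparison_test'[OF sM, of 0]) (use M_nonneg in auto)
  have le: "(lam k)\<^sup>2 * (U (coef h) k t)\<^sup>2 \<le> \<rho>\<^sup>2 * (U (coef h) k t)\<^sup>2 + (if lam k > \<rho> then M k else 0)" for k
  proof (cases "lam k > \<rho>")
    case True
    then show ?thesis using energy_M'(2)[OF h t, of k] by (simp add: add_increasing)
  next
    case False
    then have "(lam k)\<^sup>2 \<le> \<rho>\<^sup>2" using lam by (intro power_mono) auto
    then show ?thesis using False by (simp add: mult_right_mono)
  qed
  have "h t = G (coef h) t" using fx[OF t] by simp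
  also have "\<dots> \<le> (\<Sum>k. \<rho>\<^sup>2 * (U (coef h) k t)\<^sup>2 + (if lam k > \<rho> then M k else 0))"
    unfolding G_def
  proof (rule suminf_le[OF le])
    show "summable (\<lambda>k. (lam k)\<^sup>2 * (U (coef h) k t)\<^sup>2)"
      by (rule summable_comparison_test'[OF sM, of 0]) (use energy_M'(2)[OF h t] in auto)
  qed (intro summable_add summable_mult sU t sh)
  also have "\<dots> = \<rho>\<^sup>2 * Y t + (\<Sum>k. if lam k > \<rho> then M k else 0)"
    unfolding Y_def by (simp add: suminf_add[OF summable_mult[OF sU[OF t]] sh, symmetric] suminf_mult[OF sU[OF t]])
  also have "\<dots> \<le> \<rho>\<^sup>2 * ((B + H * T) * exp T) + 1"
    using Y high by (intro add_mono mult_left_mono) auto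
  finally show ?thesis using bd_bound by linarith
qed

text \<open>On \<open>[0, n]\<close> the given history \<open>p\<close> stays below the truncation level, so it is a solution of the
  truncated problem as well.\<close>

lemma extend_solution:
  assumes n: "0 \<le> n" "n \<le> T" and p: "p \<in> lip_class n Lh g0"
    and p_bd: "\<And>t. t \<in> {0..n} \<Longrightarrow> p t \<le> bd"
    and p_sol: "\<And>t. t \<in> {0..n} \<Longrightarrow> G (\<lambda>s. m (p s)) t = p t"
  obtains h where "h \<in> X" "\<And>t. t \<in> {0..n} \<Longrightarrow> h t = p t" "\<And>t. t \<in> {0..T} \<Longrightarrow> h t \<le> bd"
    "\<And>t. t \<in> {0..T} \<Longrightarrow> G (\<lambda>s. m (h s)) t = h t"
    "\<And>k t. t \<in> {0..T} \<Longrightarrow> (V (\<lambda>s. m (h s)) k t)\<^sup>2 + (lam k)\<^sup>2 * (U (\<lambda>s. m (h s)) k t)\<^sup>2 \<le> M k"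
proof -
  define q where "q = (\<lambda>t. p (min t n))"
  have qX: "q \<in> X"
    unfolding lip_class_def
  proof (intro CollectI conjI ballI)
    fix s t assume st: "s \<in> {0..T}" "t \<in> {0..T}"
    have "\<bar>q s - q t\<bar> \<le> Lh * \<bar>min s n - min t n\<bar>"
      unfolding q_def by (rule lip_classD(1)[OF p]) (use st n in auto)
    also have "\<dots> \<le> Lh * \<bar>s - t\<bar>" using Lh by (intro mult_left_mono) (auto simp: min_def)
    finally show "\<bar>q s - q t\<bar> \<le> Lh * \<bar>s - t\<bar>" .
  qed (use lip_classD(2,3)[OF p] n in \<open>auto simp: q_def\<close>)
  have q: "G (coef q) s = q s" if s: "s \<in> {0..n}" for s
  proof -
    have "G (coef q) s = G (\<lambda>s. m (p s)) s"
      by (rule UV_causal(3)) (use s p_bd in \<open>auto simp: coef_def q_def min_absorb2\<close>)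
    then show ?thesis using p_sol[OF s] s by (simp add: q_def)
  qed
  have causal: "G (coef h) s = G (coef h') s" if "s \<in> {0..T}" "\<And>r. r \<in> {0..s} \<Longrightarrow> h r = h' r" for h h' s
    by (rule UV_causal(3)) (use that in \<open>auto simp: coef_def\<close>)
  obtain h where h: "h \<in> X" "\<And>t. t \<in> {0..n} \<Longrightarrow> h t = q t" "\<And>t. t \<in> {0..T} \<Longrightarrow> G (coef h) t = h t"
    by (rule causal_fixpoint[where F = "\<lambda>h. G (coef h)" and p = q, OF n Lh G_maps causal G_continuous qX q]) auto
  have le: "h t \<le> bd" if "t \<in> {0..T}" for t by (rule fixpoint_le_bd[OF h(1,3) that])
  have eq: "U (coef h) k t = U (\<lambda>s. m (h s)) k t" "V (coef h) k t = V (\<lambda>s. m (h s)) k t"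
    "G (coef h) t = G (\<lambda>s. m (h s)) t" if "t \<in> {0..T}" for k t
    by (rule UV_causal; use that le in \<open>auto simp: coef_def min_absorb2\<close>)+
  show thesis
  proof (rule that[OF h(1) _ le])
    fix k t assume t: "t \<in> {0..T}"
    show "(V (\<lambda>s. m (h s)) k t)\<^sup>2 + (lam k)\<^sup>2 * (U (\<lambda>s. m (h s)) k t)\<^sup>2 \<le> M k"
      using energy_M[OF h(1) t, of k] by (simp add: eq[OF t])
  qed (use h eq in \<open>auto simp: q_def\<close>)
qed

end

section \<open>Global solutions for data with spectral gaps\<close>

context hyperbolic
begin

text \<open>The constants attached to data of size \<open>B\<close>, a horizon \<open>T\<close> and a cutoff frequency \<open>\<rho>\<close>: the conserved
  energy bound, the bound on \<open>|A\<^sup>1\<^sup>/\<^sup>2 u|\<^sup>2\<close>, the resulting bound on the coefficient, and the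
  Lipschitz constant of \<open>|A\<^sup>1\<^sup>/\<^sup>2 u|\<^sup>2\<close>.\<close>

definition H_const :: "real \<Rightarrow> real" where
  "H_const B = B + B * (m 0 + L * \<omega> B)"

definition bd_const :: "real \<Rightarrow> real \<Rightarrow> real \<Rightarrow> real" where
  "bd_const B T \<rho> = \<rho>\<^sup>2 * ((B + H_const B * T) * exp T) + 1 + B"

definition K_const :: "real \<Rightarrow> real \<Rightarrow> real \<Rightarrow> real" where
  "K_const B T \<rho> = m 0 + L * \<omega> (bd_const B T \<rho>)"

definition low_const :: "real \<Rightarrow> real \<Rightarrow> real \<Rightarrow> real" where
  "low_const B T \<rho> = exp ((1 + K_const B T \<rho>) * \<rho> * T)"

definition Lip_const :: "real \<Rightarrow> real \<Rightarrow> real \<Rightarrow> real" where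
  "Lip_const B T \<rho> = \<rho> * (2 * B) * low_const B T \<rho> + 1"

text \<open>A predicate and not a pair of formulas: \<open>energy_estimate\<close> only yields
  existence, and a pair is selected for each horizon and cutoff when the blocks are built.\<close>

definition energy_const :: "real \<Rightarrow> real \<Rightarrow> real \<Rightarrow> real \<Rightarrow> real \<Rightarrow> bool" where
  "energy_const B T \<rho> C R \<longleftrightarrow> C \<ge> 0 \<and> R \<ge> 0 \<and>
     (\<forall>l h u v. l \<ge> 1 \<longrightarrow> (\<forall>t\<in>{0..T}. 0 \<le> h t \<and> h t \<le> bd_const B T \<rho>) \<longrightarrow>
       (\<forall>s\<in>{0..T}. \<forall>t\<in>{0..T}. \<bar>h s - h t\<bar> \<le> Lip_const B T \<rho> * \<bar>s - t\<bar>) \<longrightarrow>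
       solves_on T (\<lambda>t. l\<^sup>2 * m (h t)) u v \<longrightarrow>
       (\<forall>t\<in>{0..T}. (v t)\<^sup>2 + l\<^sup>2 * (u t)\<^sup>2 \<le> C * exp (R * \<phi> l) * ((v 0)\<^sup>2 + l\<^sup>2 * (u 0)\<^sup>2)))"

lemma H_const_nonneg: "B \<ge> 0 \<Longrightarrow> H_const B \<ge> 0"
  unfolding H_const_def using m_nonneg[of 0] L \<omega>_nonneg[of B] by simp

lemma bd_const_ge: "B \<ge> 0 \<Longrightarrow> T \<ge> 0 \<Longrightarrow> bd_const B T \<rho> \<ge> B"
  unfolding bd_const_def using H_const_nonneg[of B] by simp

text \<open>Together with the monotonicity of \<open>Lip_const\<close>, this makes the solution
  found on one horizon an admissible history for the next.\<close>

lemma bd_const_mono: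
  assumes "B \<ge> 0" "0 \<le> T" "T \<le> T'" "0 \<le> \<rho>" "\<rho> \<le> \<rho>'"
  shows "bd_const B T \<rho> \<le> bd_const B T' \<rho>'"
proof -
  have "H_const B * T \<le> H_const B * T'" using assms H_const_nonneg by (intro mult_left_mono) auto
  then have "\<rho>\<^sup>2 * ((B + H_const B * T) * exp T) \<le> \<rho>'\<^sup>2 * ((B + H_const B * T') * exp T')"
    using assms H_const_nonneg[of B] by (intro mult_mono power_mono) auto
  then show ?thesis by (simp add: bd_const_def)
qed

lemma K_const_nonneg: "B \<ge> 0 \<Longrightarrow> T \<ge> 0 \<Longrightarrow> K_const B T \<rho> \<ge> 0"
  unfolding K_const_def using m_nonneg[of 0] L \<omega>_nonneg[of "bd_const B T \<rho>"] bd_const_ge[of B T \<rho>] by simp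

lemma Lip_const_nonneg: "B \<ge> 0 \<Longrightarrow> \<rho> \<ge> 0 \<Longrightarrow> Lip_const B T \<rho> \<ge> 0"
  unfolding Lip_const_def low_const_def by simp

lemma Lip_const_mono:
  assumes "B \<ge> 0" "0 \<le> T" "T \<le> T'" "0 \<le> \<rho>" "\<rho> \<le> \<rho>'"
  shows "Lip_const B T \<rho> \<le> Lip_const B T' \<rho>'"
proof -
  have "\<omega> (bd_const B T \<rho>) \<le> \<omega> (bd_const B T' \<rho>')"
    using bd_const_mono[OF assms] bd_const_ge[of B T \<rho>] assms by (intro \<omega>_mono) auto
  then have "K_const B T \<rho> \<le> K_const B T' \<rho>'"
    unfolding K_const_def using L by (simp add: mult_left_mono)
  then have "(1 + K_const B T \<rho>) * \<rho> * T \<le> (1 + K_const B T' \<rho>') * \<rho>' * T'"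
    using assms K_const_nonneg[of B T \<rho>] by (intro mult_mono) auto
  then have "low_const B T \<rho> \<le> low_const B T' \<rho>'" by (simp add: low_const_def)
  then show ?thesis unfolding Lip_const_def
    using assms by (intro add_mono mult_mono) (auto simp: low_const_def)
qed

lemma energy_const_exists:
  assumes "B \<ge> 0" "T \<ge> 0" "\<rho> \<ge> 0"
  shows "\<exists>C R. energy_const B T \<rho> C R"
proof -
  obtain C R where CR: "C \<ge> 0" "R \<ge> 0"
    "\<And>l h u v t. l \<ge> 1 \<Longrightarrow> (\<And>t. t \<in> {0..T} \<Longrightarrow> 0 \<le> h t \<and> h t \<le> bd_const B T \<rho>) \<Longrightarrow>
      (\<And>s t. s \<in> {0..T} \<Longrightarrow> t \<in> {0..T} \<Longrightarrow> \<bar>h s - h t\<bar> \<le> Lip_const B T \<rho> * \<bar>s - t\<bar>) \<Longrightarrow>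
      solves_on T (\<lambda>t. l\<^sup>2 * m (h t)) u v \<Longrightarrow> t \<in> {0..T} \<Longrightarrow>
      (v t)\<^sup>2 + l\<^sup>2 * (u t)\<^sup>2 \<le> C * exp (R * \<phi> l) * ((v 0)\<^sup>2 + l\<^sup>2 * (u 0)\<^sup>2)"
    using energy_estimate[OF Lip_const_nonneg[OF assms(1,3), of T] assms(2), of "bd_const B T \<rho>"] by blast
  have "energy_const B T \<rho> C R"
    unfolding energy_const_def by (intro conjI CR allI impI ballI) auto
  then show ?thesis by blast
qed

end

section \<open>Majorants of the component energies and smallness above a cutoff\<close>

context spectral_data
begin

text \<open>For fixed \<open>C\<close> and \<open>R\<close> this holds once \<open>\<rho>\<close> is
  large enough. The difficulty is to have it with the constants belonging to \<open>\<rho>\<close>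
  itself; for that the data must have no frequencies in a long interval above
  \<open>\<rho>\<close>.\<close>

definition spectral_gap :: "real \<Rightarrow> real \<Rightarrow> real \<Rightarrow> bool" where
  "spectral_gap \<rho> C R \<longleftrightarrow> (\<Sum>k. if lam k > \<rho> then lam k * (C * exp (R * \<phi> (lam k)) * E0 k) else 0) \<le> 1"

text \<open>The bounds of \<open>low_energy\<close> and of the hyperbolic estimate, joined at the
  cutoff. The latter requires frequencies of at least 1, hence \<open>\<rho> \<ge> 1\<close> later
  on.\<close>

definition dominator :: "real \<Rightarrow> real \<Rightarrow> real \<Rightarrow> real \<Rightarrow> real \<Rightarrow> nat \<Rightarrow> real" where
  "dominator B T \<rho> C R k = (if lam k \<le> \<rho> then low_const B T \<rho> * E0 k else C * exp (R * \<phi> (lam k)) * E0 k)"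

lemma dominator_nonneg: "C \<ge> 0 \<Longrightarrow> dominator B T \<rho> C R k \<ge> 0"
  unfolding dominator_def low_const_def using E0_nonneg by simp

text \<open>The amplification by \<open>exp (R * \<phi>)\<close> turns the weight \<open>r\<close>
  into \<open>r + R\<close>. Data of every radius absorb the loss, and the solution again has every
  radius.\<close>

lemma summable_lam_dominator:
  assumes "C \<ge> 0" "R \<ge> 0" "r > 0"
  shows "summable (\<lambda>k. lam k * dominator B T \<rho> C R k * exp (r * \<phi> (lam k)))"
proof (rule summable_comparison_test'[of "\<lambda>k. (low_const B T \<rho> + C) * (lam k * E0 k * exp ((r + R) * \<phi> (lam k)))" 0])
  show "summable (\<lambda>k. (low_const B T \<rho> + C) * (lam k * E0 k * exp ((r + R) * \<phi> (lam k))))"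
    using assms by (intro summable_mult summable_lam_E0) auto
  fix k
  have \<phi>: "\<phi> (lam k) > 0" using \<phi>_pos[OF lam] .
  have l: "low_const B T \<rho> \<ge> 0" by (simp add: low_const_def)
  have e: "1 \<le> exp (R * \<phi> (lam k))" using \<phi> assms by simp
  have "dominator B T \<rho> C R k \<le> (low_const B T \<rho> + C) * (E0 k * exp (R * \<phi> (lam k)))"
  proof (cases "lam k \<le> \<rho>")
    case True
    have "low_const B T \<rho> * (E0 k * 1) \<le> (low_const B T \<rho> + C) * (E0 k * exp (R * \<phi> (lam k)))"
      using l assms E0_nonneg e by (intro mult_mono) auto
    then show ?thesis using True by (simp add: dominator_def)
  next
    case False
    have "C * (E0 k * exp (R * \<phi> (lam k))) \<le> (low_const B T \<rho> + C) * (E0 k * exp (R * \<phi> (lam k)))"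
      using l assms E0_nonneg[of k] by (intro mult_right_mono) auto
    then show ?thesis using False by (simp add: dominator_def mult_ac)
  qed
  then have "(lam k * exp (r * \<phi> (lam k))) * dominator B T \<rho> C R k \<le>
    (lam k * exp (r * \<phi> (lam k))) * ((low_const B T \<rho> + C) * (E0 k * exp (R * \<phi> (lam k))))"
    using lam[of k] by (intro mult_left_mono) auto
  moreover have "exp ((r + R) * \<phi> (lam k)) = exp (r * \<phi> (lam k)) * exp (R * \<phi> (lam k))"
    by (simp add: distrib_right exp_add)
  ultimately show "norm (lam k * dominator B T \<rho> C R k * exp (r * \<phi> (lam k))) \<le>
    (low_const B T \<rho> + C) * (lam k * E0 k * exp ((r + R) * \<phi> (lam k)))"
    using lam[of k] dominator_nonneg[OF assms(1), of B T \<rho> R k] by (simp add: mult_ac)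
qed

lemma summable_lam_dominator':
  assumes "C \<ge> 0" "R \<ge> 0"
  shows "summable (\<lambda>k. lam k * dominator B T \<rho> C R k)"
proof (rule summable_comparison_test'[OF summable_lam_dominator[OF assms zero_less_one], of 0])
  fix k
  have "lam k * dominator B T \<rho> C R k * 1 \<le> lam k * dominator B T \<rho> C R k * exp (1 * \<phi> (lam k))"
    using lam[of k] dominator_nonneg[OF assms(1)] \<phi>_pos[OF lam, of k] by (intro mult_left_mono) auto
  then show "norm (lam k * dominator B T \<rho> C R k) \<le> lam k * dominator B T \<rho> C R k * exp (1 * \<phi> (lam k))"
    using lam[of k] dominator_nonneg[OF assms(1)] by simp
qed

lemma summable_dominator:
  assumes "C \<ge> 0" "R \<ge> 0" "\<rho> \<ge> 1"
  shows "summable (dominator B T \<rho> C R)"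
proof (rule summable_comparison_test'[of "\<lambda>k. low_const B T \<rho> * E0 k + lam k * dominator B T \<rho> C R k" 0])
  show "summable (\<lambda>k. low_const B T \<rho> * E0 k + lam k * dominator B T \<rho> C R k)"
    by (intro summable_add summable_mult summable_E0 summable_lam_dominator' assms)
  fix k
  have "dominator B T \<rho> C R k \<le> low_const B T \<rho> * E0 k + lam k * dominator B T \<rho> C R k"
  proof (cases "lam k \<le> \<rho>")
    case True
    then show ?thesis using mult_nonneg_nonneg[OF lam dominator_nonneg[OF assms(1)], of k B T \<rho> R k]
      by (simp add: dominator_def)
  next
    case False
    then have "1 * dominator B T \<rho> C R k \<le> lam k * dominator B T \<rho> C R k"
      using assms dominator_nonneg[OF assms(1)] by (intro mult_right_mono) auto
    moreover have "0 \<le> low_const B T \<rho> * E0 k" using E0_nonneg by (simp add: low_const_def)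
    ultimately show ?thesis by simp
  qed
  then show "norm (dominator B T \<rho> C R k) \<le> low_const B T \<rho> * E0 k + lam k * dominator B T \<rho> C R k"
    using dominator_nonneg[OF assms(1)] by simp
qed

lemma horizon_intro:
  assumes B: "(\<Sum>k. (a k)\<^sup>2) \<le> B" "(\<Sum>k. (b k)\<^sup>2) \<le> B" "g0 \<le> B"
    and T: "T \<ge> 0" and \<rho>: "\<rho> \<ge> 1" and CR: "energy_const B T \<rho> C R" and gap: "spectral_gap \<rho> C R"
  shows "horizon \<omega> m \<phi> L \<Lambda> lam a b T \<rho> (bd_const B T \<rho>) (Lip_const B T \<rho>) B (H_const B) (dominator B T \<rho> C R)"
proof
  have C: "C \<ge> 0" and R: "R \<ge> 0" using CR by (auto simp: energy_const_def)
  have g00: "g0 \<ge> 0" unfolding g0_def by (intro suminf_nonneg summable_lam2_a2) auto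
  have B0: "B \<ge> 0" using g00 B by linarith
  have \<rho>0: "\<rho> \<ge> 0" using \<rho> by simp
  let ?M = "dominator B T \<rho> C R"
  let ?hi = "\<lambda>k. if lam k > \<rho> then lam k * (C * exp (R * \<phi> (lam k)) * E0 k) else 0"
  show "T \<ge> 0" "\<rho> \<ge> 0" by fact+
  show "g0 \<le> bd_const B T \<rho>" using bd_const_ge[OF B0 T] B by (meson order_trans)
  show "Lip_const B T \<rho> \<ge> 0" by (rule Lip_const_nonneg[OF B0 \<rho>0])
  show sM: "summable ?M" by (rule summable_dominator[OF C R \<rho>])
  show slM: "summable (\<lambda>k. lam k * ?M k)" by (rule summable_lam_dominator'[OF C R])
  have hi: "?hi k = (if lam k > \<rho> then lam k * ?M k else 0)" for k by (simp add: dominator_def)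
  have shi: "summable ?hi"
    by (rule summable_comparison_test'[OF slM, of 0]) (use lam dominator_nonneg[OF C] in \<open>auto simp: hi\<close>)
  have low0: "low_const B T \<rho> \<ge> 0" by (simp add: low_const_def)
  show "(\<Sum>k. lam k * ?M k) \<le> Lip_const B T \<rho>"
  proof -
    have "(\<Sum>k. lam k * ?M k) \<le> (\<Sum>k. \<rho> * low_const B T \<rho> * E0 k + ?hi k)"
    proof (rule suminf_le[OF _ slM summable_add[OF summable_mult[OF summable_E0] shi]])
      fix k
      have "lam k * (low_const B T \<rho> * E0 k) \<le> \<rho> * (low_const B T \<rho> * E0 k)" if "lam k \<le> \<rho>"
        using that low0 E0_nonneg by (intro mult_right_mono) auto
      moreover have "0 \<le> \<rho> * low_const B T \<rho> * E0 k" using low0 E0_nonneg \<rho>0 by simp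
      ultimately show "lam k * ?M k \<le> \<rho> * low_const B T \<rho> * E0 k + ?hi k" by (auto simp: dominator_def mult.assoc)
    qed
    also have "\<dots> = \<rho> * low_const B T \<rho> * (\<Sum>k. E0 k) + (\<Sum>k. ?hi k)"
      by (simp add: suminf_add[OF summable_mult[OF summable_E0] shi, symmetric] suminf_mult[OF summable_E0])
    also have "(\<Sum>k. E0 k) = (\<Sum>k. (b k)\<^sup>2) + g0"
      unfolding E0_def g0_def by (rule suminf_add[OF sb summable_lam2_a2, symmetric])
    also have "\<rho> * low_const B T \<rho> * \<dots> + (\<Sum>k. ?hi k) \<le> \<rho> * low_const B T \<rho> * (2 * B) + 1"
      using B low0 \<rho>0 gap by (intro add_mono mult_left_mono) (auto simp: spectral_gap_def)
    finally show ?thesis by (simp add: Lip_const_def mult_ac)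
  qed
  \<comment> \<open>The gap condition bounds the tail weighted by \<open>lam k\<close>; since
    \<open>\<rho> \<ge> 1\<close>, it bounds the unweighted tail too.\<close>
  show "(\<Sum>k. if lam k > \<rho> then ?M k else 0) \<le> 1"
  proof -
    have "(\<Sum>k. if lam k > \<rho> then ?M k else 0) \<le> (\<Sum>k. ?hi k)"
    proof (rule suminf_le[OF _ _ shi])
      show "summable (\<lambda>k. if lam k > \<rho> then ?M k else 0)"
        by (rule summable_comparison_test'[OF sM, of 0]) (use dominator_nonneg[OF C] in auto)
      fix k
      have "1 * ?M k \<le> lam k * ?M k" if "lam k > \<rho>"
        using that \<rho> dominator_nonneg[OF C] by (intro mult_right_mono) auto
      then show "(if lam k > \<rho> then ?M k else 0) \<le> ?hi k" by (simp add: hi)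
    qed
    then show ?thesis using gap by (simp add: spectral_gap_def)
  qed
  show "(\<Sum>k. (b k)\<^sup>2) + g0 * (m 0 + L * \<omega> g0) \<le> H_const B"
    unfolding H_const_def using B g00 m_nonneg[of 0] L \<omega>_mono[of g0 B] \<omega>_nonneg[of g0]
    by (intro add_mono mult_mono) (auto intro: mult_left_mono)
  show "(\<Sum>k. (a k)\<^sup>2) \<le> B" by fact
  show "\<rho>\<^sup>2 * ((B + H_const B * T) * exp T) + 1 \<le> bd_const B T \<rho>" using B0 by (simp add: bd_const_def)
  fix h k t
  assume h: "\<And>t. t \<in> {0..T} \<Longrightarrow> 0 \<le> h t \<and> h t \<le> bd_const B T \<rho>"
    and lip: "\<And>s t. s \<in> {0..T} \<Longrightarrow> t \<in> {0..T} \<Longrightarrow> \<bar>h s - h t\<bar> \<le> Lip_const B T \<rho> * \<bar>s - t\<bar>"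
    and t: "t \<in> {0..T}"
  have "continuous_on {0..T} h"
    by (rule lipschitz_on_continuous_on[of "Lip_const B T \<rho>"])
       (use lip Lip_const_nonneg[OF B0 \<rho>0] in \<open>auto simp: lipschitz_on_def dist_real_def\<close>)
  then have c: "continuous_on {0..T} (\<lambda>s. m (h s))"
    by (rule continuous_on_compose2[OF continuous_on_m]) (use h in auto)
  note sol = UV_solves[OF c, of k]
  let ?E = "\<lambda>t. (V (\<lambda>s. m (h s)) k t)\<^sup>2 + (lam k)\<^sup>2 * (U (\<lambda>s. m (h s)) k t)\<^sup>2"
  have E0: "?E 0 = E0 k" by (simp add: E0_def)
  show "?E t \<le> ?M k"
  proof (cases "lam k \<le> \<rho>")
    case True
    have "?E t \<le> ?E 0 * exp ((1 + K_const B T \<rho>) * lam k * T)"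
    proof (rule low_energy[OF sol lam _ t])
      fix s assume s: "s \<in> {0..T}"
      have "\<bar>m (h s) - m 0\<bar> \<le> L * \<omega> \<bar>h s - 0\<bar>" using h[OF s] by (intro m_modulus) auto
      also have "\<dots> \<le> L * \<omega> (bd_const B T \<rho>)" using h[OF s] L by (intro mult_left_mono \<omega>_mono) auto
      finally show "0 \<le> m (h s) \<and> m (h s) \<le> K_const B T \<rho>"
        using m_nonneg[of "h s"] h[OF s] by (auto simp: K_const_def)
    qed
    also have "\<dots> \<le> E0 k * low_const B T \<rho>"
      unfolding E0 low_const_def using E0_nonneg True lam[of k] T K_const_nonneg[OF B0 T, of \<rho>]
      by (intro mult_left_mono) (auto intro!: mult_mono)
    finally show ?thesis using True by (simp add: dominator_def mult_ac)
  next
    case False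
    have "?E t \<le> C * exp (R * \<phi> (lam k)) * ?E 0"
      using CR[unfolded energy_const_def, THEN conjunct2, THEN conjunct2, rule_format, of "lam k" h, OF _ h lip sol t]
        False \<rho> by auto
    then show ?thesis using False E0 by (simp add: dominator_def)
  qed
qed

text \<open>Cutoff, truncation level and majorant change with the horizon, and no bound is uniform
  in time; hence the majorant in the last conclusion depends on \<open>T\<close>. Dependent choice
  makes the successive solutions agree, so that they can be glued.\<close>

lemma global_scalar_solution:
  fixes Ts \<rho>s :: "nat \<Rightarrow> real"
  assumes B: "(\<Sum>k. (a k)\<^sup>2) \<le> B" "(\<Sum>k. (b k)\<^sup>2) \<le> B" "g0 \<le> B"
    and Ts: "mono Ts" "\<And>j. Ts j \<ge> real j" and \<rho>s: "mono \<rho>s" "\<And>j. \<rho>s j \<ge> 1"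
    and gaps: "\<And>j. energy_const B (Ts j) (\<rho>s j) (C j) (R j)" "\<And>j. spectral_gap (\<rho>s j) (C j) (R j)"
  obtains h where "\<And>t. t \<ge> 0 \<Longrightarrow> h t \<ge> 0" "continuous_on {0..} h"
    "\<And>t. t \<ge> 0 \<Longrightarrow> G (\<lambda>s. m (h s)) t = h t"
    "\<And>T. \<exists>M. summable M \<and> (\<forall>r>0. summable (\<lambda>k. lam k * M k * exp (r * \<phi> (lam k)))) \<and>
      (\<forall>k. \<forall>t\<in>{0..T}. (V (\<lambda>s. m (h s)) k t)\<^sup>2 + (lam k)\<^sup>2 * (U (\<lambda>s. m (h s)) k t)\<^sup>2 \<le> M k)"
proof -
  have g00: "g0 \<ge> 0" unfolding g0_def by (intro suminf_nonneg summable_lam2_a2) auto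
  have B0: "B \<ge> 0" using g00 B by linarith
  have T0: "Ts j \<ge> 0" for j using Ts(2)[of j] by linarith
  have CR: "C j \<ge> 0" "R j \<ge> 0" for j using gaps(1)[of j] by (auto simp: energy_const_def)
  have TS: "Ts j \<le> Ts (Suc j)" and \<rho>S: "\<rho>s j \<le> \<rho>s (Suc j)" for j
    using Ts(1) \<rho>s(1) by (auto simp: mono_def)
  have \<rho>0: "0 \<le> \<rho>s j" for j using \<rho>s(2)[of j] by linarith
  define M where "M = (\<lambda>j. dominator B (Ts j) (\<rho>s j) (C j) (R j))"
  define bd where "bd = (\<lambda>j. bd_const B (Ts j) (\<rho>s j))"
  define Lh where "Lh = (\<lambda>j. Lip_const B (Ts j) (\<rho>s j))"
  have hor: "horizon \<omega> m \<phi> L \<Lambda> lam a b (Ts j) (\<rho>s j) (bd j) (Lh j) B (H_const B) (M j)" for j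
    unfolding M_def bd_def Lh_def by (rule horizon_intro[OF B T0 \<rho>s(2) gaps])
  define P where "P = (\<lambda>j h. h \<in> lip_class (Ts j) (Lh j) g0 \<and> (\<forall>t\<in>{0..Ts j}. h t \<le> bd j \<and> G (\<lambda>s. m (h s)) t = h t \<and>
    (\<forall>k. (V (\<lambda>s. m (h s)) k t)\<^sup>2 + (lam k)\<^sup>2 * (U (\<lambda>s. m (h s)) k t)\<^sup>2 \<le> M j k)))"
  define Q where "Q = (\<lambda>j (h::real \<Rightarrow> real) h'. \<forall>t\<in>{0..Ts j}. h' t = h t)"
  have "\<exists>f. \<forall>j. P j (f j) \<and> Q j (f j) (f (Suc j))"
  proof (rule dependent_nat_choice)
    \<comment> \<open>The start is an extension of a history consisting of time 0 only, where
      \<open>G\<close> has the value \<open>g0\<close> for every coefficient.\<close>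
    obtain h where "h \<in> lip_class (Ts 0) (Lh 0) g0" "\<And>t. t \<in> {0..Ts 0} \<Longrightarrow> h t \<le> bd 0"
      "\<And>t. t \<in> {0..Ts 0} \<Longrightarrow> G (\<lambda>s. m (h s)) t = h t"
      "\<And>k t. t \<in> {0..Ts 0} \<Longrightarrow> (V (\<lambda>s. m (h s)) k t)\<^sup>2 + (lam k)\<^sup>2 * (U (\<lambda>s. m (h s)) k t)\<^sup>2 \<le> M 0 k"
    proof (rule horizon.extend_solution[OF hor[of 0], of 0 "\<lambda>_. g0"])
      show "(\<lambda>_. g0) \<in> lip_class 0 (Lh 0) g0" using g00 by (auto simp: lip_class_def)
      show "g0 \<le> bd 0" using B bd_const_ge[OF B0 T0[of 0]] unfolding bd_def by (meson order_trans)
      show "G (\<lambda>s. m g0) t = g0" if "t \<in> {0..0}" for t using that by (simp add: G_def g0_def)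
    qed (use T0 in auto)
    then show "\<exists>h. P 0 h" unfolding P_def by blast
  next
    fix p j assume p: "P j p"
    obtain h where "h \<in> lip_class (Ts (Suc j)) (Lh (Suc j)) g0" "\<And>t. t \<in> {0..Ts j} \<Longrightarrow> h t = p t"
      "\<And>t. t \<in> {0..Ts (Suc j)} \<Longrightarrow> h t \<le> bd (Suc j)"
      "\<And>t. t \<in> {0..Ts (Suc j)} \<Longrightarrow> G (\<lambda>s. m (h s)) t = h t"
      "\<And>k t. t \<in> {0..Ts (Suc j)} \<Longrightarrow> (V (\<lambda>s. m (h s)) k t)\<^sup>2 + (lam k)\<^sup>2 * (U (\<lambda>s. m (h s)) k t)\<^sup>2 \<le> M (Suc j) k"
    proof (rule horizon.extend_solution[OF hor[of "Suc j"], of "Ts j" p])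
      have "Lh j \<le> Lh (Suc j)" unfolding Lh_def by (rule Lip_const_mono[OF B0 T0 TS \<rho>0 \<rho>S])
      then have "Lh j * \<bar>s - t\<bar> \<le> Lh (Suc j) * \<bar>s - t\<bar>" for s t by (intro mult_right_mono) auto
      moreover have pl: "p \<in> lip_class (Ts j) (Lh j) g0" using p by (simp add: P_def)
      ultimately show "p \<in> lip_class (Ts j) (Lh (Suc j)) g0"
        using lip_classD(2,3)[OF pl] order_trans[OF lip_classD(1)[OF pl]] unfolding lip_class_def by blast
      have "bd j \<le> bd (Suc j)" unfolding bd_def by (rule bd_const_mono[OF B0 T0 TS \<rho>0 \<rho>S])
      then show "p t \<le> bd (Suc j)" if "t \<in> {0..Ts j}" for t using p that unfolding P_def by force
      show "G (\<lambda>s. m (p s)) t = p t" if "t \<in> {0..Ts j}" for t using p that unfolding P_def by blast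
    qed (use T0 TS in auto)
    then show "\<exists>h. P (Suc j) h \<and> Q j p h" unfolding P_def Q_def by blast
  qed
  then obtain f where f: "\<And>j. P j (f j)" "\<And>j. Q j (f j) (f (Suc j))" by blast
  have f_agree: "f (j + i) t = f j t" if "t \<in> {0..Ts j}" for i j t
  proof (induction i)
    case (Suc i)
    have "Ts j \<le> Ts (j + i)" using Ts(1) by (simp add: mono_def)
    then have "f (Suc (j + i)) t = f (j + i) t" using f(2)[of "j + i"] that unfolding Q_def by auto
    then show ?case using Suc by simp
  qed simp
  \<comment> \<open>Since \<open>Ts j \<ge> real j\<close>, the horizon with index
    \<open>J t\<close> contains \<open>t\<close>; by \<open>f_agree\<close> every other horizon
    containing \<open>t\<close> gives the same value.\<close>
  define J where "J = (\<lambda>t::real. nat \<lceil>t\<rceil>)"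
  have tJ: "t \<le> real (J t)" for t unfolding J_def by (rule real_nat_ceiling_ge)
  have J: "t \<in> {0..Ts (J t)}" if "t \<ge> 0" for t
    using Ts(2)[of "J t"] tJ[of t] that by simp
  define h where "h = (\<lambda>t. f (J t) t)"
  have h: "h t = f j t" if "t \<in> {0..Ts j}" for j t
  proof -
    have t: "t \<in> {0..Ts (J t)}" using that by (intro J) auto
    show ?thesis
    proof (cases "j \<le> J t")
      case True
      then show ?thesis using f_agree[OF that, of "J t - j"] by (simp add: h_def)
    next
      case False
      then show ?thesis using f_agree[OF t, of "j - J t"] by (simp add: h_def)
    qed
  qed
  have hUV: "U (\<lambda>s. m (h s)) k t = U (\<lambda>s. m (f j s)) k t" "V (\<lambda>s. m (h s)) k t = V (\<lambda>s. m (f j s)) k t"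
    "G (\<lambda>s. m (h s)) t = G (\<lambda>s. m (f j s)) t" if t: "t \<in> {0..Ts j}" for j k t
  proof -
    have eq: "m (h s) = m (f j s)" if "s \<in> {0..t}" for s using h[of s j] that t by simp
    have t0: "0 \<le> t" using t by simp
    show "U (\<lambda>s. m (h s)) k t = U (\<lambda>s. m (f j s)) k t" "V (\<lambda>s. m (h s)) k t = V (\<lambda>s. m (f j s)) k t"
      "G (\<lambda>s. m (h s)) t = G (\<lambda>s. m (f j s)) t" by (rule UV_causal, erule eq, rule t0)+
  qed
  show thesis
  proof (rule that[of h])
    fix t :: real assume t: "t \<ge> 0"
    note Pt = f(1)[of "J t", unfolded P_def]
    show "h t \<ge> 0" using lip_classD(2)[OF conjunct1[OF Pt] J[OF t]] by (simp add: h_def)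
    show "G (\<lambda>s. m (h s)) t = h t"
      unfolding hUV(3)[OF J[OF t]] h[OF J[OF t]] using Pt J[OF t] by blast
  next
    show "continuous_on {0..} h"
      unfolding continuous_on_eq_continuous_within
    proof
      fix t :: real assume "t \<in> {0..}"
      then have t: "t \<ge> 0" by simp
      define j where "j = J (t + 1)"
      have tj: "t + 1 \<le> Ts j" using J[of "t + 1"] t by (simp add: j_def)
      have fj: "f j \<in> lip_class (Ts j) (Lh j) g0" using f(1)[of j] by (simp add: P_def)
      have "continuous_on {0..Ts j} (f j)"
        by (rule horizon.continuous_h[OF hor fj])
      then have "continuous_on {0..Ts j} h" by (rule continuous_on_eq) (simp only: h)
      then have "continuous (at t within {0..Ts j}) h" using t tj by (simp add: continuous_on_eq_continuous_within)
      \<comment> \<open>The horizon reaches at least to \<open>t + 1\<close>, so \<open>t\<close> is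
        not its right end and the two one-sided filters coincide.\<close>
      moreover have "at t within {0..Ts j} = at t within {0..}"
        by (rule at_within_nhd[of t "{..<t + 1}"]) (use tj in auto)
      ultimately show "continuous (at t within {0..}) h" by simp
    qed
  next
    fix T :: real
    define j where "j = J T"
    have Tj: "T \<le> Ts j" using Ts(2)[of j] tJ[of T] by (simp add: j_def)
    show "\<exists>M. summable M \<and> (\<forall>r>0. summable (\<lambda>k. lam k * M k * exp (r * \<phi> (lam k)))) \<and>
      (\<forall>k. \<forall>t\<in>{0..T}. (V (\<lambda>s. m (h s)) k t)\<^sup>2 + (lam k)\<^sup>2 * (U (\<lambda>s. m (h s)) k t)\<^sup>2 \<le> M k)"
    proof (intro exI[of _ "M j"] conjI allI impI ballI)
      show "summable (M j)" unfolding M_def by (rule summable_dominator[OF CR \<rho>s(2)])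
      show "summable (\<lambda>k. lam k * M j k * exp (r * \<phi> (lam k)))" if "r > 0" for r
        unfolding M_def by (rule summable_lam_dominator[OF CR that])
      fix k t assume "t \<in> {0..T}"
      then have t: "t \<in> {0..Ts j}" using Tj by auto
      show "(V (\<lambda>s. m (h s)) k t)\<^sup>2 + (lam k)\<^sup>2 * (U (\<lambda>s. m (h s)) k t)\<^sup>2 \<le> M j k"
        unfolding hUV(1,2)[OF t] using f(1)[of j] t unfolding P_def by blast
    qed
  qed
qed

end

section \<open>Expansions in an orthonormal system\<close>

locale onb =
  fixes e :: "nat \<Rightarrow> 'a::{real_inner, complete_space}"
  assumes complete: "complete_orthonormal_system e"
begin

lemma inner_e: "inner (e j) (e k) = (if j = k then 1 else 0)"
  using complete by (simp add: complete_orthonormal_system_def)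

lemma norm_finite_expansion:
  assumes "finite S" shows "(norm (\<Sum>k\<in>S. c k *\<^sub>R e k))\<^sup>2 = (\<Sum>k\<in>S. (c k)\<^sup>2)"
  using assms
proof induction
  case (insert x S)
  have "inner (e x) (\<Sum>k\<in>S. c k *\<^sub>R e k) = (\<Sum>k\<in>S. 0)"
    unfolding inner_sum_right by (rule sum.cong) (use insert in \<open>auto simp: inner_e\<close>)
  then have "orthogonal (c x *\<^sub>R e x) (\<Sum>k\<in>S. c k *\<^sub>R e k)" by (simp add: orthogonal_def)
  moreover have "(norm (c x *\<^sub>R e x))\<^sup>2 = (c x)\<^sup>2"
    by (simp add: power_mult_distrib norm_eq_1[THEN iffD2] inner_e)
  ultimately show ?case using insert by (simp add: norm_add_Pythagorean)
qed simp

text \<open>The sort of \<open>e\<close> is not a subsort of \<open>banach\<close>, so the library's Cauchy criterion for series does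
  not apply.\<close>

lemma summable_expansion:
  assumes c: "summable (\<lambda>k. (c k)\<^sup>2)" shows "summable (\<lambda>k. c k *\<^sub>R e k)"
proof -
  let ?S = "\<lambda>n. \<Sum>k<n. c k *\<^sub>R e k" and ?s = "\<lambda>n. \<Sum>k<n. (c k)\<^sup>2"
  have eq: "(norm (?S n - ?S m))\<^sup>2 = ?s n - ?s m" if "m \<le> n" for m n
  proof -
    have "?S n - ?S m = (\<Sum>k\<in>{m..<n}. c k *\<^sub>R e k)" "?s n - ?s m = (\<Sum>k\<in>{m..<n}. (c k)\<^sup>2)"
      using that by (simp_all add: lessThan_atLeast0 sum_diff_nat_ivl)
    then show ?thesis by (simp add: norm_finite_expansion)
  qed
  have dist: "(dist (?S m) (?S n))\<^sup>2 = dist (?s m) (?s n)" for m n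
  proof (cases "m \<le> n")
    case True
    then have "?s m \<le> ?s n" by (intro sum_mono2) auto
    then show ?thesis using eq[OF True] by (simp add: dist_norm norm_minus_commute[of "?S m"])
  next
    case False
    then have "?s n \<le> ?s m" by (intro sum_mono2) auto
    then show ?thesis using eq[of n m] False by (simp add: dist_norm)
  qed
  have "Cauchy ?s" using c by (simp add: summable_iff_convergent Cauchy_convergent_iff)
  have "Cauchy ?S"
    unfolding Cauchy_def
  proof (intro allI impI)
    fix r :: real assume r: "r > 0"
    then have "r\<^sup>2 > 0" by simp
    with \<open>Cauchy ?s\<close> obtain M where M: "\<And>m n. m \<ge> M \<Longrightarrow> n \<ge> M \<Longrightarrow> dist (?s m) (?s n) < r\<^sup>2"
      unfolding Cauchy_def by meson
    have "dist (?S m) (?S n) < r" if "m \<ge> M" "n \<ge> M" for m n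
      by (rule power2_less_imp_less) (use M[OF that] r in \<open>simp_all add: dist\<close>)
    then show "\<exists>M. \<forall>m\<ge>M. \<forall>n\<ge>M. dist (?S m) (?S n) < r" by blast
  qed
  then show ?thesis by (simp add: summable_iff_convergent Cauchy_convergent_iff)
qed

lemma inner_expansion:
  assumes c: "summable (\<lambda>k. (c k)\<^sup>2)" shows "inner (\<Sum>k. c k *\<^sub>R e k) (e j) = c j"
proof -
  have "inner (\<Sum>k. c k *\<^sub>R e k) (e j) = (\<Sum>k. inner (c k *\<^sub>R e k) (e j))"
    by (rule bounded_linear.suminf[OF bounded_linear_inner_left summable_expansion[OF c]])
  also have "\<dots> = (\<Sum>k\<in>{j}. inner (c k *\<^sub>R e k) (e j))" by (rule suminf_finite) (auto simp: inner_e)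
  finally show ?thesis by (simp add: inner_e)
qed

lemma bessel: "summable (\<lambda>k. (inner u (e k))\<^sup>2)"
proof (rule summableI_nonneg_bounded)
  fix n
  let ?p = "\<Sum>k<n. inner u (e k) *\<^sub>R e k"
  have "inner u ?p = (\<Sum>k<n. (inner u (e k))\<^sup>2)" by (simp add: inner_sum_right power2_eq_square)
  moreover have "(norm ?p)\<^sup>2 = (\<Sum>k<n. (inner u (e k))\<^sup>2)" by (rule norm_finite_expansion) simp
  moreover have "0 \<le> (norm (u - ?p))\<^sup>2" by simp
  then have "0 \<le> (norm u)\<^sup>2 - 2 * inner u ?p + (norm ?p)\<^sup>2"
    by (simp only: power2_norm_eq_inner inner_diff_left inner_diff_right inner_commute[of ?p u])
  ultimately show "(\<Sum>k<n. (inner u (e k))\<^sup>2) \<le> (norm u)\<^sup>2" by linarith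
qed simp

text \<open>The remainder is orthogonal to a dense subspace, hence to itself.\<close>

lemma expansion_eq: "(\<Sum>k. inner u (e k) *\<^sub>R e k) = u"
proof -
  define y where "y = u - (\<Sum>k. inner u (e k) *\<^sub>R e k)"
  have "inner y (e k) = 0" for k by (simp add: y_def inner_diff_left inner_expansion[OF bessel])
  then have "span (range e) \<subseteq> {x. inner y x = 0}"
    by (intro span_minimal) (auto simp: subspace_def inner_add_right)
  then have "closure (span (range e)) \<subseteq> {x. inner y x = 0}"
    by (rule closure_minimal) (rule closed_hyperplane)
  moreover have "y \<in> closure (span (range e))" using complete by (simp add: complete_orthonormal_system_def)
  ultimately have "inner y y = 0" by blast
  then show ?thesis by (simp add: y_def)
qed

lemma parseval: "(\<lambda>k. (inner u (e k))\<^sup>2) sums (norm u)\<^sup>2"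
proof -
  have "(\<lambda>n. \<Sum>k<n. inner u (e k) *\<^sub>R e k) \<longlonglongrightarrow> u"
    using summable_LIMSEQ[OF summable_expansion[OF bessel[of u]]] by (simp add: expansion_eq)
  then have "(\<lambda>n. (norm (\<Sum>k<n. inner u (e k) *\<^sub>R e k))\<^sup>2) \<longlonglongrightarrow> (norm u)\<^sup>2" by (intro tendsto_intros)
  then show ?thesis by (simp add: sums_def norm_finite_expansion)
qed

lemma norm_expansion:
  assumes c: "summable (\<lambda>k. (c k)\<^sup>2)" shows "(norm (\<Sum>k. c k *\<^sub>R e k))\<^sup>2 = (\<Sum>k. (c k)\<^sup>2)"
  using parseval[of "\<Sum>k. c k *\<^sub>R e k"] by (simp add: inner_expansion[OF c] sums_iff)

text \<open>Convergence in a Gevrey norm reduces to convergence of components plus two majorants,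
  one for the Hilbert norm and one for the weighted sum. Continuity and difference quotients are
  both treated this way.\<close>

lemma gevrey_norm_tendsto_0:
  assumes lim: "\<And>k. ((\<lambda>s. inner (x s) (e k)) \<longlongrightarrow> 0) F"
    and D: "\<forall>\<^sub>F s in F. \<forall>k. (inner (x s) (e k))\<^sup>2 \<le> D k" "summable D"
    and D': "\<forall>\<^sub>F s in F. \<forall>k. gevrey_term e lam \<phi> r \<alpha> (x s) k \<le> D' k" "summable D'"
  shows "((\<lambda>s. gevrey_norm e lam \<phi> r \<alpha> (x s)) \<longlongrightarrow> 0) F"
proof -
  have l: "((\<lambda>s. (inner (x s) (e k))\<^sup>2) \<longlongrightarrow> 0) F" for k using tendsto_power[OF lim, of k 2] by simp
  have "((\<lambda>s. \<Sum>k. (inner (x s) (e k))\<^sup>2) \<longlongrightarrow> (\<Sum>k::nat. 0)) F"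
    by (rule dominated_series_tendsto[OF l _ D(2)]) (use D(1) in simp)
  moreover have "gevrey_term e lam \<phi> r \<alpha> (x s) k \<ge> 0" for s k by (simp add: gevrey_term_def rpow_def)
  then have "((\<lambda>s. \<Sum>k. gevrey_term e lam \<phi> r \<alpha> (x s) k) \<longlongrightarrow> (\<Sum>k::nat. 0)) F"
  proof (intro dominated_series_tendsto[OF _ _ D'(2)])
    fix k
    have "((\<lambda>s. rpow (lam k) (4 * \<alpha>) * (inner (x s) (e k))\<^sup>2 * exp (r * \<phi> (lam k))) \<longlongrightarrow>
      rpow (lam k) (4 * \<alpha>) * 0 * exp (r * \<phi> (lam k))) F"
      by (intro tendsto_mult tendsto_const l)
    then show "((\<lambda>s. gevrey_term e lam \<phi> r \<alpha> (x s) k) \<longlongrightarrow> 0) F" by (simp add: gevrey_term_def)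
  qed (use D'(1) in simp)
  ultimately have "((\<lambda>s. sqrt ((\<Sum>k. (inner (x s) (e k))\<^sup>2) + (\<Sum>k. gevrey_term e lam \<phi> r \<alpha> (x s) k))) \<longlongrightarrow>
    sqrt ((\<Sum>k::nat. 0) + (\<Sum>k::nat. 0))) F"
    by (intro tendsto_real_sqrt tendsto_add)
  moreover have "(\<Sum>k. (inner (x s) (e k))\<^sup>2) = (norm (x s))\<^sup>2" for s
    using parseval[of "x s"] by (simp add: sums_iff)
  ultimately show ?thesis by (simp add: gevrey_norm_def)
qed

lemma norm_le_gevrey_norm:
  assumes "u \<in> gevrey e lam \<phi> r \<alpha>" shows "norm u \<le> gevrey_norm e lam \<phi> r \<alpha> u"
proof -
  have "0 \<le> gevrey_term e lam \<phi> r \<alpha> u k" for k by (simp add: gevrey_term_def rpow_def)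
  then have "0 \<le> (\<Sum>k. gevrey_term e lam \<phi> r \<alpha> u k)"
    by (intro suminf_nonneg) (use assms in \<open>auto simp: gevrey_def\<close>)
  then show ?thesis unfolding gevrey_norm_def by (intro real_le_rsqrt) simp
qed

end

section \<open>The weights of orders 1/4 and 3/4\<close>

lemma rpow_1: "x \<ge> 0 \<Longrightarrow> rpow x 1 = x"
  by (simp add: rpow_def)

lemma rpow_3: "x \<ge> 0 \<Longrightarrow> rpow x 3 = x ^ 3"
  by (cases "x = 0") (simp_all add: rpow_def powr_numeral)

lemma gevrey_term_14:
  "lam k \<ge> 0 \<Longrightarrow> gevrey_term e lam \<phi> r (1/4) u k = lam k * (inner u (e k))\<^sup>2 * exp (r * \<phi> (lam k))"
  by (simp add: gevrey_term_def rpow_1)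

lemma gevrey_term_34:
  "lam k \<ge> 0 \<Longrightarrow> gevrey_term e lam \<phi> r (3/4) u k = lam k ^ 3 * (inner u (e k))\<^sup>2 * exp (r * \<phi> (lam k))"
  by (simp add: gevrey_term_def rpow_3)

lemma square_diff_le: "x\<^sup>2 \<le> D \<Longrightarrow> y\<^sup>2 \<le> D \<Longrightarrow> (x - y)\<^sup>2 \<le> 4 * D" for x y :: real
  using zero_le_power2[of "x + y"] by (simp add: power2_eq_square algebra_simps)

section \<open>From components to solutions in the Hilbert space\<close>

locale kirchhoff_data = spectral_data \<omega> m \<phi> L \<Lambda> lam "\<lambda>k. inner v0 (e k)" "\<lambda>k. inner v1 (e k)" + onb e
  for \<omega> m \<phi> L \<Lambda> lam v0 v1 and e :: "nat \<Rightarrow> 'a::{real_inner, complete_space}"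
begin

text \<open>Since \<open>x \<le> 1 + x\<^sup>3\<close> for \<open>x = \<lambda> exp (r \<phi>(\<lambda>))\<close>, the data space of order \<open>3/4\<close> embeds into the one of
  order \<open>1/4\<close>, whatever \<open>\<phi>\<close> does near \<open>0\<close>.\<close>

lemma summable_lam_v0:
  assumes "r > 0" shows "summable (\<lambda>k. lam k * (inner v0 (e k))\<^sup>2 * exp (r * \<phi> (lam k)))"
proof (rule summable_comparison_test'[of
    "\<lambda>k. (inner v0 (e k))\<^sup>2 + lam k ^ 3 * (inner v0 (e k))\<^sup>2 * exp ((3 * r) * \<phi> (lam k))" 0])
  show "summable (\<lambda>k. (inner v0 (e k))\<^sup>2 + lam k ^ 3 * (inner v0 (e k))\<^sup>2 * exp ((3 * r) * \<phi> (lam k)))"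
    using assms by (intro summable_add sa sa3) simp
  fix k
  let ?x = "lam k * exp (r * \<phi> (lam k))"
  have x: "?x \<ge> 0" using lam by simp
  have "?x \<le> 1 + ?x ^ 3"
  proof (cases "?x \<le> 1")
    case True then show ?thesis using x by (simp add: add_increasing2)
  next
    case False
    then have "?x ^ 1 \<le> ?x ^ 3" by (intro power_increasing) auto
    then show ?thesis by simp
  qed
  then have "?x * (inner v0 (e k))\<^sup>2 \<le> (1 + ?x ^ 3) * (inner v0 (e k))\<^sup>2" by (intro mult_right_mono) auto
  then have "?x * (inner v0 (e k))\<^sup>2 \<le> (inner v0 (e k))\<^sup>2 + ?x ^ 3 * (inner v0 (e k))\<^sup>2"
    by (simp only: distrib_right mult_1)
  moreover have "?x ^ 3 = lam k ^ 3 * exp ((3 * r) * \<phi> (lam k))"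
    by (simp add: power_mult_distrib exp_of_nat_mult[of 3, simplified, symmetric] mult.assoc)
  ultimately show "norm (lam k * (inner v0 (e k))\<^sup>2 * exp (r * \<phi> (lam k))) \<le>
    (inner v0 (e k))\<^sup>2 + lam k ^ 3 * (inner v0 (e k))\<^sup>2 * exp ((3 * r) * \<phi> (lam k))"
    using lam[of k] by (simp add: mult_ac)
qed

text \<open>The energy majorant yields all the regularity: multiplied by \<open>lam k\<close>, it
  controls \<open>lam k ^ 3 * U\<^sup>2\<close> (order 3/4 for \<open>u\<close>) and
  \<open>lam k * V\<^sup>2\<close> (order 1/4 for \<open>u'\<close>). By the mean value theorem the
  difference quotients have the same majorant as \<open>V\<close>.\<close>

lemma global_solution_exists:
  assumes h0: "\<And>t. t \<ge> 0 \<Longrightarrow> h t \<ge> 0" and ch: "continuous_on {0..} h"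
    and sol: "\<And>t. t \<ge> 0 \<Longrightarrow> G (\<lambda>s. m (h s)) t = h t"
    and dom: "\<And>T. \<exists>M. summable M \<and> (\<forall>r>0. summable (\<lambda>k. lam k * M k * exp (r * \<phi> (lam k)))) \<and>
      (\<forall>k. \<forall>t\<in>{0..T}. (V (\<lambda>s. m (h s)) k t)\<^sup>2 + (lam k)\<^sup>2 * (U (\<lambda>s. m (h s)) k t)\<^sup>2 \<le> M k)"
  shows "\<exists>u. global_solution e lam \<phi> m v0 v1 u"
proof -
  define c where "c = (\<lambda>s. m (h s))"
  have cc: "continuous_on {0..} c"
    unfolding c_def by (rule continuous_on_compose2[OF continuous_on_m ch]) (use h0 in auto)
  have ccT: "continuous_on {0..T} c" for T by (rule continuous_on_subset[OF cc]) auto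
  have "\<forall>T. \<exists>M. summable M \<and> (\<forall>r>0. summable (\<lambda>k. lam k * M k * exp (r * \<phi> (lam k)))) \<and>
      (\<forall>k. \<forall>t\<in>{0..T}. (V c k t)\<^sup>2 + (lam k)\<^sup>2 * (U c k t)\<^sup>2 \<le> M k)"
    unfolding c_def by (intro allI dom)
  from choice[OF this] obtain M where M: "\<forall>T. summable (M T) \<and> (\<forall>r>0. summable (\<lambda>k. lam k * M T k * exp (r * \<phi> (lam k)))) \<and>
      (\<forall>k. \<forall>t\<in>{0..T}. (V c k t)\<^sup>2 + (lam k)\<^sup>2 * (U c k t)\<^sup>2 \<le> M T k)" ..
  have sM: "summable (M T)" for T using M by simp
  have slM: "summable (\<lambda>k. lam k * M T k * exp (r * \<phi> (lam k)))" if "r > 0" for T r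
    using M[rule_format, of T] that by simp
  have E: "(V c k t)\<^sup>2 + (lam k)\<^sup>2 * (U c k t)\<^sup>2 \<le> M T k" if "t \<in> {0..T}" for T k t
    using M[rule_format, of T] that by simp
  have VM: "(V c k t)\<^sup>2 \<le> M T k" and lUM: "(lam k)\<^sup>2 * (U c k t)\<^sup>2 \<le> M T k" if "t \<in> {0..T}" for T k t
    using E[OF that, of k] zero_le_power2[of "V c k t"]
      mult_nonneg_nonneg[OF zero_le_power2[of "lam k"] zero_le_power2[of "U c k t"]] by linarith+
  have M0: "M t k \<ge> 0" if "t \<ge> 0" for t k
    using order_trans[OF zero_le_power2 VM[of t t k]] that by simp
  define D where "D = (\<lambda>T k. 2 * (inner v0 (e k))\<^sup>2 + 2 * T\<^sup>2 * M T k)"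
  have sD: "summable (D T)" for T unfolding D_def by (intro summable_add summable_mult bessel sM)
  have UD: "(U c k t)\<^sup>2 \<le> D T k" if "t \<in> {0..T}" for T k t
    unfolding D_def by (rule U_bound[OF ccT VM that])
  have slD: "summable (\<lambda>k. lam k * D T k * exp (r * \<phi> (lam k)))" if "r > 0" for T r
    using summable_add[OF summable_mult[OF summable_lam_v0[OF that], of 2] summable_mult[OF slM[OF that, of T], of "2 * T\<^sup>2"]]
    by (simp add: D_def algebra_simps)
  have sU: "summable (\<lambda>k. (U c k t)\<^sup>2)" if "t \<ge> 0" for t
    by (rule summable_comparison_test'[OF sD[of t], of 0]) (use UD[of t t] that in simp)
  have sV: "summable (\<lambda>k. (V c k t)\<^sup>2)" if "t \<ge> 0" for t
    by (rule summable_comparison_test'[OF sM[of t], of 0]) (use VM[of t t] that in simp)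
  define u where "u = (\<lambda>t. \<Sum>k. U c k t *\<^sub>R e k)"
  define u' where "u' = (\<lambda>t. \<Sum>k. V c k t *\<^sub>R e k)"
  have iu: "inner (u t) (e k) = U c k t" and iu': "inner (u' t) (e k) = V c k t" if "t \<ge> 0" for t k
    using inner_expansion[OF sU[OF that]] inner_expansion[OF sV[OF that]] by (simp_all add: u_def u'_def)
  \<comment> \<open>Limits at \<open>t\<close> only see a neighbourhood, so the majorants of the
    bounded interval \<open>{0..t + 1}\<close> suffice.\<close>
  have at_eq: "at t within {0..t + 1} = at t within {0..}" if "t \<ge> 0" for t :: real
    by (rule at_within_nhd[of t "{..<t + 1}"]) auto
  have dU: "(U c k has_real_derivative V c k t) (at t within {0..})"
    and dV: "(V c k has_real_derivative - ((lam k)\<^sup>2 * c t * U c k t)) (at t within {0..})" if "t \<ge> 0" for k t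
    using UV_deriv[OF ccT, of t "t + 1" k] that by (simp_all add: at_eq)
  have cU: "(U c k \<longlongrightarrow> U c k t) (at t within {0..})" and cV: "(V c k \<longlongrightarrow> V c k t) (at t within {0..})"
    if "t \<ge> 0" for k t
    using DERIV_continuous[OF dU[OF that]] DERIV_continuous[OF dV[OF that]] by (simp_all add: continuous_within)
  have near: "\<forall>\<^sub>F s in at t within {0..}. s \<in> {0..t + 1} \<and> s \<noteq> t" if "t \<ge> 0" for t :: real
    unfolding at_eq[OF that, symmetric] by (simp add: eventually_at_filter)
  have C0u: "C0_in (gevrey e lam \<phi> r (3/4)) (gevrey_norm e lam \<phi> r (3/4)) u" if r: "r > 0" for r
    unfolding C0_in_def
  proof (intro conjI allI impI)
    fix t :: real assume t: "t \<ge> 0"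
    \<comment> \<open>The energy bound is multiplied by
      \<open>lam k * exp (r * \<phi> (lam k))\<close>. The factor 4 lets the same inequality serve
      for differences of two states via \<open>square_diff_le\<close>.\<close>
    have lU: "lam k ^ 3 * x * exp (r * \<phi> (lam k)) \<le> 4 * (lam k * M T k * exp (r * \<phi> (lam k)))"
      if "(lam k)\<^sup>2 * x \<le> 4 * M T k" for x T k
    proof -
      have "(lam k * exp (r * \<phi> (lam k))) * ((lam k)\<^sup>2 * x) \<le> (lam k * exp (r * \<phi> (lam k))) * (4 * M T k)"
        using that lam by (intro mult_left_mono) auto
      then show ?thesis by (simp add: power2_eq_square power3_eq_cube mult_ac)
    qed
    show "u t \<in> gevrey e lam \<phi> r (3/4)"
      unfolding gevrey_def
    proof (intro CollectI, rule summable_comparison_test'[of "\<lambda>k. 4 * (lam k * M t k * exp (r * \<phi> (lam k)))" 0])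
      show "summable (\<lambda>k. 4 * (lam k * M t k * exp (r * \<phi> (lam k))))" by (intro summable_mult slM r)
      fix k
      have "(lam k)\<^sup>2 * (U c k t)\<^sup>2 \<le> 4 * M t k" using lUM[of t t k] M0[OF t, of k] t by simp
      from lU[OF this] show "norm (gevrey_term e lam \<phi> r (3/4) (u t) k) \<le> 4 * (lam k * M t k * exp (r * \<phi> (lam k)))"
        using lam[of k] by (simp add: gevrey_term_34 lam iu[OF t])
    qed
    show "((\<lambda>s. gevrey_norm e lam \<phi> r (3/4) (u s - u t)) \<longlongrightarrow> 0) (at t within {0..})"
    proof (rule gevrey_norm_tendsto_0)
      fix k
      have "((\<lambda>s. U c k s - U c k t) \<longlongrightarrow> 0) (at t within {0..})" using cU[OF t] by (rule LIM_zero)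
      then show "((\<lambda>s. inner (u s - u t) (e k)) \<longlongrightarrow> 0) (at t within {0..})"
        by (rule Lim_transform_eventually)
           (use near[OF t] t in \<open>auto elim!: eventually_mono simp: inner_diff_left iu\<close>)
    next
      show "\<forall>\<^sub>F s in at t within {0..}. \<forall>k. (inner (u s - u t) (e k))\<^sup>2 \<le> 4 * D (t + 1) k"
        using near[OF t]
        by eventually_elim (use t in \<open>auto simp: inner_diff_left iu intro!: square_diff_le UD\<close>)
      show "summable (\<lambda>k. 4 * D (t + 1) k)" by (intro summable_mult sD)
      show "\<forall>\<^sub>F s in at t within {0..}. \<forall>k. gevrey_term e lam \<phi> r (3/4) (u s - u t) k \<le>
        4 * (lam k * M (t + 1) k * exp (r * \<phi> (lam k)))"
        using near[OF t]
      proof (eventually_elim, intro allI)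
        fix s k assume s: "s \<in> {0..t + 1} \<and> s \<noteq> t"
        have "(lam k * U c k s - lam k * U c k t)\<^sup>2 \<le> 4 * M (t + 1) k"
          using lUM[of s "t + 1" k] lUM[of t "t + 1" k] s t by (intro square_diff_le) (auto simp: power_mult_distrib)
        then have "(lam k)\<^sup>2 * (U c k s - U c k t)\<^sup>2 \<le> 4 * M (t + 1) k"
          by (simp add: power_mult_distrib flip: right_diff_distrib)
        from lU[OF this] show "gevrey_term e lam \<phi> r (3/4) (u s - u t) k \<le> 4 * (lam k * M (t + 1) k * exp (r * \<phi> (lam k)))"
          using s t by (simp add: gevrey_term_34 lam inner_diff_left iu)
      qed
      show "summable (\<lambda>k. 4 * (lam k * M (t + 1) k * exp (r * \<phi> (lam k))))" by (intro summable_mult slM r)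
    qed
  qed
  have l1: "lam k * x * exp (r * \<phi> (lam k)) \<le> 4 * (lam k * y * exp (r * \<phi> (lam k)))" if "x \<le> 4 * y" for r x y k
  proof -
    have "(lam k * exp (r * \<phi> (lam k))) * x \<le> (lam k * exp (r * \<phi> (lam k))) * (4 * y)"
      using that lam by (intro mult_left_mono) auto
    then show ?thesis by (simp add: mult_ac)
  qed
  have u14: "u t \<in> gevrey e lam \<phi> r (1/4)" if r: "r > 0" and t: "t \<ge> 0" for r t
    unfolding gevrey_def
  proof (intro CollectI, rule summable_comparison_test'[of "\<lambda>k. 4 * (lam k * D t k * exp (r * \<phi> (lam k)))" 0])
    show "summable (\<lambda>k. 4 * (lam k * D t k * exp (r * \<phi> (lam k))))" by (intro summable_mult slD r)
    fix k
    have "(U c k t)\<^sup>2 \<le> 4 * D t k" using UD[of t t k] order_trans[OF zero_le_power2 UD[of t t k]] t by simp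
    from l1[OF this] show "norm (gevrey_term e lam \<phi> r (1/4) (u t) k) \<le> 4 * (lam k * D t k * exp (r * \<phi> (lam k)))"
      using lam[of k] by (simp add: gevrey_term_14 lam iu[OF t])
  qed
  have u'14: "u' t \<in> gevrey e lam \<phi> r (1/4)" if r: "r > 0" and t: "t \<ge> 0" for r t
    unfolding gevrey_def
  proof (intro CollectI, rule summable_comparison_test'[of "\<lambda>k. 4 * (lam k * M t k * exp (r * \<phi> (lam k)))" 0])
    show "summable (\<lambda>k. 4 * (lam k * M t k * exp (r * \<phi> (lam k))))" by (intro summable_mult slM r)
    fix k
    have "(V c k t)\<^sup>2 \<le> 4 * M t k" using VM[of t t k] M0[OF t, of k] t by simp
    from l1[OF this] show "norm (gevrey_term e lam \<phi> r (1/4) (u' t) k) \<le> 4 * (lam k * M t k * exp (r * \<phi> (lam k)))"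
      using lam[of k] by (simp add: gevrey_term_14 lam iu'[OF t])
  qed
  have C0u': "C0_in (gevrey e lam \<phi> r (1/4)) (gevrey_norm e lam \<phi> r (1/4)) u'" if r: "r > 0" for r
    unfolding C0_in_def
  proof (intro conjI allI impI u'14 r)
    fix t :: real assume t: "t \<ge> 0"
    have bd: "\<forall>\<^sub>F s in at t within {0..}. \<forall>k. (inner (u' s - u' t) (e k))\<^sup>2 \<le> 4 * M (t + 1) k"
      using near[OF t]
      by eventually_elim (use t in \<open>auto simp: inner_diff_left iu' intro!: square_diff_le VM\<close>)
    show "((\<lambda>s. gevrey_norm e lam \<phi> r (1/4) (u' s - u' t)) \<longlongrightarrow> 0) (at t within {0..})"
    proof (rule gevrey_norm_tendsto_0[OF _ bd])
      fix k
      have "((\<lambda>s. V c k s - V c k t) \<longlongrightarrow> 0) (at t within {0..})" using cV[OF t] by (rule LIM_zero)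
      then show "((\<lambda>s. inner (u' s - u' t) (e k)) \<longlongrightarrow> 0) (at t within {0..})"
        by (rule Lim_transform_eventually)
           (use near[OF t] t in \<open>auto elim!: eventually_mono simp: inner_diff_left iu'\<close>)
    next
      show "\<forall>\<^sub>F s in at t within {0..}. \<forall>k. gevrey_term e lam \<phi> r (1/4) (u' s - u' t) k \<le>
        4 * (lam k * M (t + 1) k * exp (r * \<phi> (lam k)))"
        using bd by eventually_elim (use lam in \<open>simp add: gevrey_term_14 l1\<close>)
    qed (intro summable_mult sM slM r)+
  qed
  have quot: "((\<lambda>s. gevrey_norm e lam \<phi> r (1/4) ((u s - u t) /\<^sub>R (s - t) - u' t)) \<longlongrightarrow> 0) (at t within {0..})"
    if r: "r > 0" and t: "t \<ge> 0" for r t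
  proof -
    have iq: "inner ((u s - u t) /\<^sub>R (s - t) - u' t) (e k) = (U c k s - U c k t) / (s - t) - V c k t" if "s \<ge> 0" for s k
      using that t by (simp add: inner_diff_left iu iu' divide_inverse mult.commute)
    \<comment> \<open>Quotient and derivative both have squares below \<open>M (t + 1) k\<close>, so
      their difference is dominated uniformly in \<open>s\<close>.\<close>
    have "(inner ((u s - u t) /\<^sub>R (s - t) - u' t) (e k))\<^sup>2 \<le> 4 * M (t + 1) k" if s: "s \<in> {0..t + 1} \<and> s \<noteq> t" for s k
    proof -
      have "norm (U c k s - U c k t) \<le> sqrt (M (t + 1) k) * norm (s - t)"
        by (rule field_differentiable_bound[OF convex_real_interval(5) UV_deriv(1)[OF ccT]])
           (use s t real_sqrt_le_mono[OF VM[of _ "t + 1" k]] in auto)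
      then have "\<bar>(U c k s - U c k t) / (s - t)\<bar> \<le> sqrt (M (t + 1) k)"
        using s by (simp add: pos_divide_le_eq)
      then have q: "((U c k s - U c k t) / (s - t))\<^sup>2 \<le> M (t + 1) k"
        using M0[of "t + 1" k] t abs_le_square_iff[of "(U c k s - U c k t) / (s - t)" "sqrt (M (t + 1) k)"] by simp
      have "0 \<le> s" using s by simp
      then show ?thesis unfolding iq[OF \<open>0 \<le> s\<close>]
        by (intro square_diff_le[OF q] VM) (use t in simp)
    qed
    then have bd: "\<forall>\<^sub>F s in at t within {0..}. \<forall>k. (inner ((u s - u t) /\<^sub>R (s - t) - u' t) (e k))\<^sup>2 \<le> 4 * M (t + 1) k"
      using near[OF t] by (auto elim!: eventually_mono)
    show ?thesis
    proof (rule gevrey_norm_tendsto_0[OF _ bd])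
      fix k
      have "((\<lambda>s. (U c k s - U c k t) / (s - t) - V c k t) \<longlongrightarrow> 0) (at t within {0..})"
        using dU[OF t, of k] unfolding has_field_derivative_iff by (rule LIM_zero)
      then show "((\<lambda>s. inner ((u s - u t) /\<^sub>R (s - t) - u' t) (e k)) \<longlongrightarrow> 0) (at t within {0..})"
        by (rule Lim_transform_eventually) (use near[OF t] in \<open>auto elim!: eventually_mono simp: iq\<close>)
    next
      show "\<forall>\<^sub>F s in at t within {0..}. \<forall>k. gevrey_term e lam \<phi> r (1/4) ((u s - u t) /\<^sub>R (s - t) - u' t) k \<le>
        4 * (lam k * M (t + 1) k * exp (r * \<phi> (lam k)))"
        using bd by eventually_elim (use lam in \<open>simp add: gevrey_term_14 l1\<close>)
    qed (intro summable_mult sM slM r)+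
  qed
  have u0: "u 0 = v0" and u'0: "u' 0 = v1" by (simp_all add: u_def u'_def expansion_eq)
  \<comment> \<open>Membership makes the \<open>suminf\<close> in \<open>gevrey_norm\<close> a
    genuine nonnegative sum. Only then does \<open>norm_le_gevrey_norm\<close> carry the limit of
    the difference quotients over to the Hilbert norm, as the initial velocity requires.\<close>
  have gev_diff: "x - y \<in> gevrey e lam \<phi> r (1/4)" if "x \<in> gevrey e lam \<phi> r (1/4)" "y \<in> gevrey e lam \<phi> r (1/4)" for x y r
    unfolding gevrey_def
  proof (intro CollectI, rule summable_comparison_test'[of
      "\<lambda>k. 4 * (gevrey_term e lam \<phi> r (1/4) x k + gevrey_term e lam \<phi> r (1/4) y k)" 0])
    show "summable (\<lambda>k. 4 * (gevrey_term e lam \<phi> r (1/4) x k + gevrey_term e lam \<phi> r (1/4) y k))"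
      using that by (intro summable_mult summable_add) (auto simp: gevrey_def)
    fix k
    have "(inner x (e k) - inner y (e k))\<^sup>2 \<le> 4 * ((inner x (e k))\<^sup>2 + (inner y (e k))\<^sup>2)"
      by (rule square_diff_le) auto
    from l1[OF this, of k r] show "norm (gevrey_term e lam \<phi> r (1/4) (x - y) k) \<le>
      4 * (gevrey_term e lam \<phi> r (1/4) x k + gevrey_term e lam \<phi> r (1/4) y k)"
      using lam[of k] by (simp add: gevrey_term_14 lam inner_diff_left algebra_simps)
  qed
  have gev_scale: "a *\<^sub>R x \<in> gevrey e lam \<phi> r (1/4)" if "x \<in> gevrey e lam \<phi> r (1/4)" for a x r
  proof -
    have "gevrey_term e lam \<phi> r (1/4) (a *\<^sub>R x) = (\<lambda>k. a\<^sup>2 * gevrey_term e lam \<phi> r (1/4) x k)"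
      by (simp add: fun_eq_iff gevrey_term_def power_mult_distrib mult_ac)
    then show ?thesis using that by (simp add: gevrey_def summable_mult)
  qed
  have vd: "(u has_vector_derivative v1) (at 0 within {0..})"
  proof -
    have "((\<lambda>s. (u s - u 0) /\<^sub>R (s - 0) - u' 0) \<longlongrightarrow> 0) (at 0 within {0..})"
    proof (rule Lim_null_comparison[OF _ quot[OF zero_less_one order_refl]])
      show "\<forall>\<^sub>F s in at 0 within {0..}. norm ((u s - u 0) /\<^sub>R (s - 0) - u' 0) \<le>
        gevrey_norm e lam \<phi> 1 (1/4) ((u s - u 0) /\<^sub>R (s - 0) - u' 0)"
        using near[OF order_refl]
        by eventually_elim (auto intro!: norm_le_gevrey_norm gev_diff gev_scale u14 u'14)
    qed
    then have "((\<lambda>s. norm ((u s - u 0) /\<^sub>R (s - 0) - u' 0)) \<longlongrightarrow> 0) (at 0 within {0..})"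
      by (rule tendsto_norm_zero)
    then have "((\<lambda>s. norm ((1 / norm (s - 0)) *\<^sub>R (u s - (u 0 + (s - 0) *\<^sub>R v1)))) \<longlongrightarrow> 0) (at 0 within {0..})"
    proof (rule Lim_transform_eventually)
      show "\<forall>\<^sub>F s in at 0 within {0..}. norm ((u s - u 0) /\<^sub>R (s - 0) - u' 0) =
        norm ((1 / norm (s - 0)) *\<^sub>R (u s - (u 0 + (s - 0) *\<^sub>R v1)))"
        using near[OF order_refl]
      proof eventually_elim
        case (elim s)
        then have "(1 / norm (s - 0)) *\<^sub>R (u s - (u 0 + (s - 0) *\<^sub>R v1)) = (u s - u 0) /\<^sub>R (s - 0) - u' 0"
          by (simp add: u'0 scaleR_diff_right scaleR_add_right divide_inverse)
        then show ?case by simp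
      qed
    qed
    then have "((\<lambda>s. (1 / norm (s - 0)) *\<^sub>R (u s - (u 0 + (s - 0) *\<^sub>R v1))) \<longlongrightarrow> 0) (at 0 within {0..})"
      by (rule tendsto_norm_zero_cancel)
    then show ?thesis unfolding has_vector_derivative_def has_derivative_within
      using bounded_linear_scaleR_left by blast
  qed
  have en: "(norm (frac_power e lam (1/2) (u t)))\<^sup>2 = h t" if t: "t \<ge> 0" for t
  proof -
    have "summable (\<lambda>k. (lam k * U c k t)\<^sup>2)"
      by (rule summable_comparison_test'[OF sM[of t], of 0]) (use lUM[of t t] t in \<open>simp add: power_mult_distrib\<close>)
    moreover have "frac_power e lam (1/2) (u t) = (\<Sum>k. (lam k * U c k t) *\<^sub>R e k)"
      by (simp add: frac_power_def rpow_1 lam iu[OF t])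
    ultimately have "(norm (frac_power e lam (1/2) (u t)))\<^sup>2 = G c t"
      by (simp add: norm_expansion G_def power_mult_distrib)
    then show ?thesis using sol[OF t] by (simp add: c_def)
  qed
  have eqn: "\<exists>f2. C2_with (\<lambda>t. inner (u t) (e k)) f2 \<and>
    (\<forall>t\<ge>0. f2 t + m ((norm (frac_power e lam (1/2) (u t)))\<^sup>2) * (lam k)\<^sup>2 * inner (u t) (e k) = 0)" for k
  proof (intro exI conjI)
    let ?f2 = "\<lambda>t. - ((lam k)\<^sup>2 * c t * U c k t)"
    have cU': "continuous_on {0..} (U c k)" by (rule DERIV_continuous_on[OF dU]) simp
    show "C2_with (\<lambda>t. inner (u t) (e k)) ?f2"
      unfolding C2_with_def
    proof (intro conjI exI[of _ "V c k"] allI impI)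
      show "continuous_on {0..} ?f2" by (intro continuous_intros cc cU')
      fix t :: real assume t: "t \<ge> 0"
      show "((\<lambda>t. inner (u t) (e k)) has_real_derivative V c k t) (at t within {0..})"
        by (rule has_field_derivative_transform_within[OF dU[OF t] zero_less_one]) (use t iu in auto)
      show "(V c k has_real_derivative ?f2 t) (at t within {0..})" by (rule dV[OF t])
    qed
    show "\<forall>t\<ge>0. ?f2 t + m ((norm (frac_power e lam (1/2) (u t)))\<^sup>2) * (lam k)\<^sup>2 * inner (u t) (e k) = 0"
      by (simp add: en iu c_def)
  qed
  show ?thesis
    unfolding global_solution_def C1_in_def
    by (rule exI[of _ u]) (intro conjI allI impI exI[of _ u'] C0u C0u' u14 quot u0 vd eqn)
qed

end

section \<open>Splitting the data\<close>

lemma gevrey_inf_34_iff: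
  assumes "\<And>k. lam k \<ge> 0"
  shows "u \<in> gevrey_inf e lam \<phi> (3/4) \<longleftrightarrow>
    (\<forall>r>0. summable (\<lambda>k. lam k ^ 3 * (inner u (e k))\<^sup>2 * exp (r * \<phi> (lam k))))"
proof -
  have "gevrey_term e lam \<phi> r (3/4) u = (\<lambda>k. lam k ^ 3 * (inner u (e k))\<^sup>2 * exp (r * \<phi> (lam k)))" for r
    by (simp add: fun_eq_iff gevrey_term_34 assms)
  then show ?thesis by (auto simp: gevrey_inf_def gevrey_def)
qed

lemma gevrey_inf_14_iff:
  assumes "\<And>k. lam k \<ge> 0"
  shows "u \<in> gevrey_inf e lam \<phi> (1/4) \<longleftrightarrow>
    (\<forall>r>0. summable (\<lambda>k. lam k * (inner u (e k))\<^sup>2 * exp (r * \<phi> (lam k))))"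
proof -
  have "gevrey_term e lam \<phi> r (1/4) u = (\<lambda>k. lam k * (inner u (e k))\<^sup>2 * exp (r * \<phi> (lam k)))" for r
    by (simp add: fun_eq_iff gevrey_term_14 assms)
  then show ?thesis by (auto simp: gevrey_inf_def gevrey_def)
qed

section \<open>Data supported on frequency blocks\<close>

context kirchhoff_data
begin

lemma summable_weighted_E0:
  assumes "C \<ge> 0" "R \<ge> 0"
  shows "summable (\<lambda>k. lam k * (C * exp (R * \<phi> (lam k)) * E0 k))"
proof (rule summable_comparison_test'[of "\<lambda>k. C * (lam k * E0 k * exp ((R + 1) * \<phi> (lam k)))" 0])
  show "summable (\<lambda>k. C * (lam k * E0 k * exp ((R + 1) * \<phi> (lam k))))"
    using assms by (intro summable_mult summable_lam_E0) simp
  fix k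
  have "exp (R * \<phi> (lam k)) \<le> exp ((R + 1) * \<phi> (lam k))"
    using \<phi>_pos[OF lam, of k] by simp
  then have "(C * lam k * E0 k) * exp (R * \<phi> (lam k)) \<le> (C * lam k * E0 k) * exp ((R + 1) * \<phi> (lam k))"
    using assms lam[of k] E0_nonneg[of k] by (intro mult_left_mono) auto
  then show "norm (lam k * (C * exp (R * \<phi> (lam k)) * E0 k)) \<le> C * (lam k * E0 k * exp ((R + 1) * \<phi> (lam k)))"
    using assms lam[of k] E0_nonneg[of k] by (simp add: mult_ac)
qed

text \<open>\<open>C\<close> and \<open>R\<close> are fixed here, so this concerns the tail of one
  convergent series; it converges because the data have every radius.\<close>

lemma spectral_gap_tail:
  assumes "C \<ge> 0" "R \<ge> 0"
  obtains s' where "s' \<ge> s" "spectral_gap s' C R"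
proof -
  let ?X = "\<lambda>k. lam k * (C * exp (R * \<phi> (lam k)) * E0 k)"
  have X: "?X k \<ge> 0" for k using assms lam[of k] E0_nonneg[of k] by simp
  have "(\<lambda>n. \<Sum>k. if lam k > real n then ?X k else 0) \<longlonglongrightarrow> (\<Sum>k::nat. 0)"
  proof (rule dominated_series_tendsto[OF _ _ summable_weighted_E0[OF assms]])
    fix k
    have "\<forall>\<^sub>F n in sequentially. (if lam k > real n then ?X k else 0) = 0"
      using eventually_ge_at_top[of "nat \<lceil>lam k\<rceil>"]
    proof eventually_elim
      case (elim n)
      then have "lam k \<le> real n" by linarith
      then show ?case by simp
    qed
    then show "(\<lambda>n. if lam k > real n then ?X k else 0) \<longlonglongrightarrow> 0" by (rule tendsto_eventually)
  qed (use X in auto)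
  then have "\<forall>\<^sub>F n in sequentially. (\<Sum>k. if lam k > real n then ?X k else 0) < 1"
    by (rule order_tendstoD) simp
  moreover have "\<forall>\<^sub>F n in sequentially. s \<le> real n"
    using eventually_ge_at_top[of "nat \<lceil>s\<rceil>"] by eventually_elim linarith
  ultimately have "\<forall>\<^sub>F n in sequentially. (\<Sum>k. if lam k > real n then ?X k else 0) < 1 \<and> s \<le> real n"
    by (rule eventually_conj)
  then obtain n where "(\<Sum>k. if lam k > real n then ?X k else 0) < 1" "s \<le> real n"
    unfolding eventually_sequentially by blast
  then show thesis by (intro that[of "real n"]) (auto simp: spectral_gap_def)
qed

text \<open>By the hypothesis \<open>S\<close>, no mode of \<open>S\<close> has its frequency
  between \<open>\<rho>s j\<close> and \<open>\<rho>s' j\<close>. The tail of the restricted data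
  above \<open>\<rho>s j\<close> is therefore part of the full tail above \<open>\<rho>s' j\<close>,
  which is small with respect to the constants of \<open>\<rho>s j\<close>.\<close>

lemma restricted_solution:
  fixes S :: "nat set" and s Ts :: "nat \<Rightarrow> real"
  assumes B: "(norm v0)\<^sup>2 \<le> B" "(norm v1)\<^sup>2 \<le> B" "g0 \<le> B"
    and Ts: "mono Ts" "\<And>j. Ts j \<ge> real j" and \<rho>s: "mono \<rho>s" "\<And>j. \<rho>s j \<ge> 1"
    and CR: "\<And>j. energy_const B (Ts j) (\<rho>s j) (C j) (R j)"
    and gap: "\<And>j. spectral_gap (\<rho>s' j) (C j) (R j)"
    and S: "\<And>j k. k \<in> S \<Longrightarrow> lam k > \<rho>s j \<Longrightarrow> lam k > \<rho>s' j"
  obtains x0 x1 where "x0 \<in> gevrey_inf e lam \<phi> (3/4)" "x1 \<in> gevrey_inf e lam \<phi> (1/4)"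
    "\<And>k. inner x0 (e k) = (if k \<in> S then inner v0 (e k) else 0)"
    "\<And>k. inner x1 (e k) = (if k \<in> S then inner v1 (e k) else 0)"
    "\<exists>u. global_solution e lam \<phi> m x0 x1 u"
proof -
  have "\<exists>x. (\<forall>k. inner x (e k) = (if k \<in> S then inner y (e k) else 0)) \<and> (norm x)\<^sup>2 \<le> (norm y)\<^sup>2" for y
  proof -
    have s: "summable (\<lambda>k. (if k \<in> S then inner y (e k) else 0)\<^sup>2)"
      by (rule summable_comparison_test'[OF bessel[of y], of 0]) auto
    have "(norm (\<Sum>k. (if k \<in> S then inner y (e k) else 0) *\<^sub>R e k))\<^sup>2 = (\<Sum>k. (if k \<in> S then inner y (e k) else 0)\<^sup>2)"
      by (rule norm_expansion[OF s])
    also have "\<dots> \<le> (\<Sum>k. (inner y (e k))\<^sup>2)" by (rule suminf_le[OF _ s bessel]) auto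
    also have "\<dots> = (norm y)\<^sup>2" using parseval[of y] by (simp add: sums_iff)
    finally show ?thesis using inner_expansion[OF s] by blast
  qed
  then obtain P where P: "\<And>y k. inner (P y) (e k) = (if k \<in> S then inner y (e k) else 0)"
    "\<And>y. (norm (P y))\<^sup>2 \<le> (norm y)\<^sup>2"
    by metis
  have P2: "(inner (P y) (e k))\<^sup>2 \<le> (inner y (e k))\<^sup>2" for y k by (simp add: P)
  interpret Q: kirchhoff_data \<omega> m \<phi> L \<Lambda> lam "P v0" "P v1" e
  proof unfold_locales
    fix r :: real assume r: "r > 0"
    show "summable (\<lambda>k. lam k ^ 3 * (inner (P v0) (e k))\<^sup>2 * exp (r * \<phi> (lam k)))"
      by (rule summable_comparison_test'[OF sa3[OF r], of 0])
         (use lam P2 in \<open>auto intro!: mult_right_mono mult_left_mono\<close>)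
    show "summable (\<lambda>k. lam k * (inner (P v1) (e k))\<^sup>2 * exp (r * \<phi> (lam k)))"
      by (rule summable_comparison_test'[OF sb1[OF r], of 0])
         (use lam P2 in \<open>auto intro!: mult_right_mono mult_left_mono\<close>)
  qed (rule lam bessel)+
  have E0: "Q.E0 k = (if k \<in> S then E0 k else 0)" for k
    unfolding Q.E0_def E0_def by (simp add: P)
  have "Q.g0 \<le> g0"
    unfolding Q.g0_def g0_def using P2
    by (intro suminf_le Q.summable_lam2_a2 summable_lam2_a2) (auto intro: mult_left_mono)
  then have Bg: "Q.g0 \<le> B" using B by linarith
  have Bn: "(\<Sum>k. (inner (P v0) (e k))\<^sup>2) \<le> B" "(\<Sum>k. (inner (P v1) (e k))\<^sup>2) \<le> B"
    using parseval[of "P v0"] parseval[of "P v1"] order_trans[OF P(2) B(1)] order_trans[OF P(2) B(2)]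
    by (simp_all only: sums_iff)
  have CR0: "C j \<ge> 0" "R j \<ge> 0" for j using CR[of j] by (auto simp: energy_const_def)
  have Qgap: "Q.spectral_gap (\<rho>s j) (C j) (R j)" for j
  proof -
    let ?t = "\<lambda>k. if lam k > \<rho>s j then lam k * (C j * exp (R j * \<phi> (lam k)) * Q.E0 k) else 0"
    let ?t' = "\<lambda>k. if lam k > \<rho>s' j then lam k * (C j * exp (R j * \<phi> (lam k)) * E0 k) else 0"
    have pos: "0 \<le> lam k * (C j * exp (R j * \<phi> (lam k)) * E0 k)" for k
      using CR0 lam[of k] E0_nonneg[of k] by simp
    have "(\<Sum>k. ?t k) \<le> (\<Sum>k. ?t' k)"
    proof (rule suminf_le)
      show "?t k \<le> ?t' k" for k using S[of k j] pos[of k] by (auto simp: E0)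
      show "summable ?t"
        by (rule summable_comparison_test'[OF summable_weighted_E0[OF CR0[of j]], of 0]) (use pos in \<open>auto simp: E0\<close>)
      show "summable ?t'"
        by (rule summable_comparison_test'[OF summable_weighted_E0[OF CR0[of j]], of 0]) (use pos in auto)
    qed
    then show ?thesis using gap[of j] by (simp add: spectral_gap_def Q.spectral_gap_def)
  qed
  obtain h where h: "\<And>t. t \<ge> 0 \<Longrightarrow> h t \<ge> 0" "continuous_on {0..} h"
    "\<And>t. t \<ge> 0 \<Longrightarrow> Q.G (\<lambda>s. m (h s)) t = h t"
    "\<And>T. \<exists>M. summable M \<and> (\<forall>r>0. summable (\<lambda>k. lam k * M k * exp (r * \<phi> (lam k)))) \<and>
      (\<forall>k. \<forall>t\<in>{0..T}. (Q.V (\<lambda>s. m (h s)) k t)\<^sup>2 + (lam k)\<^sup>2 * (Q.U (\<lambda>s. m (h s)) k t)\<^sup>2 \<le> M k)"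
    by (rule Q.global_scalar_solution[OF Bn Bg Ts \<rho>s CR Qgap]) blast
  show thesis
  proof (rule that[OF _ _ P(1) P(1)])
    show "\<exists>u. global_solution e lam \<phi> m (P v0) (P v1) u" by (rule Q.global_solution_exists[OF h])
    show "P v0 \<in> gevrey_inf e lam \<phi> (3/4)" "P v1 \<in> gevrey_inf e lam \<phi> (1/4)"
      using Q.sa3 Q.sb1 by (simp_all add: gevrey_inf_34_iff gevrey_inf_14_iff lam)
  qed
qed

lemma splitting:
  obtains x0 x1 y0 y1 where "x0 \<in> gevrey_inf e lam \<phi> (3/4)" "x1 \<in> gevrey_inf e lam \<phi> (1/4)"
    "y0 \<in> gevrey_inf e lam \<phi> (3/4)" "y1 \<in> gevrey_inf e lam \<phi> (1/4)"
    "v0 = x0 + y0" "v1 = x1 + y1"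
    "\<exists>u. global_solution e lam \<phi> m x0 x1 u" "\<exists>u. global_solution e lam \<phi> m y0 y1 u"
proof -
  \<comment> \<open>One bound serves both summands, since restriction to a set of modes increases
    none of the three quantities.\<close>
  define B where "B = (norm v0)\<^sup>2 + (norm v1)\<^sup>2 + g0"
  have g00: "g0 \<ge> 0" unfolding g0_def by (intro suminf_nonneg summable_lam2_a2) auto
  have B: "(norm v0)\<^sup>2 \<le> B" "(norm v1)\<^sup>2 \<le> B" "g0 \<le> B" "B \<ge> 0" using g00 by (auto simp: B_def)
  have "\<forall>p. \<exists>q. fst p \<ge> 0 \<longrightarrow> snd p \<ge> 0 \<longrightarrow> energy_const B (fst p) (snd p) (fst q) (snd q)"
  proof
    fix p :: "real \<times> real"
    show "\<exists>q. fst p \<ge> 0 \<longrightarrow> snd p \<ge> 0 \<longrightarrow> energy_const B (fst p) (snd p) (fst q) (snd q)"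
    proof (cases "fst p \<ge> 0 \<and> snd p \<ge> 0")
      case True
      then obtain C R where "energy_const B (fst p) (snd p) C R" using energy_const_exists[OF B(4)] by blast
      then show ?thesis by (intro exI[of _ "(C, R)"]) simp
    qed blast
  qed
  from choice[OF this] obtain q where
    q: "\<forall>p. fst p \<ge> 0 \<longrightarrow> snd p \<ge> 0 \<longrightarrow> energy_const B (fst p) (snd p) (fst (q p)) (snd (q p))" ..
  define C where "C = (\<lambda>(n::nat) s. fst (q (real n, s)))"
  define R where "R = (\<lambda>(n::nat) s. snd (q (real n, s)))"
  have CR: "energy_const B (real n) s (C n s) (R n s)" if "s \<ge> 0" for n s
    using q[rule_format, of "(real n, s)"] that by (simp add: C_def R_def)
  \<comment> \<open>The next cutoff is chosen after the constants of the current one, with the index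
    as horizon. Steps of length at least 1 make the cutoffs unbounded, so every frequency falls into
    a block.\<close>
  have "\<exists>s. \<forall>n. s n \<ge> 1 \<and> (s (Suc n) \<ge> s n + 1 \<and> spectral_gap (s (Suc n)) (C n (s n)) (R n (s n)))"
  proof (rule dependent_nat_choice)
    fix x :: real and n assume x: "1 \<le> x"
    then have "C n x \<ge> 0" "R n x \<ge> 0" using CR[of x n] by (auto simp: energy_const_def)
    then obtain y where "y \<ge> x + 1" "spectral_gap y (C n x) (R n x)" by (rule spectral_gap_tail)
    with x show "\<exists>y. 1 \<le> y \<and> x + 1 \<le> y \<and> spectral_gap y (C n x) (R n x)" by (intro exI[of _ y]) auto
  qed auto
  then obtain s where s: "\<And>n. s n \<ge> 1" "\<And>n. s (Suc n) \<ge> s n + 1"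
    "\<And>n. spectral_gap (s (Suc n)) (C n (s n)) (R n (s n))" by blast
  have "s n \<le> s (Suc n)" for n using s(2)[of n] by linarith
  then have mono_s: "mono s" by (rule incseq_SucI)
  have s_ge: "s n \<ge> real n" for n
  proof (induction n)
    case 0 then show ?case using s(1)[of 0] by simp
  next
    case (Suc n) then show ?case using s(2)[of n] by simp
  qed
  \<comment> \<open>The index of the block containing \<open>lam k\<close>: block 0 reaches up to
    \<open>s 0\<close>, and block \<open>Suc n\<close> lies above \<open>s n\<close> and reaches up
    to \<open>s (Suc n)\<close>.\<close>
  define N where "N = (\<lambda>k. LEAST n. lam k \<le> s n)"
  have N: "lam k \<le> s (N k)" for k
    unfolding N_def
  proof (rule LeastI)
    show "lam k \<le> s (nat \<lceil>lam k\<rceil>)" using s_ge[of "nat \<lceil>lam k\<rceil>"] real_nat_ceiling_ge[of "lam k"] by linarith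
  qed
  have N_less: "n < N k" if "lam k > s n" for n k
  proof (rule ccontr)
    assume "\<not> n < N k"
    then have "s (N k) \<le> s n" by (intro monoD[OF mono_s]) simp
    then show False using N[of k] that by linarith
  qed
  \<comment> \<open>Block \<open>Suc n\<close> has the opposite parity to \<open>n\<close>, so it is
    missing from the summand whose blocks have the parity of \<open>n\<close>.\<close>
  have gap: "lam k > s (Suc n)" if "lam k > s n" "even (N k) \<longleftrightarrow> even n" for k n
  proof -
    have "N k \<noteq> Suc n" using that(2) by auto
    then have "Suc n < N k" using N_less[OF that(1)] by simp
    then show ?thesis using not_less_Least[of "Suc n" "\<lambda>n. lam k \<le> s n"] by (simp add: N_def)
  qed
  \<comment> \<open>The summand of parity \<open>p\<close> has its gaps just above the cutoffs with
    indices \<open>2 * j + p\<close>. These indices also serve as horizons, and they exceed every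
    bound.\<close>
  have part: "\<exists>x0 x1. x0 \<in> gevrey_inf e lam \<phi> (3/4) \<and> x1 \<in> gevrey_inf e lam \<phi> (1/4) \<and>
    (\<forall>k. inner x0 (e k) = (if k \<in> {k. even (N k) \<longleftrightarrow> even p} then inner v0 (e k) else 0)) \<and>
    (\<forall>k. inner x1 (e k) = (if k \<in> {k. even (N k) \<longleftrightarrow> even p} then inner v1 (e k) else 0)) \<and>
    (\<exists>u. global_solution e lam \<phi> m x0 x1 u)" for p :: nat
  proof (rule restricted_solution[where S = "{k. even (N k) \<longleftrightarrow> even p}" and Ts = "\<lambda>j. real (2 * j + p)"
      and \<rho>s = "\<lambda>j. s (2 * j + p)" and \<rho>s' = "\<lambda>j. s (Suc (2 * j + p))"
      and C = "\<lambda>j. C (2 * j + p) (s (2 * j + p))" and R = "\<lambda>j. R (2 * j + p) (s (2 * j + p))", OF B(1-3)])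
    show "mono (\<lambda>j. real (2 * j + p))" by (auto simp: mono_def)
    show "mono (\<lambda>j. s (2 * j + p))" by (auto simp: mono_def intro!: monoD[OF mono_s])
    show "energy_const B (real (2 * j + p)) (s (2 * j + p)) (C (2 * j + p) (s (2 * j + p))) (R (2 * j + p) (s (2 * j + p)))" for j
      by (rule CR) (use s(1)[of "2 * j + p"] in linarith)
    show "lam k > s (Suc (2 * j + p))" if "k \<in> {k. even (N k) \<longleftrightarrow> even p}" "lam k > s (2 * j + p)" for j k
      using that by (intro gap) simp_all
    show "spectral_gap (s (Suc (2 * j + p))) (C (2 * j + p) (s (2 * j + p))) (R (2 * j + p) (s (2 * j + p)))" for j
      by (rule s(3))
    show "1 \<le> s (2 * j + p)" for j by (rule s(1))
    show "real j \<le> real (2 * j + p)" for j by simp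
  qed blast
  from part[of 0] obtain x0 x1 where x: "x0 \<in> gevrey_inf e lam \<phi> (3/4)" "x1 \<in> gevrey_inf e lam \<phi> (1/4)"
    "\<And>k. inner x0 (e k) = (if even (N k) then inner v0 (e k) else 0)"
    "\<And>k. inner x1 (e k) = (if even (N k) then inner v1 (e k) else 0)"
    "\<exists>u. global_solution e lam \<phi> m x0 x1 u" by auto
  from part[of 1] obtain y0 y1 where y: "y0 \<in> gevrey_inf e lam \<phi> (3/4)" "y1 \<in> gevrey_inf e lam \<phi> (1/4)"
    "\<And>k. inner y0 (e k) = (if odd (N k) then inner v0 (e k) else 0)"
    "\<And>k. inner y1 (e k) = (if odd (N k) then inner v1 (e k) else 0)"
    "\<exists>u. global_solution e lam \<phi> m y0 y1 u" by auto
  have eqI: "w = z" if "\<And>k. inner w (e k) = inner z (e k)" for w z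
    by (subst (1 2) expansion_eq[symmetric]) (simp only: that)
  have "v0 = x0 + y0" "v1 = x1 + y1" by (rule eqI, simp add: inner_add_left x y)+
  from this show thesis by (rule that[OF x(1,2) y(1,2) _ _ x(5) y(5)])
qed

end

theorem mainTheorem3:
  fixes D :: "'a::{real_inner, complete_space} set"
    and A :: "'a \<Rightarrow> 'a"
    and e :: "nat \<Rightarrow> 'a"
    and lam :: "nat \<Rightarrow> real"
    and \<omega> m \<phi> :: "real \<Rightarrow> real"
    and u0 u1 :: 'a
  assumes "self_adjoint D A"
    and "nonnegative_operator D A"
    and "eigen_system D A e lam"
    and "continuity_modulus \<omega>"
    and "\<forall>x\<ge>0. m x \<ge> 0"
    and "\<exists>L. \<forall>a\<ge>0. \<forall>b\<ge>0. \<bar>m a - m b\<bar> \<le> L * \<omega> \<bar>a - b\<bar>"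
    and "\<forall>x\<ge>0. \<phi> x > 0"
    and "\<exists>\<Lambda>.
       ((\<exists>\<nu>>0. \<forall>\<sigma>\<ge>0. m \<sigma> \<ge> \<nu>) \<and> (\<forall>\<sigma>>0. \<sigma> * \<omega> (1 / \<sigma>) \<le> \<Lambda> * \<phi> \<sigma>)) \<or>
       ((\<forall>\<sigma>\<ge>0. m \<sigma> \<ge> 0) \<and> (\<forall>\<sigma>>0. \<sigma> \<le> \<Lambda> * \<phi> (\<sigma> / sqrt (\<omega> (1 / \<sigma>)))))"
    and "u0 \<in> gevrey_inf e lam \<phi> (3/4)"
    and "u1 \<in> gevrey_inf e lam \<phi> (1/4)"
  shows "\<exists>v0 v1 w0 w1.
     v0 \<in> gevrey_inf e lam \<phi> (3/4) \<and> v1 \<in> gevrey_inf e lam \<phi> (1/4) \<and>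
     w0 \<in> gevrey_inf e lam \<phi> (3/4) \<and> w1 \<in> gevrey_inf e lam \<phi> (1/4) \<and>
     u0 = v0 + w0 \<and> u1 = v1 + w1 \<and>
     (\<exists>u. global_solution e lam \<phi> m v0 v1 u) \<and>
     (\<exists>u. global_solution e lam \<phi> m w0 w1 u)"
proof -
  obtain L where L: "\<And>a b. a \<ge> 0 \<Longrightarrow> b \<ge> 0 \<Longrightarrow> \<bar>m a - m b\<bar> \<le> L * \<omega> \<bar>a - b\<bar>" using assms(6) by blast
  obtain \<Lambda> where \<Lambda>: "((\<exists>\<nu>>0. \<forall>\<sigma>\<ge>0. m \<sigma> \<ge> \<nu>) \<and> (\<forall>\<sigma>>0. \<sigma> * \<omega> (1 / \<sigma>) \<le> \<Lambda> * \<phi> \<sigma>)) \<or>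
       ((\<forall>\<sigma>\<ge>0. m \<sigma> \<ge> 0) \<and> (\<forall>\<sigma>>0. \<sigma> \<le> \<Lambda> * \<phi> (\<sigma> / sqrt (\<omega> (1 / \<sigma>)))))"
    using assms(8) by blast
  have \<omega>: "\<omega> x \<ge> 0" if "x \<ge> 0" for x
    using assms(4) that unfolding continuity_modulus_def by (cases "x = 0") (auto intro: less_imp_le)
  have lam: "lam k \<ge> 0" for k using assms(3) by (simp add: eigen_system_def)
  interpret onb e by unfold_locales (use assms(3) in \<open>simp add: eigen_system_def\<close>)
  \<comment> \<open>The given constant may have either sign; \<open>\<bar>L\<bar>\<close> is
    admissible because \<open>\<omega>\<close> is nonnegative.\<close>
  interpret kirchhoff_data \<omega> m \<phi> "\<bar>L\<bar>" \<Lambda> lam u0 u1 e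
  proof unfold_locales
    show "continuity_modulus \<omega>" by fact
    show "m x \<ge> 0" if "x \<ge> 0" for x using assms(5) that by blast
    show "\<bar>m a - m b\<bar> \<le> \<bar>L\<bar> * \<omega> \<bar>a - b\<bar>" if "a \<ge> 0" "b \<ge> 0" for a b
      using L[OF that] mult_right_mono[OF abs_ge_self[of L] \<omega>[of "\<bar>a - b\<bar>"]] by simp
    show "\<phi> x > 0" if "x \<ge> 0" for x using assms(7) that by blast
    show "((\<exists>\<nu>>0. \<forall>\<sigma>\<ge>0. m \<sigma> \<ge> \<nu>) \<and> (\<forall>\<sigma>>0. \<sigma> * \<omega> (1 / \<sigma>) \<le> \<Lambda> * \<phi> \<sigma>)) \<or>
       ((\<forall>\<sigma>\<ge>0. m \<sigma> \<ge> 0) \<and> (\<forall>\<sigma>>0. \<sigma> \<le> \<Lambda> * \<phi> (\<sigma> / sqrt (\<omega> (1 / \<sigma>)))))" by fact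
    show "summable (\<lambda>k. lam k ^ 3 * (inner u0 (e k))\<^sup>2 * exp (r * \<phi> (lam k)))" if "r > 0" for r
      using assms(9) that by (simp add: gevrey_inf_34_iff lam)
    show "summable (\<lambda>k. lam k * (inner u1 (e k))\<^sup>2 * exp (r * \<phi> (lam k)))" if "r > 0" for r
      using assms(10) that by (simp add: gevrey_inf_14_iff lam)
  qed (use lam bessel in auto)
  show ?thesis by (rule splitting) blast
qed

end
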